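(* Let $\varphi$ be a non-constant entire function of exponential type and let $C_\varphi:=\{z\in\mathbb{C}: |\varphi(z)|=1\}$. Then for every compact and convex set $K\subset\mathbb{C}$ with $K\cap C_\varphi\neq\emptyset$ there exists a function $f\in\mathcal{HC}(\varphi(D),H(\mathbb{C}))$ that is of exponential type and satisfies $K(f)=K$.
   Context: $H(\mathbb{C})$ is the space of entire functions with the topology of locally uniform convergence. An entire function $f$ is of exponential type if $\limsup_{r\to\infty}\frac{\log M_f(r)}{r}<+\infty$, where $M_f(r)=\max_{|z|=r}|f(z)|$. For an entire function $\varphi(z)=\sum_{n\ge 0}c_nz^n$ of exponential type, the differential operator $\varphi(D):H(\mathbb{C})\to H(\mathbb{C})$ is the continuous linear operator $\varphi(D)f=\sum_{n\ge0}c_nf^{(n)}$. For a continuous linear operator $T:X\to X$ on a topological vector space $X$, $\mathcal{HC}(T,X)$ is the set of hypercyclic vectors, i.e. of all $x\in X$ such that $\{T^nx:n\in\mathbb{N}\}$ is dense in $X$. For an entire function $f$ of exponential type, $K(f)\subset\mathbb{C}$ denotes its conjugate indicator diagram: the smallest compact convex set such that the Borel transform $\mathcal{B}f(z)=\sum_{n\ge0}f^{(n)}(0)/z^{n+1}$ (holomorphic near $\infty$) has an analytic continuation to $\mathbb{C}\setminus K(f)$ ($K(0)=\emptyset$). Equivalently, $K(f)$ is the compact convex set with $r\,h_f(\Theta)=\sup\{\mathrm{Re}(re^{i\Theta}u):u\in K(f)\}$, where $h_f(\Theta)=\limsup_{r\to\infty}\frac{\log|f(re^{i\Theta})|}{r}$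 is the indicator function. *)

theory Defs
  imports "HOL-Complex_Analysis.Complex_Analysis"
begin

section \<open>The space of entire functions\<close>

definition entire :: "(complex \<Rightarrow> complex) set" where
  "entire = {f. f holomorphic_on UNIV}"

text \<open>Locally uniform convergence: the sets of all entire \<open>g\<close> that are \<open>e\<close>-close to \<open>f\<close> on a
  compact set \<open>C\<close> form a neighbourhood base at \<open>f\<close>.\<close>

definition entire_nbhd :: "(complex \<Rightarrow> complex) \<Rightarrow> complex set \<Rightarrow> real \<Rightarrow> (complex \<Rightarrow> complex) set" where
  "entire_nbhd f C e = {g \<in> entire. \<forall>z\<in>C. dist (g z) (f z) < e}"

definition entire_topology :: "(complex \<Rightarrow> complex) topology" where
  "entire_topology = topology (\<lambda>U. U \<subseteq> entire \<and>
     (\<forall>f\<in>U. \<exists>C e. compact C \<and> 0 < e \<and> entire_nbhd f C e \<subseteq> U))"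

lemma openin_entire_topology:
  "openin entire_topology U \<longleftrightarrow>
     U \<subseteq> entire \<and> (\<forall>f\<in>U. \<exists>C e. compact C \<and> 0 < e \<and> entire_nbhd f C e \<subseteq> U)"
proof -
  let ?L = "\<lambda>U. U \<subseteq> entire \<and>
    (\<forall>f\<in>U. \<exists>C e. compact C \<and> 0 < e \<and> entire_nbhd f C e \<subseteq> U)"
  have "istopology ?L"
    unfolding istopology_def
  proof (intro conjI allI impI)
    fix S T assume S: "?L S" and T: "?L T"
    show "S \<inter> T \<subseteq> entire" using S by blast
    show "\<forall>f\<in>S \<inter> T. \<exists>C e. compact C \<and> 0 < e \<and> entire_nbhd f C e \<subseteq> S \<inter> T"
    proof
      fix f assume f: "f \<in> S \<inter> T"
      obtain C e where 1: "compact C" "0 < e" "entire_nbhd f C e \<subseteq> S" using S f by blast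
      obtain C' e' where 2: "compact C'" "0 < e'" "entire_nbhd f C' e' \<subseteq> T" using T f by blast
      have "entire_nbhd f (C \<union> C') (min e e') \<subseteq> S \<inter> T"
        using 1(3) 2(3) by (auto simp: entire_nbhd_def)
      then show "\<exists>C e. compact C \<and> 0 < e \<and> entire_nbhd f C e \<subseteq> S \<inter> T"
        using 1 2 by (metis compact_Un min_less_iff_conj)
    qed
  next
    fix \<K> assume K: "\<forall>S\<in>\<K>. ?L S"
    show "\<Union>\<K> \<subseteq> entire" using K by blast
    show "\<forall>f\<in>\<Union>\<K>. \<exists>C e. compact C \<and> 0 < e \<and> entire_nbhd f C e \<subseteq> \<Union>\<K>"
      using K by (meson Union_iff Union_upper order_trans)
  qed
  then show ?thesis
    by (simp add: entire_topology_def topology_inverse')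
qed

lemma topspace_entire_topology [simp]: "topspace entire_topology = entire"
proof
  show "topspace entire_topology \<subseteq> entire"
    using openin_entire_topology openin_topspace by blast
  have "openin entire_topology entire"
    unfolding openin_entire_topology
    by (auto simp: entire_nbhd_def intro!: exI[of _ "{}"] exI[of _ "1::real"])
  then show "entire \<subseteq> topspace entire_topology"
    by (rule openin_subset)
qed

lemma openin_entire_nbhd:
  assumes "f \<in> entire" "compact C"
  shows "openin entire_topology (entire_nbhd f C e)"
  unfolding openin_entire_topology
proof (intro conjI ballI)
  show "entire_nbhd f C e \<subseteq> entire" by (auto simp: entire_nbhd_def)
  fix g assume g: "g \<in> entire_nbhd f C e"
  have "\<exists>d>0. \<forall>z\<in>C. dist (g z) (f z) \<le> e - d"
  proof (cases "C = {}")
    case False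
    have cont: "continuous_on C (\<lambda>z. dist (g z) (f z))"
      using g assms
      by (auto simp: entire_nbhd_def entire_def
          intro!: continuous_intros holomorphic_on_imp_continuous_on
          elim: holomorphic_on_subset)
    obtain w where w: "w \<in> C" "\<And>z. z \<in> C \<Longrightarrow> dist (g z) (f z) \<le> dist (g w) (f w)"
      using continuous_attains_sup[OF assms(2) False cont] by blast
    then show ?thesis
      using g by (intro exI[of _ "e - dist (g w) (f w)"]) (auto simp: entire_nbhd_def)
  qed (auto intro: exI[of _ 1])
  then obtain d where d: "d > 0" "\<And>z. z \<in> C \<Longrightarrow> dist (g z) (f z) \<le> e - d" by blast
  have "entire_nbhd g C d \<subseteq> entire_nbhd f C e"
  proof
    fix h assume h: "h \<in> entire_nbhd g C d"
    have "dist (h z) (f z) < e" if "z \<in> C" for z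
      using d(2)[OF that] h that dist_triangle[of "h z" "f z" "g z"]
      by (force simp: entire_nbhd_def)
    then show "h \<in> entire_nbhd f C e" using h by (auto simp: entire_nbhd_def)
  qed
  then show "\<exists>D d. compact D \<and> 0 < d \<and> entire_nbhd g D d \<subseteq> entire_nbhd f C e"
    using assms d by blast
qed

section \<open>Hypercyclic vectors\<close>

definition hypercyclic_vectors :: "('a \<Rightarrow> 'a) \<Rightarrow> 'a topology \<Rightarrow> 'a set" where
  "hypercyclic_vectors T X =
     {x \<in> topspace X. X closure_of (range (\<lambda>n. (T ^^ n) x)) = topspace X}"

lemma hypercyclic_vectors_entire_iff:
  "f \<in> hypercyclic_vectors T entire_topology \<longleftrightarrow> f \<in> entire \<and>
     (\<forall>g\<in>entire. \<forall>C e. compact C \<longrightarrow> 0 < e \<longrightarrow> (\<exists>n. (T ^^ n) f \<in> entire_nbhd g C e))"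
proof -
  have "g \<in> entire_topology closure_of (range (\<lambda>n. (T ^^ n) f)) \<longleftrightarrow>
      (\<forall>C e. compact C \<longrightarrow> 0 < e \<longrightarrow> (\<exists>n. (T ^^ n) f \<in> entire_nbhd g C e))"
    if g: "g \<in> entire" for g
  proof
    assume L: "g \<in> entire_topology closure_of (range (\<lambda>n. (T ^^ n) f))"
    show "\<forall>C e. compact C \<longrightarrow> 0 < e \<longrightarrow> (\<exists>n. (T ^^ n) f \<in> entire_nbhd g C e)"
    proof (intro allI impI)
      fix C :: "complex set" and e :: real assume "compact C" "0 < e"
      then have "openin entire_topology (entire_nbhd g C e)" "g \<in> entire_nbhd g C e"
        using openin_entire_nbhd[OF g] g by (auto simp: entire_nbhd_def)
      then show "\<exists>n. (T ^^ n) f \<in> entire_nbhd g C e"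
        using L unfolding in_closure_of by blast
    qed
  next
    assume R: "\<forall>C e. compact C \<longrightarrow> 0 < e \<longrightarrow> (\<exists>n. (T ^^ n) f \<in> entire_nbhd g C e)"
    then show "g \<in> entire_topology closure_of (range (\<lambda>n. (T ^^ n) f))"
      using g unfolding in_closure_of openin_entire_topology topspace_entire_topology
      by (metis (no_types, lifting) rangeI subset_iff)
  qed
  moreover have "entire_topology closure_of (range (\<lambda>n. (T ^^ n) f)) = entire \<longleftrightarrow>
      (\<forall>g\<in>entire. g \<in> entire_topology closure_of (range (\<lambda>n. (T ^^ n) f)))"
    using closure_of_subset_topspace[of entire_topology "range (\<lambda>n. (T ^^ n) f)"]
    by (simp only: topspace_entire_topology set_eq_subset subset_iff Ball_def) metis
  ultimately show ?thesis
    by (simp add: hypercyclic_vectors_def)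
qed

section \<open>Exponential type and differential operators\<close>

definition max_modulus :: "(complex \<Rightarrow> complex) \<Rightarrow> real \<Rightarrow> real" where
  "max_modulus f r = (SUP z\<in>sphere 0 r. norm (f z))"

text \<open>For \<open>f = 0\<close> the convention \<open>ln 0 = 0\<close> replaces \<open>-\<infinity>\<close> by \<open>0\<close>; either way the zero function is
  of exponential type.\<close>

definition exponential_type :: "(complex \<Rightarrow> complex) \<Rightarrow> bool" where
  "exponential_type f \<longleftrightarrow> f \<in> entire \<and>
     Limsup at_top (\<lambda>r. ereal (ln (max_modulus f r) / r)) < \<infinity>"

definition taylor_coeff :: "(complex \<Rightarrow> complex) \<Rightarrow> nat \<Rightarrow> complex" where
  "taylor_coeff \<phi> n = (deriv ^^ n) \<phi> 0 / fact n"

text \<open>The series is summed pointwise. For entire \<open>f\<close> and \<open>\<phi>\<close> of exponential type it converges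
  locally uniformly, so this is also its sum in the space of entire functions.\<close>

definition diff_op :: "(complex \<Rightarrow> complex) \<Rightarrow> (complex \<Rightarrow> complex) \<Rightarrow> (complex \<Rightarrow> complex)" where
  "diff_op \<phi> f = (\<lambda>z. \<Sum>n. taylor_coeff \<phi> n * (deriv ^^ n) f z)"

section \<open>Conjugate indicator diagram\<close>

text \<open>For \<open>f\<close> of exponential type the series converges for all \<open>z\<close> of large modulus; elsewhere the
  value is irrelevant, as only the germ at infinity is used below.\<close>

definition borel_transform :: "(complex \<Rightarrow> complex) \<Rightarrow> complex \<Rightarrow> complex" where
  "borel_transform f z = (\<Sum>n. (deriv ^^ n) f 0 / z ^ (n + 1))"

definition borel_continues_off :: "(complex \<Rightarrow> complex) \<Rightarrow> complex set \<Rightarrow> bool" where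
  "borel_continues_off f K \<longleftrightarrow>
     (\<exists>F. F holomorphic_on (- K) \<and> (\<forall>\<^sub>F z in at_infinity. F z = borel_transform f z))"

text \<open>\<open>Least\<close> is taken with respect to set inclusion.\<close>

definition conj_indicator_diagram :: "(complex \<Rightarrow> complex) \<Rightarrow> complex set" where
  "conj_indicator_diagram f = (LEAST K. compact K \<and> convex K \<and> borel_continues_off f K)"

end

theory Submission
  imports Defs
begin

text \<open>
  Fix \<open>w \<in> K\<close> with \<open>|\<phi>(w)| = 1\<close>. If \<open>G\<close> is holomorphic off \<open>K\<close>, then
  \<open>f(z) = (2\<pi>i)\<^bsup>-1\<^esup> \<integral> G(\<xi>) e\<^bsup>\<xi>z\<^esup> d\<xi>\<close> over a large circle is of exponential type, its Borel transform is
  the germ of \<open>G\<close> at infinity, and \<open>\<phi>(D)\<close> acts as multiplication of \<open>G\<close> by \<open>\<phi>\<close>. Take for \<open>G\<close> a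
  generic locally uniform limit, on the complement of \<open>K\<close>, of principal parts at \<open>w\<close>. Genericity
  means countably many requirements that are open and dense: the orbit of \<open>f\<close> comes close to every
  function \<open>p(z) e\<^bsup>wz\<^esup>\<close>, \<open>p\<close> a polynomial, and the Laurent coefficients of \<open>G\<close> about each point \<open>c\<close> of
  a countable dense set grow faster than \<open>r\<^sup>n\<close> whenever \<open>K\<close> is not contained in the disc of radius
  \<open>r\<close> about \<open>c\<close>. As a compact convex set is an intersection of discs, the latter forces \<open>K(f) = K\<close>.

  Density of the orbit requirements: near \<open>w\<close> write \<open>\<phi> = \<phi>(w) e\<^sup>s\<close> with \<open>s(w) = 0\<close>. For a fixed
  holomorphic \<open>h\<close>, let \<open>x\<^sup>j\<close> correspond to the principal part of \<open>j! h / s\<^bsup>j+1\<^esup>\<close>. Then \<open>\<phi>(D)\<^sup>n\<close> becomes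
  \<open>\<phi>(w)\<^sup>n\<close> times the translation \<open>P(x) \<mapsto> P(x + n)\<close> of polynomials, and a translation steers
  \<open>x\<^bsup>m+1\<^esup> (x - n)\<^sup>m / n\<^bsup>m+1\<^esup> \<longrightarrow> 0\<close> to \<open>x\<^sup>m (x/n + 1)\<^bsup>m+1\<^esup> \<longrightarrow> x\<^sup>m\<close>, and similarly \<open>x\<^sup>m\<close> to \<open>0\<close>. Density of
  the growth requirements: perturb by a small multiple of \<open>1 / (\<xi> - \<mu>)\<close> with \<open>\<mu> \<in> K\<close>, after
  pushing the pole \<open>\<mu>\<close> to \<open>w\<close> along a segment inside \<open>K\<close>.
\<close>

section \<open>Exponential transforms of functions on a circle\<close>

definition cint :: "complex \<Rightarrow> real \<Rightarrow> (complex \<Rightarrow> complex) \<Rightarrow> complex" where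
  "cint w R g = contour_integral (circlepath w R) g / (2 * of_real pi * \<i>)"

lemma cint_integrable:
  assumes "continuous_on (sphere w R) g" "0 < R"
  shows "g contour_integrable_on circlepath w R"
  using assms by (intro contour_integrable_continuous_circlepath) simp

lemma cint_cong:
  assumes "0 < R" "\<And>\<xi>. \<xi> \<in> sphere w R \<Longrightarrow> g \<xi> = g' \<xi>"
  shows "cint w R g = cint w R g'"
  unfolding cint_def using assms by (intro arg_cong2[where f = "(/)"] contour_integral_eq) auto

lemma cint_add:
  assumes "0 < R" "continuous_on (sphere w R) g" "continuous_on (sphere w R) h"
  shows "cint w R (\<lambda>\<xi>. g \<xi> + h \<xi>) = cint w R g + cint w R h"
  using assms by (simp add: cint_def contour_integral_add cint_integrable add_divide_distrib)

lemma cint_diff: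
  assumes "0 < R" "continuous_on (sphere w R) g" "continuous_on (sphere w R) h"
  shows "cint w R (\<lambda>\<xi>. g \<xi> - h \<xi>) = cint w R g - cint w R h"
  using assms by (simp add: cint_def contour_integral_diff cint_integrable diff_divide_distrib)

lemma cint_cmult:
  assumes "0 < R" "continuous_on (sphere w R) g"
  shows "cint w R (\<lambda>\<xi>. c * g \<xi>) = c * cint w R g"
  using assms by (simp add: cint_def contour_integral_lmul cint_integrable)

lemma cint_0 [simp]: "cint w R (\<lambda>\<xi>. 0) = 0"
  by (simp add: cint_def)

lemma cint_sum:
  assumes "0 < R" "finite A" "\<And>i. i \<in> A \<Longrightarrow> continuous_on (sphere w R) (g i)"
  shows "cint w R (\<lambda>\<xi>. \<Sum>i\<in>A. g i \<xi>) = (\<Sum>i\<in>A. cint w R (g i))"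
  using assms(2,3)
proof (induction A rule: finite_induct)
  case (insert x A)
  have "cint w R (\<lambda>\<xi>. g x \<xi> + (\<Sum>i\<in>A. g i \<xi>)) = cint w R (g x) + cint w R (\<lambda>\<xi>. \<Sum>i\<in>A. g i \<xi>)"
    using insert assms(1) by (intro cint_add continuous_on_sum) auto
  with insert show ?case by simp
qed simp

lemma cint_bound:
  assumes R: "0 < R" and g: "continuous_on (sphere w R) g"
    and B: "\<And>\<xi>. \<xi> \<in> sphere w R \<Longrightarrow> norm (g \<xi>) \<le> B"
  shows "norm (cint w R g) \<le> R * B"
proof -
  \<comment> \<open>The circle estimate asks for a nonnegative bound; this is read off at the point
    \<open>w + R\<close> of the circle.\<close>
  have "0 \<le> norm (g (w + of_real R))" by simp
  also have "norm (g (w + of_real R)) \<le> B" using R by (intro B) (simp add: dist_norm)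
  finally have "0 \<le> B" .
  then have "norm (contour_integral (circlepath w R) g) \<le> B * (2 * pi * R)"
    using R B has_contour_integral_integral[OF cint_integrable[OF g R]]
    by (intro has_contour_integral_bound_circlepath) (auto simp: dist_norm norm_minus_commute)
  then show ?thesis
    using R by (simp add: cint_def norm_divide norm_mult field_simps)
qed

text \<open>The M-test makes the partial sums converge uniformly on the circle, so integration
  passes to the limit.\<close>

lemma cint_sums:
  assumes R: "0 < R" and u: "\<And>n. continuous_on (sphere w R) (u n)"
    and g: "\<And>\<xi>. \<xi> \<in> sphere w R \<Longrightarrow> (\<lambda>n. u n \<xi>) sums g \<xi>"
    and M: "\<And>n \<xi>. \<xi> \<in> sphere w R \<Longrightarrow> norm (u n \<xi>) \<le> M n" "summable M"
  shows "(\<lambda>n. cint w R (u n)) sums cint w R g"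
proof -
  have eq: "(\<Sum>i. u i \<xi>) = g \<xi>" if "\<xi> \<in> sphere w R" for \<xi>
    using g[OF that] by (simp add: sums_iff)
  have "uniform_limit (sphere w R) (\<lambda>n \<xi>. \<Sum>i<n. u i \<xi>) (\<lambda>\<xi>. \<Sum>i. u i \<xi>) sequentially"
    using M by (rule Weierstrass_m_test)
  then have "uniform_limit (sphere w R) (\<lambda>n \<xi>. \<Sum>i<n. u i \<xi>) g sequentially"
    by (rule uniform_limit_cong'[THEN iffD1, rotated -1]) (use eq in auto)
  then have "(\<lambda>n. contour_integral (circlepath w R) (\<lambda>\<xi>. \<Sum>i<n. u i \<xi>))
               \<longlonglongrightarrow> contour_integral (circlepath w R) g"
    using R u by (intro contour_integral_uniform_limit_circlepath(2))
      (auto intro!: always_eventually cint_integrable continuous_on_sum)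
  then have "(\<lambda>n. cint w R (\<lambda>\<xi>. \<Sum>i<n. u i \<xi>)) \<longlonglongrightarrow> cint w R g"
    unfolding cint_def by (intro tendsto_divide tendsto_const) auto
  then show ?thesis
    using R u by (simp add: sums_def cint_sum)
qed

lemma cint_Cauchy:
  assumes "0 < R" "g holomorphic_on cball w R" "z \<in> ball w R"
  shows "cint w R (\<lambda>\<xi>. g \<xi> / (\<xi> - z)) = g z"
proof -
  have "((\<lambda>\<xi>. g \<xi> / (\<xi> - z)) has_contour_integral (2 * of_real pi * \<i>) * g z) (circlepath w R)"
    using assms by (intro Cauchy_integral_circlepath)
      (auto simp: dist_norm norm_minus_commute intro: holomorphic_on_imp_continuous_on holomorphic_on_subset)
  from contour_integral_unique[OF this] show ?thesis by (simp add: cint_def)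
qed

lemma cint_Cauchy_higher:
  assumes "0 < R" "g holomorphic_on cball w R"
  shows "cint w R (\<lambda>\<xi>. g \<xi> / (\<xi> - w) ^ Suc k) = (deriv ^^ k) g w / fact k"
proof -
  have "((\<lambda>\<xi>. g \<xi> / (\<xi> - w) ^ Suc k) has_contour_integral (2 * pi * \<i>) / (fact k) * (deriv ^^ k) g w)
     (circlepath w R)"
    using assms by (intro Cauchy_has_contour_integral_higher_derivative_circlepath)
      (auto intro: holomorphic_on_imp_continuous_on holomorphic_on_subset)
  from contour_integral_unique[OF this] show ?thesis by (simp add: cint_def)
qed

text \<open>Cauchy's theorem comes out of the integral formula at the centre: multiplying and
  dividing by \<open>\<xi> - w\<close> gives a Cauchy kernel whose numerator vanishes at
  \<open>w\<close>.\<close>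

lemma cint_holomorphic:
  assumes "0 < R" "g holomorphic_on cball w R"
  shows "cint w R g = 0"
proof -
  have "cint w R (\<lambda>\<xi>. (g \<xi> * (\<xi> - w)) / (\<xi> - w)) = g w * (w - w)"
    using assms by (intro cint_Cauchy holomorphic_intros) auto
  moreover have "cint w R (\<lambda>\<xi>. (g \<xi> * (\<xi> - w)) / (\<xi> - w)) = cint w R g"
    using assms by (intro cint_cong) auto
  ultimately show ?thesis by simp
qed

lemma cint_radius:
  assumes "open S" "g holomorphic_on S - {w}" "0 < r" "r \<le> R" "cball w R \<subseteq> S"
  shows "cint w R g = cint w r g"
  using contour_integral_circlepath_eq(3)[OF assms] by (simp add: cint_def)

section \<open>The transform and the action of differential operators on it\<close>

text \<open>Polya's inversion of the Borel transform. Expanding the exponential in \<open>z\<close>,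
  the derivatives at 0 are the moments of \<open>g\<close> on the circle; if \<open>g\<close> is
  holomorphic outside and vanishes at infinity, these are its Laurent coefficients at
  infinity.\<close>

definition exp_transform :: "complex \<Rightarrow> real \<Rightarrow> (complex \<Rightarrow> complex) \<Rightarrow> complex \<Rightarrow> complex" where
  "exp_transform w R g z = cint w R (\<lambda>\<xi>. g \<xi> * exp (\<xi> * z))"

text \<open>Differentiation under the integral sign over the parameter interval of the circle;
  \<open>c2\<close> is the joint continuity that Leibniz' rule asks for.\<close>

lemma exp_transform_has_field_derivative:
  assumes R: "0 < R" and g: "continuous_on (sphere w R) g"
  shows "(exp_transform w R g has_field_derivative exp_transform w R (\<lambda>\<xi>. \<xi> * g \<xi>) z) (at z)"
proof -
  define \<gamma> where "\<gamma> = circlepath w R"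
  define \<gamma>' where "\<gamma>' = (\<lambda>x::real. 2 * of_real pi * \<i> * of_real R * exp (2 * of_real pi * \<i> * of_real x))"
  have \<gamma>': "vector_derivative \<gamma> (at x) = \<gamma>' x" for x
    by (simp add: \<gamma>_def \<gamma>'_def vector_derivative_circlepath)
  have \<gamma>: "continuous_on {0..1} \<gamma>" "\<gamma> ` {0..1} = sphere w R"
    using R path_circlepath[of w R] path_image_circlepath_nonneg[of R w]
    by (auto simp: \<gamma>_def path_def path_image_def)
  have g\<gamma>: "continuous_on {0..1} (\<lambda>t. g (\<gamma> t))"
    using g \<gamma> by (metis continuous_on_compose2 order_refl)
  have \<gamma>'c: "continuous_on A \<gamma>'" for A
    unfolding \<gamma>'_def by (intro continuous_intros)
  have eq: "exp_transform w R h z =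
      integral {0..1} (\<lambda>t. h (\<gamma> t) * exp (\<gamma> t * z) * \<gamma>' t) / (2 * of_real pi * \<i>)" for h z
    by (simp add: exp_transform_def cint_def contour_integral_integral \<gamma>' flip: \<gamma>_def)
  have c2: "continuous_on (UNIV \<times> {0..1}) (\<lambda>(x, t). \<gamma> t * g (\<gamma> t) * exp (\<gamma> t * x) * \<gamma>' t)"
    unfolding split_beta
    by (intro continuous_intros continuous_on_compose2[OF \<gamma>(1)] continuous_on_compose2[OF g\<gamma>]
        continuous_on_compose2[OF \<gamma>'c[of UNIV]]) auto
  have "((\<lambda>x. integral (cbox 0 1) (\<lambda>t. g (\<gamma> t) * exp (\<gamma> t * x) * \<gamma>' t)) has_field_derivative
      integral (cbox 0 1) (\<lambda>t. \<gamma> t * g (\<gamma> t) * exp (\<gamma> t * z) * \<gamma>' t)) (at z within UNIV)"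
  proof (rule leibniz_rule_field_derivative)
    show "((\<lambda>x. g (\<gamma> t) * exp (\<gamma> t * x) * \<gamma>' t) has_field_derivative
        \<gamma> t * g (\<gamma> t) * exp (\<gamma> t * x) * \<gamma>' t) (at x within UNIV)" for x t
      by (auto intro!: derivative_eq_intros)
    show "(\<lambda>t. g (\<gamma> t) * exp (\<gamma> t * x) * \<gamma>' t) integrable_on cbox 0 1" for x
      using g\<gamma> \<gamma> \<gamma>'c by (intro integrable_continuous continuous_intros) auto
    show "continuous_on (UNIV \<times> cbox 0 1) (\<lambda>(x, t). \<gamma> t * g (\<gamma> t) * exp (\<gamma> t * x) * \<gamma>' t)"
      using c2 by simp
  qed auto
  then show ?thesis
    unfolding eq[abs_def] by (intro DERIV_cdivide) simp
qed

lemma exp_transform_entire: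
  assumes "0 < R" "continuous_on (sphere w R) g"
  shows "exp_transform w R g \<in> entire"
  using exp_transform_has_field_derivative[OF assms]
  by (auto simp: entire_def holomorphic_on_open)

lemma higher_deriv_exp_transform:
  assumes "0 < R" "continuous_on (sphere w R) g"
  shows "(deriv ^^ n) (exp_transform w R g) = exp_transform w R (\<lambda>\<xi>. \<xi> ^ n * g \<xi>)"
proof (induction n)
  case (Suc n)
  have "continuous_on (sphere w R) (\<lambda>\<xi>. \<xi> ^ n * g \<xi>)"
    using assms(2) by (intro continuous_intros)
  then have "deriv (exp_transform w R (\<lambda>\<xi>. \<xi> ^ n * g \<xi>)) z = exp_transform w R (\<lambda>\<xi>. \<xi> ^ Suc n * g \<xi>) z" for z
    using DERIV_imp_deriv[OF exp_transform_has_field_derivative[OF assms(1)]] by (simp add: mult.assoc)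
  with Suc show ?case by auto
qed simp

lemma norm_bounded_on_sphere:
  fixes g :: "complex \<Rightarrow> complex"
  assumes "continuous_on (sphere w R) g"
  shows "\<exists>B\<ge>0. \<forall>\<xi>\<in>sphere w R. norm (g \<xi>) \<le> B"
proof -
  have "bounded (g ` sphere w R)"
    using assms by (intro compact_imp_bounded compact_continuous_image) auto
  then obtain B where "0 < B" "\<forall>x\<in>g ` sphere w R. norm x \<le> B"
    by (auto simp: bounded_pos)
  then show ?thesis by (auto intro!: exI[of _ B])
qed

text \<open>Each derivative brings down a factor \<open>\<xi>\<close>, so the operator sums the
  Taylor series of \<open>\<phi>\<close> under the integral.\<close>

lemma diff_op_exp_transform:
  assumes \<phi>: "\<phi> \<in> entire" and R: "0 < R" and g: "continuous_on (sphere w R) g"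
  shows "diff_op \<phi> (exp_transform w R g) = exp_transform w R (\<lambda>\<xi>. \<phi> \<xi> * g \<xi>)"
proof
  fix z
  have ser: "(\<lambda>n. taylor_coeff \<phi> n * \<xi> ^ n) sums \<phi> \<xi>" for \<xi>
    using holomorphic_power_series[of \<phi> 0 "norm \<xi> + 1" \<xi>] \<phi>
    by (auto simp: entire_def taylor_coeff_def intro: holomorphic_on_subset)
  then have cr: "conv_radius (taylor_coeff \<phi>) = \<infinity>"
    by (intro conv_radius_inftyI'') (auto simp: sums_iff)
  have "continuous_on (sphere w R) (\<lambda>\<xi>. g \<xi> * exp (\<xi> * z))"
    using g by (intro continuous_intros)
  then obtain B where B: "0 \<le> B" "\<And>\<xi>. \<xi> \<in> sphere w R \<Longrightarrow> norm (g \<xi> * exp (\<xi> * z)) \<le> B"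
    using norm_bounded_on_sphere by blast
  \<comment> \<open>On the circle \<open>norm \<xi> \<le> norm w + R\<close>, and the Taylor series
    of \<open>\<phi>\<close> converges absolutely at that radius, which makes this majorant
    summable.\<close>
  define M where "M = (\<lambda>n. norm (taylor_coeff \<phi> n) * (norm w + R) ^ n * B)"
  have "summable M"
    unfolding M_def using abs_summable_in_conv_radius[of "of_real (norm w + R)" "taylor_coeff \<phi>"] R cr
    by (intro summable_mult2) (simp add: norm_mult norm_power del: of_real_add)
  have "(\<lambda>n. cint w R (\<lambda>\<xi>. (taylor_coeff \<phi> n * \<xi> ^ n) * (g \<xi> * exp (\<xi> * z)))) sums
      cint w R (\<lambda>\<xi>. \<phi> \<xi> * (g \<xi> * exp (\<xi> * z)))"
  proof (rule cint_sums[OF R _ _ _ \<open>summable M\<close>])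
    fix n \<xi> assume \<xi>: "\<xi> \<in> sphere w R"
    then have "norm \<xi> \<le> norm w + R"
      using norm_triangle_ineq[of w "\<xi> - w"] by (simp add: dist_norm norm_minus_commute)
    then have "norm (\<xi> ^ n) \<le> (norm w + R) ^ n"
      by (simp add: norm_power power_mono)
    then show "norm ((taylor_coeff \<phi> n * \<xi> ^ n) * (g \<xi> * exp (\<xi> * z))) \<le> M n"
      unfolding M_def norm_mult[of "_ * _" "_ * _"] norm_mult[of "taylor_coeff \<phi> n"]
      using B(2)[OF \<xi>] R by (intro mult_mono) auto
  qed (use g ser in \<open>auto intro!: continuous_intros sums_mult2\<close>)
  moreover have "cint w R (\<lambda>\<xi>. (taylor_coeff \<phi> n * \<xi> ^ n) * (g \<xi> * exp (\<xi> * z))) =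
      taylor_coeff \<phi> n * (deriv ^^ n) (exp_transform w R g) z" for n
    unfolding higher_deriv_exp_transform[OF R g] exp_transform_def
    using g R by (subst cint_cmult[symmetric]) (auto intro!: continuous_intros simp: mult.assoc)
  ultimately show "diff_op \<phi> (exp_transform w R g) z = exp_transform w R (\<lambda>\<xi>. \<phi> \<xi> * g \<xi>) z"
    by (simp add: diff_op_def exp_transform_def sums_iff mult.assoc)
qed

lemma diff_op_funpow_exp_transform:
  assumes \<phi>: "\<phi> \<in> entire" and R: "0 < R" and g: "continuous_on (sphere w R) g"
  shows "(diff_op \<phi> ^^ n) (exp_transform w R g) = exp_transform w R (\<lambda>\<xi>. \<phi> \<xi> ^ n * g \<xi>)"
proof (induction n)
  case (Suc n)
  have "continuous_on (sphere w R) \<phi>"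
    using \<phi> by (auto simp: entire_def intro: holomorphic_on_imp_continuous_on holomorphic_on_subset)
  then have "continuous_on (sphere w R) (\<lambda>\<xi>. \<phi> \<xi> ^ n * g \<xi>)"
    using g by (intro continuous_intros)
  then show ?case
    using Suc diff_op_exp_transform[OF \<phi> R, of w "\<lambda>\<xi>. \<phi> \<xi> ^ n * g \<xi>"] by (simp add: mult.assoc)
qed simp

lemma exp_transform_norm_le:
  assumes R: "0 < R" and g: "continuous_on (sphere w R) g"
    and B: "\<And>\<xi>. \<xi> \<in> sphere w R \<Longrightarrow> norm (g \<xi>) \<le> B"
  shows "norm (exp_transform w R g z) \<le> R * (B * exp ((norm w + R) * norm z))"
  unfolding exp_transform_def
proof (rule cint_bound[OF R])
  fix \<xi> assume \<xi>: "\<xi> \<in> sphere w R"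
  then have "norm \<xi> \<le> norm w + R"
    using norm_triangle_ineq[of w "\<xi> - w"] by (simp add: dist_norm norm_minus_commute)
  then have "norm \<xi> * norm z \<le> (norm w + R) * norm z"
    by (rule mult_right_mono) simp
  with complex_Re_le_cmod[of "\<xi> * z"] have "Re (\<xi> * z) \<le> (norm w + R) * norm z"
    unfolding norm_mult by linarith
  moreover have "0 \<le> B"
    by (rule order_trans[OF norm_ge_zero B[OF \<xi>]])
  ultimately show "norm (g \<xi> * exp (\<xi> * z)) \<le> B * exp ((norm w + R) * norm z)"
    using B[OF \<xi>] unfolding norm_mult norm_exp_eq_Re by (intro mult_mono) auto
qed (use g in \<open>auto intro!: continuous_intros\<close>)

lemma exponential_type_exp_transform:
  assumes R: "0 < R" and g: "continuous_on (sphere w R) g"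
  shows "exponential_type (exp_transform w R g)"
proof -
  obtain B where B: "0 \<le> B" "\<And>\<xi>. \<xi> \<in> sphere w R \<Longrightarrow> norm (g \<xi>) \<le> B"
    using norm_bounded_on_sphere[OF g] by blast
  define f where "f = exp_transform w R g"
  \<comment> \<open>At least 1, so that \<open>ln C\<close> is nonnegative and
    \<open>ln C \<le> ln C * r\<close> for \<open>r \<ge> 1\<close>.\<close>
  define C where "C = max 1 (R * B)"
  define A where "A = norm w + R"
  have C: "1 \<le> C" and A: "0 \<le> A" using R by (auto simp: C_def A_def)
  have f: "norm (f z) \<le> C * exp (A * norm z)" for z
  proof -
    have "R * B * exp (A * norm z) \<le> C * exp (A * norm z)"
      by (intro mult_right_mono) (auto simp: C_def)
    then show ?thesis
      using exp_transform_norm_le[OF R g B(2), of z] unfolding f_def A_def mult.assoc by linarith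
  qed
  have "ln (max_modulus f r) / r \<le> ln C + A" if r: "1 \<le> r" for r
  proof -
    have "max_modulus f r \<le> C * exp (A * r)"
      unfolding max_modulus_def
    proof (rule cSUP_least)
      show "norm (f z) \<le> C * exp (A * r)" if "z \<in> sphere 0 r" for z
        using f[of z] that by simp
    qed (use r in auto)
    moreover have "0 \<le> max_modulus f r"
    proof -
      have "norm (f (of_real r)) \<le> max_modulus f r"
        unfolding max_modulus_def
      proof (rule cSUP_upper)
        show "bdd_above ((\<lambda>z. norm (f z)) ` sphere 0 r)"
        proof (rule bdd_aboveI2)
          show "norm (f z) \<le> C * exp (A * r)" if "z \<in> sphere 0 r" for z
            using f[of z] that by simp
        qed
      qed (use r in auto)
      then show ?thesis by (rule order_trans[OF norm_ge_zero])
    qed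
    \<comment> \<open>Monotonicity of \<open>ln\<close> needs a positive argument; where the maximum
      modulus vanishes, the convention \<open>ln 0 = 0\<close> meets the final bound as
      well.\<close>
    ultimately have "ln (max_modulus f r) \<le> ln (C * exp (A * r)) \<or> max_modulus f r = 0"
      by (metis ln_mono order_le_less)
    moreover have "ln (C * exp (A * r)) = ln C + A * r" "0 \<le> ln C" "ln C \<le> ln C * r"
      using C r mult_left_mono[OF r, of "ln C"] by (simp_all add: ln_mult)
    moreover have "0 \<le> A * r" using A r by simp
    ultimately have "ln (max_modulus f r) \<le> ln C * r + A * r"
    proof (elim disjE)
      assume "max_modulus f r = 0"
      then have "ln (max_modulus f r) = 0" by (simp only: ln_0)
      then show ?thesis using \<open>0 \<le> A * r\<close> \<open>0 \<le> ln C\<close> \<open>ln C \<le> ln C * r\<close> by linarith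
    qed linarith
    then have "ln (max_modulus f r) \<le> (ln C + A) * r" by (simp only: distrib_right)
    then show ?thesis using r by (simp add: pos_divide_le_eq)
  qed
  then have "\<forall>\<^sub>F r in at_top. ereal (ln (max_modulus f r) / r) \<le> ereal (ln C + A)"
    by (intro eventually_at_top_linorderI[of 1]) simp
  then have "Limsup at_top (\<lambda>r. ereal (ln (max_modulus f r) / r)) \<le> ereal (ln C + A)"
    by (rule Limsup_bounded)
  also have "\<dots> < \<infinity>" by simp
  finally show ?thesis
    using exp_transform_entire[OF R g] unfolding exponential_type_def f_def by blast
qed

section \<open>Principal parts\<close>

text \<open>At \<open>\<xi> = w\<close> the members have the junk value \<open>0\<close>.\<close>

definition princ :: "complex \<Rightarrow> (complex \<Rightarrow> complex) set" where
  "princ w = range (\<lambda>p \<xi>. poly (pCons 0 p) (inverse (\<xi> - w)))"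

lemma princ_add:
  assumes "F \<in> princ w" "G \<in> princ w"
  shows "(\<lambda>\<xi>. F \<xi> + G \<xi>) \<in> princ w"
proof -
  obtain p q where "F = (\<lambda>\<xi>. poly (pCons 0 p) (inverse (\<xi> - w)))" "G = (\<lambda>\<xi>. poly (pCons 0 q) (inverse (\<xi> - w)))"
    using assms by (auto simp: princ_def)
  then have "(\<lambda>\<xi>. F \<xi> + G \<xi>) = (\<lambda>\<xi>. poly (pCons 0 (p + q)) (inverse (\<xi> - w)))"
    by (simp add: algebra_simps)
  then show ?thesis unfolding princ_def by (rule range_eqI)
qed

lemma princ_cmult:
  assumes "F \<in> princ w"
  shows "(\<lambda>\<xi>. c * F \<xi>) \<in> princ w"
proof -
  obtain p where "F = (\<lambda>\<xi>. poly (pCons 0 p) (inverse (\<xi> - w)))"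
    using assms by (auto simp: princ_def)
  then have "(\<lambda>\<xi>. c * F \<xi>) = (\<lambda>\<xi>. poly (pCons 0 (smult c p)) (inverse (\<xi> - w)))"
    by (simp add: algebra_simps)
  then show ?thesis unfolding princ_def by (rule range_eqI)
qed

lemma princ_mult:
  assumes "F \<in> princ w" "G \<in> princ w"
  shows "(\<lambda>\<xi>. F \<xi> * G \<xi>) \<in> princ w"
proof -
  obtain p q where "F = (\<lambda>\<xi>. poly (pCons 0 p) (inverse (\<xi> - w)))" "G = (\<lambda>\<xi>. poly (pCons 0 q) (inverse (\<xi> - w)))"
    using assms by (auto simp: princ_def)
  then have "(\<lambda>\<xi>. F \<xi> * G \<xi>) = (\<lambda>\<xi>. poly (pCons 0 (p * pCons 0 q)) (inverse (\<xi> - w)))"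
    by (simp add: algebra_simps)
  then show ?thesis unfolding princ_def by (rule range_eqI)
qed

lemma princ_0: "(\<lambda>\<xi>. 0) \<in> princ w"
  unfolding princ_def by (rule range_eqI[of _ _ 0]) simp

lemma princ_sum:
  assumes "\<And>i. i \<in> A \<Longrightarrow> F i \<in> princ w"
  shows "(\<lambda>\<xi>. \<Sum>i\<in>A. F i \<xi>) \<in> princ w"
  using assms
proof (induction A rule: infinite_finite_induct)
  case (insert x A)
  then show ?case using princ_add[of "F x" w "\<lambda>\<xi>. \<Sum>i\<in>A. F i \<xi>"] by simp
qed (simp_all add: princ_0)

lemma princ_power: "(\<lambda>\<xi>. inverse (\<xi> - w) ^ Suc m) \<in> princ w"
  unfolding princ_def by (rule range_eqI[of _ _ "monom 1 m"]) (simp add: poly_monom)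

text \<open>Reduces linear statements to single poles: a polynomial without constant term in
  \<open>inverse (\<xi> - w)\<close> is a finite combination of positive powers.\<close>

lemma princ_induct [consumes 1, case_names zero add cmult power]:
  assumes "F \<in> princ w"
    and "P (\<lambda>\<xi>. 0)"
    and "\<And>F G. F \<in> princ w \<Longrightarrow> G \<in> princ w \<Longrightarrow> P F \<Longrightarrow> P G \<Longrightarrow> P (\<lambda>\<xi>. F \<xi> + G \<xi>)"
    and "\<And>c F. F \<in> princ w \<Longrightarrow> P F \<Longrightarrow> P (\<lambda>\<xi>. c * F \<xi>)"
    and "\<And>m. P (\<lambda>\<xi>. inverse (\<xi> - w) ^ Suc m)"
  shows "P F"
proof -
  have sum: "P (\<lambda>\<xi>. \<Sum>i<n. c i * inverse (\<xi> - w) ^ Suc i)" for c and n :: nat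
  proof (induction n)
    case (Suc n)
    have 1: "(\<lambda>\<xi>. \<Sum>i<n. c i * inverse (\<xi> - w) ^ Suc i) \<in> princ w"
      by (intro princ_sum princ_cmult princ_power)
    have 2: "(\<lambda>\<xi>. c n * inverse (\<xi> - w) ^ Suc n) \<in> princ w"
      by (intro princ_cmult princ_power)
    show ?case
      using assms(3)[OF 1 2 Suc assms(4)[OF princ_power assms(5)]] by simp
  qed (simp add: assms(2))
  obtain p where "F = (\<lambda>\<xi>. poly (pCons 0 p) (inverse (\<xi> - w)))"
    using assms(1) by (auto simp: princ_def)
  then have "F = (\<lambda>\<xi>. inverse (\<xi> - w) * poly p (inverse (\<xi> - w)))"
    by simp
  then have "F = (\<lambda>\<xi>. \<Sum>i<Suc (degree p). coeff p i * inverse (\<xi> - w) ^ Suc i)"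
    by (simp add: poly_altdef sum_distrib_left lessThan_Suc_atMost mult_ac)
  then show ?thesis using sum by metis
qed

lemma princ_holomorphic:
  assumes "F \<in> princ w" "w \<notin> S"
  shows "F holomorphic_on S"
  using assms by (auto simp: princ_def intro!: holomorphic_intros)

text \<open>Inversion maps the exterior of the disc of radius \<open>\<delta>\<close> about
  \<open>w\<close> into the compact disc \<open>cball 0 (inverse \<delta>)\<close>, where the
  polynomial is bounded.\<close>

lemma princ_bounded:
  assumes "F \<in> princ w" "0 < \<delta>"
  shows "\<exists>B\<ge>0. \<forall>\<xi>. \<delta> \<le> dist w \<xi> \<longrightarrow> norm (F \<xi>) \<le> B"
proof -
  obtain p where F: "F = (\<lambda>\<xi>. poly (pCons 0 p) (inverse (\<xi> - w)))"
    using assms by (auto simp: princ_def)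
  have "bounded ((\<lambda>x. poly (pCons 0 p) x) ` cball 0 (inverse \<delta>))"
    by (intro compact_imp_bounded compact_continuous_image continuous_intros) auto
  then obtain B where B: "0 < B" "\<And>x. norm x \<le> inverse \<delta> \<Longrightarrow> norm (poly (pCons 0 p) x) \<le> B"
    unfolding bounded_pos by auto
  have "norm (F \<xi>) \<le> B" if "\<delta> \<le> dist w \<xi>" for \<xi>
    unfolding F using that assms(2)
    by (intro B(2)) (simp add: norm_inverse dist_norm norm_minus_commute le_imp_inverse_le)
  with B(1) show ?thesis by (intro exI[of _ B]) auto
qed

text \<open>Induction on the pole order: once \<open>H w\<close> is subtracted, the difference
  quotient, filled in at \<open>w\<close> by the derivative, is holomorphic and carries one pole
  order less.\<close>

lemma principal_part:
  assumes "0 < r" "H holomorphic_on ball w r"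
  shows "\<exists>E\<in>princ w. \<exists>A. A holomorphic_on ball w r \<and>
    (\<forall>\<xi>\<in>ball w r - {w}. H \<xi> * inverse (\<xi> - w) ^ M = E \<xi> + A \<xi>)"
  using assms(2)
proof (induction M arbitrary: H)
  case 0
  then show ?case by (intro bexI[OF _ princ_0] exI[of _ H]) simp
next
  case (Suc M)
  define H1 where "H1 = (\<lambda>\<xi>. if \<xi> = w then deriv H w else (H \<xi> - H w) / (\<xi> - w))"
  have "H1 holomorphic_on ball w r"
    unfolding H1_def using Suc.prems assms(1) by (intro pole_lemma) auto
  then obtain E A where E: "E \<in> princ w" and A: "A holomorphic_on ball w r"
    and EA: "\<forall>\<xi>\<in>ball w r - {w}. H1 \<xi> * inverse (\<xi> - w) ^ M = E \<xi> + A \<xi>"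
    using Suc.IH by blast
  have "H \<xi> * inverse (\<xi> - w) ^ Suc M = H w * inverse (\<xi> - w) ^ Suc M + E \<xi> + A \<xi>"
    if \<xi>: "\<xi> \<in> ball w r - {w}" for \<xi>
  proof -
    have "H \<xi> * inverse (\<xi> - w) = H w * inverse (\<xi> - w) + H1 \<xi>"
      using \<xi> by (simp add: H1_def divide_inverse algebra_simps)
    then have "H \<xi> * inverse (\<xi> - w) ^ Suc M = H w * inverse (\<xi> - w) ^ Suc M + H1 \<xi> * inverse (\<xi> - w) ^ M"
      by (simp add: distrib_right flip: mult.assoc)
    then show ?thesis using EA \<xi> by simp
  qed
  moreover have "(\<lambda>\<xi>. H w * inverse (\<xi> - w) ^ Suc M + E \<xi>) \<in> princ w"
    using E by (intro princ_add princ_cmult princ_power)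
  ultimately show ?case using A by (intro bexI exI[of _ A] conjI) auto
qed

section \<open>The translation model at a point where \<open>\<phi>\<close> does not vanish\<close>

text \<open>The tail of the exponential series is \<open>x ^ Suc n\<close> times an everywhere
  convergent power series. Holomorphy of \<open>\<rho>\<close> is what later makes the remainder
  vanish under a contour integral.\<close>

lemma exp_Taylor_remainder:
  "\<exists>\<rho>. \<rho> holomorphic_on UNIV \<and> (\<forall>x::complex. exp x = (\<Sum>i\<le>n. x ^ i / fact i) + x ^ Suc n * \<rho> x)"
proof -
  define a :: "nat \<Rightarrow> complex" where "a = (\<lambda>i. inverse (fact (i + Suc n)))"
  define \<rho> where "\<rho> = (\<lambda>x. \<Sum>i. a i * x ^ i)"
  have e: "(\<lambda>i. x ^ i / fact i) sums exp x" for x :: complex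
    using exp_converges[of x] by (simp add: scaleR_conv_of_real field_simps)
  have s: "summable (\<lambda>i. a i * x ^ i)" for x
  proof (cases "x = 0")
    case False
    have "summable (\<lambda>i. x ^ (i + Suc n) / fact (i + Suc n))"
      using e[of x] by (subst summable_iff_shift) (simp add: sums_iff)
    then have "summable (\<lambda>i. (x ^ (i + Suc n) / fact (i + Suc n)) / x ^ Suc n)"
      by (rule summable_divide)
    moreover have "(x ^ (i + Suc n) / fact (i + Suc n)) / x ^ Suc n = a i * x ^ i" for i
      using False by (simp add: a_def power_add field_simps del: fact_Suc)
    ultimately show ?thesis by simp
  qed (simp add: summable_0_powser)
  have "\<rho> holomorphic_on ball 0 r" for r
    using s by (intro power_series_holomorphic[of _ _ a]) (simp add: \<rho>_def summable_sums)
  then have "\<rho> field_differentiable (at z)" for z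
    by (rule holomorphic_on_imp_differentiable_at[of _ "ball 0 (norm z + 1)"]) auto
  then have "\<rho> holomorphic_on UNIV"
    by (simp add: holomorphic_on_def)
  moreover have "exp x = (\<Sum>i\<le>n. x ^ i / fact i) + x ^ Suc n * \<rho> x" for x
  proof -
    have "x ^ (i + Suc n) / fact (i + Suc n) = x ^ Suc n * (a i * x ^ i)" for i
      by (simp add: a_def power_add field_simps del: fact_Suc)
    then have "(\<lambda>i. x ^ (i + Suc n) / fact (i + Suc n)) sums (x ^ Suc n * \<rho> x)"
      using sums_mult[OF summable_sums[OF s[of x]], of "x ^ Suc n"] by (simp add: \<rho>_def)
    then have "(\<lambda>i. x ^ i / fact i) sums (x ^ Suc n * \<rho> x + (\<Sum>i<Suc n. x ^ i / fact i))"
      by (rule iffD1[OF sums_iff_shift])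
    then show ?thesis
      using sums_unique2[OF e[of x]] by (simp add: lessThan_Suc_atMost add.commute)
  qed
  ultimately show ?thesis by blast
qed

lemma entire_constant_on_ball:
  assumes "\<phi> \<in> entire" "0 < r" "\<phi> constant_on ball w r"
  shows "\<phi> constant_on UNIV"
proof -
  obtain c where c: "\<And>z. z \<in> ball w r \<Longrightarrow> \<phi> z = c"
    using assms(3) by (auto simp: constant_on_def)
  have "\<phi> z = c" for z
    by (rule analytic_continuation_open[of "ball w r" UNIV \<phi> "\<lambda>_. c"])
      (use assms c in \<open>auto simp: entire_def\<close>)
  then show ?thesis by (auto simp: constant_on_def)
qed

text \<open>Near \<open>w\<close> the quotient \<open>\<phi> \<xi> / \<phi> w\<close> is within
  distance 1 of 1, hence off the branch cut of \<open>Ln\<close>. Its logarithm vanishes at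
  \<open>w\<close> but not identically, as \<open>\<phi>\<close> is not constant, so the zero has a
  finite order \<open>k\<close>.\<close>

lemma local_logarithm:
  assumes \<phi>: "\<phi> \<in> entire" "\<not> \<phi> constant_on UNIV" and w: "\<phi> w \<noteq> 0"
  obtains k r g where "0 < k" "0 < r" "g holomorphic_on ball w r"
    "\<And>\<xi>. \<xi> \<in> ball w r \<Longrightarrow> g \<xi> \<noteq> 0"
    "\<And>\<xi>. \<xi> \<in> ball w r \<Longrightarrow> \<phi> \<xi> = \<phi> w * exp ((\<xi> - w) ^ k * g \<xi>)"
proof -
  have hol: "(\<lambda>\<xi>. \<phi> \<xi> / \<phi> w) holomorphic_on UNIV"
    using \<phi>(1) w by (auto simp: entire_def intro!: holomorphic_intros)
  then have "isCont (\<lambda>\<xi>. \<phi> \<xi> / \<phi> w) w"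
    by (metis UNIV_I continuous_on_eq_continuous_at holomorphic_on_imp_continuous_on open_UNIV)
  then obtain r1 where r1: "0 < r1" "\<And>\<xi>. dist \<xi> w < r1 \<Longrightarrow> dist (\<phi> \<xi> / \<phi> w) (\<phi> w / \<phi> w) < 1"
    unfolding continuous_at_eps_delta by (metis zero_less_one)
  define s where "s = (\<lambda>\<xi>. Ln (\<phi> \<xi> / \<phi> w))"
  have near: "norm (1 - \<phi> \<xi> / \<phi> w) < 1" if "\<xi> \<in> ball w r1" for \<xi>
    using r1(2)[of \<xi>] that w by (simp add: dist_commute dist_norm norm_minus_commute)
  have pos: "\<phi> \<xi> / \<phi> w \<notin> \<real>\<^sub>\<le>\<^sub>0" if "\<xi> \<in> ball w r1" for \<xi>
  proof
    assume "\<phi> \<xi> / \<phi> w \<in> \<real>\<^sub>\<le>\<^sub>0"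
    then have "Re (\<phi> \<xi> / \<phi> w) \<le> 0" by (auto simp: complex_nonpos_Reals_iff)
    then have "1 \<le> Re (1 - \<phi> \<xi> / \<phi> w)" by simp
    with complex_Re_le_cmod[of "1 - \<phi> \<xi> / \<phi> w"] near[OF that] show False by linarith
  qed
  have exp_s: "\<phi> \<xi> = \<phi> w * exp (s \<xi>)" if "\<xi> \<in> ball w r1" for \<xi>
  proof -
    have "\<phi> \<xi> / \<phi> w \<noteq> 0"
      using pos[OF that] by (metis nonpos_Reals_zero_I)
    then show ?thesis using w by (simp add: s_def)
  qed
  have s: "s holomorphic_on ball w r1"
    unfolding s_def using pos by (intro holomorphic_on_Ln' holomorphic_on_subset[OF hol]) auto
  have nc: "\<not> s constant_on ball w r1"
  proof
    assume "s constant_on ball w r1"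
    then have "\<phi> constant_on ball w r1"
      unfolding constant_on_def using exp_s by metis
    then show False using entire_constant_on_ball \<phi> r1(1) by blast
  qed
  have s0: "w \<in> ball w r1" "s w = 0"
    using r1(1) w by (simp_all add: s_def)
  obtain g r k where kr: "0 < k" "0 < r" and sub: "ball w r \<subseteq> ball w r1" and g: "g holomorphic_on ball w r"
    "\<And>\<xi>. \<xi> \<in> ball w r \<Longrightarrow> s \<xi> = (\<xi> - w) ^ k * g \<xi>" "\<And>\<xi>. \<xi> \<in> ball w r \<Longrightarrow> g \<xi> \<noteq> 0"
    by (rule holomorphic_factor_zero_nonconstant[OF s open_ball connected_ball s0 nc]) (rule that)
  show ?thesis
  proof (rule that[OF kr g(1) g(3)])
    show "\<phi> \<xi> = \<phi> w * exp ((\<xi> - w) ^ k * g \<xi>)" if "\<xi> \<in> ball w r" for \<xi>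
      using exp_s[OF subsetD[OF sub that]] g(2)[OF that] by simp
  qed
qed

text \<open>With \<open>s\<close> the local logarithm and \<open>q j\<close> a multiple of
  \<open>h / s ^ Suc j\<close>, multiplication by \<open>exp (n * s)\<close> turns
  \<open>q j\<close> into a combination of the \<open>q i\<close> with \<open>i \<le> j\<close> plus
  a holomorphic function; the coefficients are those of \<open>(x + n) ^ j\<close>. Only principal
  parts contribute to the integral, so the \<open>E j\<close> inherit this rule.\<close>

lemma translation_chain:
  assumes \<phi>: "\<phi> \<in> entire" "\<not> \<phi> constant_on UNIV" and w: "\<phi> w \<noteq> 0" and R: "0 < R"
  obtains E where "\<And>j. E j \<in> princ w"
    "E m = (\<lambda>\<xi>. fact m * inverse (\<xi> - w) ^ Suc m)"
    "\<And>n j z. exp_transform w R (\<lambda>\<xi>. \<phi> \<xi> ^ n * E j \<xi>) z = \<phi> w ^ n *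
      (\<Sum>i\<le>j. of_nat (j choose i) * of_nat n ^ (j - i) * exp_transform w R (E i) z)"
proof -
  obtain k r g where k: "0 < k" and r: "0 < r" and g: "g holomorphic_on ball w r"
    and g0: "\<And>\<xi>. \<xi> \<in> ball w r \<Longrightarrow> g \<xi> \<noteq> 0"
    and \<phi>g: "\<And>\<xi>. \<xi> \<in> ball w r \<Longrightarrow> \<phi> \<xi> = \<phi> w * exp ((\<xi> - w) ^ k * g \<xi>)"
    by (rule local_logarithm[OF \<phi> w]) (rule that)
  define s where "s = (\<lambda>\<xi>. (\<xi> - w) ^ k * g \<xi>)"
  define h where "h = (\<lambda>\<xi>. ((\<xi> - w) ^ (k - 1) * g \<xi>) ^ Suc m)"
  \<comment> \<open>\<open>h / s ^ Suc m = 1 / (\<xi> - w) ^ Suc m\<close>, so that the \<open>m\<close>-th link is a prescribed monomial\<close>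
  define q where "q = (\<lambda>j \<xi>. fact j * h \<xi> * inverse (s \<xi>) ^ Suc j)"
  have s_hol: "s holomorphic_on ball w r" and h_hol: "h holomorphic_on ball w r"
    unfolding s_def h_def using g by (auto intro!: holomorphic_intros)
  have s0: "s \<xi> \<noteq> 0" if "\<xi> \<in> ball w r - {w}" for \<xi>
    using that g0 by (auto simp: s_def)
  \<comment> \<open>For \<open>j = m\<close> the function \<open>q j\<close> is already a monomial
    on the punctured disc and its holomorphic part is 0; every other link is the principal part of a
    pole.\<close>
  have "\<exists>E A. E \<in> princ w \<and> A holomorphic_on ball w r \<and> (\<forall>\<xi>\<in>ball w r - {w}. q j \<xi> = E \<xi> + A \<xi>) \<and>
      (j = m \<longrightarrow> E = (\<lambda>\<xi>. fact m * inverse (\<xi> - w) ^ Suc m))" for j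
  proof (cases "j = m")
    case True
    have "q m \<xi> = fact m * inverse (\<xi> - w) ^ Suc m" if \<xi>: "\<xi> \<in> ball w r - {w}" for \<xi>
    proof -
      define u where "u = (\<xi> - w) ^ (k - 1) * g \<xi>"
      have "u \<noteq> 0" using \<xi> g0 by (auto simp: u_def)
      moreover have "s \<xi> = (\<xi> - w) * u"
        using k by (simp add: s_def u_def power_eq_if)
      moreover have "h \<xi> = u ^ Suc m"
        by (simp add: h_def u_def)
      ultimately show ?thesis
        using \<xi> by (simp add: q_def inverse_mult_distrib power_mult_distrib del: power_Suc)
          (simp add: power_inverse field_simps)
    qed
    then show ?thesis
      using True by (intro exI[of _ "\<lambda>\<xi>. fact m * inverse (\<xi> - w) ^ Suc m"] exI[of _ "\<lambda>\<xi>. 0"])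
        (auto intro!: princ_cmult princ_power simp del: power_Suc)
  next
    case False
    define H where "H = (\<lambda>\<xi>. fact j * h \<xi> * inverse (g \<xi>) ^ Suc j)"
    have "H holomorphic_on ball w r"
      unfolding H_def using h_hol g g0 by (auto intro!: holomorphic_intros)
    then obtain E A where "E \<in> princ w" "A holomorphic_on ball w r"
      "\<forall>\<xi>\<in>ball w r - {w}. H \<xi> * inverse (\<xi> - w) ^ (k * Suc j) = E \<xi> + A \<xi>"
      using principal_part[OF r] by blast
    moreover have "q j \<xi> = H \<xi> * inverse (\<xi> - w) ^ (k * Suc j)" for \<xi>
    proof -
      have "inverse (s \<xi>) = inverse (\<xi> - w) ^ k * inverse (g \<xi>)"
        by (simp add: s_def power_inverse)
      then show ?thesis
        unfolding q_def H_def by (simp only: power_mult_distrib power_mult mult_ac)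
    qed
    ultimately show ?thesis using False by auto
  qed
  then obtain E A where E: "\<And>j. E j \<in> princ w" and A: "\<And>j. A j holomorphic_on ball w r"
    and EA: "\<And>j \<xi>. \<xi> \<in> ball w r - {w} \<Longrightarrow> q j \<xi> = E j \<xi> + A j \<xi>"
    and Em: "E m = (\<lambda>\<xi>. fact m * inverse (\<xi> - w) ^ Suc m)"
    by metis
  define r0 where "r0 = min (r / 2) R"
  have r0: "0 < r0" "r0 \<le> R" "cball w r0 \<subseteq> ball w r" "sphere w r0 \<subseteq> ball w r - {w}"
    using r R by (auto simp: r0_def)
  have \<phi>_hol: "\<phi> holomorphic_on S" for S
    using \<phi>(1) by (auto simp: entire_def intro: holomorphic_on_subset)
  have q_cont: "continuous_on (sphere w r0) (q j)" for j
  proof -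
    have "q j holomorphic_on ball w r - {w}"
      unfolding q_def using s0 holomorphic_on_subset[OF s_hol, of "ball w r - {w}"]
        holomorphic_on_subset[OF h_hol, of "ball w r - {w}"]
      by (auto intro!: holomorphic_intros)
    then show ?thesis
      using r0(4) by (meson holomorphic_on_imp_continuous_on continuous_on_subset)
  qed
  have \<phi>_cont: "continuous_on S \<phi>" for S
    using \<phi>_hol holomorphic_on_imp_continuous_on by blast
  \<comment> \<open>The integrand is holomorphic off \<open>w\<close>, so the circle can shrink into
    the disc of the local logarithm. There \<open>q j\<close> and \<open>E j\<close> differ by a
    holomorphic function, which integrates to 0.\<close>
  have small: "exp_transform w R (\<lambda>\<xi>. \<phi> \<xi> ^ n * E j \<xi>) z = cint w r0 (\<lambda>\<xi>. \<phi> \<xi> ^ n * q j \<xi> * exp (\<xi> * z))"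
    for n j z
  proof -
    have A': "A j holomorphic_on cball w r0"
      using A r0(3) by (rule holomorphic_on_subset)
    have hol: "(\<lambda>\<xi>. \<phi> \<xi> ^ n * A j \<xi> * exp (\<xi> * z)) holomorphic_on cball w r0"
      using A' by (intro holomorphic_intros \<phi>_hol)
    have "exp_transform w R (\<lambda>\<xi>. \<phi> \<xi> ^ n * E j \<xi>) z = cint w r0 (\<lambda>\<xi>. \<phi> \<xi> ^ n * E j \<xi> * exp (\<xi> * z))"
      unfolding exp_transform_def using r0(1,2) E
      by (intro cint_radius[of UNIV] holomorphic_intros \<phi>_hol princ_holomorphic) auto
    also have "\<dots> = cint w r0 (\<lambda>\<xi>. \<phi> \<xi> ^ n * q j \<xi> * exp (\<xi> * z) - \<phi> \<xi> ^ n * A j \<xi> * exp (\<xi> * z))"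
    proof (rule cint_cong[OF r0(1)])
      fix \<xi> assume "\<xi> \<in> sphere w r0"
      then have "q j \<xi> = E j \<xi> + A j \<xi>" using EA r0(4) by blast
      then show "\<phi> \<xi> ^ n * E j \<xi> * exp (\<xi> * z) = \<phi> \<xi> ^ n * q j \<xi> * exp (\<xi> * z) - \<phi> \<xi> ^ n * A j \<xi> * exp (\<xi> * z)"
        by (simp add: algebra_simps)
    qed
    also have "\<dots> = cint w r0 (\<lambda>\<xi>. \<phi> \<xi> ^ n * q j \<xi> * exp (\<xi> * z)) - cint w r0 (\<lambda>\<xi>. \<phi> \<xi> ^ n * A j \<xi> * exp (\<xi> * z))"
      using continuous_on_subset[OF holomorphic_on_imp_continuous_on[OF A'] sphere_cball]
      by (intro cint_diff r0 continuous_intros q_cont \<phi>_cont)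
    also have "cint w r0 (\<lambda>\<xi>. \<phi> \<xi> ^ n * A j \<xi> * exp (\<xi> * z)) = 0"
      by (rule cint_holomorphic[OF r0(1) hol])
    finally show ?thesis by simp
  qed
  have "exp_transform w R (\<lambda>\<xi>. \<phi> \<xi> ^ n * E j \<xi>) z = \<phi> w ^ n *
      (\<Sum>i\<le>j. of_nat (j choose i) * of_nat n ^ (j - i) * exp_transform w R (E i) z)" for n j z
  proof -
    obtain \<rho> where \<rho>: "\<rho> holomorphic_on UNIV"
      and exp: "\<And>x::complex. exp x = (\<Sum>i\<le>j. x ^ i / fact i) + x ^ Suc j * \<rho> x"
      using exp_Taylor_remainder by blast
    define c :: "nat \<Rightarrow> complex" where "c = (\<lambda>i. of_nat (j choose i) * of_nat n ^ (j - i))"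
    \<comment> \<open>The Taylor remainder of \<open>exp (n * s)\<close> times \<open>q j\<close>:
      its factor \<open>s ^ Suc j\<close> cancels the pole, so \<open>B\<close> is holomorphic
      across \<open>w\<close>.\<close>
    define B where "B = (\<lambda>\<xi>. of_nat n ^ Suc j * fact j * h \<xi> * \<rho> (of_nat n * s \<xi>) * exp (\<xi> * z))"
    have B_hol: "B holomorphic_on cball w r0"
    proof -
      have "(\<lambda>\<xi>. \<rho> (of_nat n * s \<xi>)) holomorphic_on ball w r"
        using s_hol by (intro holomorphic_on_compose_gen[OF _ \<rho>, unfolded o_def] holomorphic_intros) auto
      then have "B holomorphic_on ball w r"
        unfolding B_def using h_hol by (intro holomorphic_intros)
      then show ?thesis using r0(3) by (rule holomorphic_on_subset)
    qed
    have expand: "\<phi> \<xi> ^ n * q j \<xi> * exp (\<xi> * z) =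
        \<phi> w ^ n * ((\<Sum>i\<le>j. c i * (q i \<xi> * exp (\<xi> * z))) + B \<xi>)" if "\<xi> \<in> sphere w r0" for \<xi>
    proof -
      have \<xi>: "\<xi> \<in> ball w r - {w}" using that r0(4) by blast
      define x where "x = of_nat n * s \<xi>"
      have "\<phi> \<xi> ^ n = \<phi> w ^ n * exp x"
        using \<phi>g[of \<xi>] \<xi> by (simp add: x_def s_def power_mult_distrib exp_of_nat_mult)
      \<comment> \<open>The Taylor polynomial is summed in reverse, so that term \<open>i\<close>
        takes \<open>q j\<close> to a multiple of \<open>q i\<close>.\<close>
      moreover define S where "S = (\<Sum>i\<le>j. x ^ (j - i) / fact (j - i))"
      moreover have "exp x = S + x ^ Suc j * \<rho> x"
        unfolding exp[of x] S_def by (subst sum.nat_diff_reindex[of _ "Suc j", unfolded lessThan_Suc_atMost, symmetric]) simp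
      moreover have "x ^ (j - i) / fact (j - i) * q j \<xi> = c i * q i \<xi>" if "i \<le> j" for i
      proof -
        have "s \<xi> ^ (j - i) * inverse (s \<xi>) ^ Suc j = inverse (s \<xi>) ^ Suc i"
        proof -
          have "Suc j = (j - i) + Suc i" using that by simp
          then have "inverse (s \<xi>) ^ Suc j = inverse (s \<xi>) ^ (j - i) * inverse (s \<xi>) ^ Suc i"
            by (metis power_add)
          then show ?thesis
            using s0[OF \<xi>] by (simp add: power_inverse del: power_Suc)
        qed
        moreover have "(fact j :: complex) / fact (j - i) = of_nat (j choose i) * fact i"
          using that by (simp add: binomial_fact)
        moreover have "x ^ (j - i) / fact (j - i) * q j \<xi> =
            of_nat n ^ (j - i) * (fact j / fact (j - i)) * h \<xi> * (s \<xi> ^ (j - i) * inverse (s \<xi>) ^ Suc j)"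
          by (simp add: x_def q_def power_mult_distrib del: power_Suc)
        ultimately show ?thesis
          by (simp add: c_def q_def del: power_Suc)
      qed
      then have "S * q j \<xi> = (\<Sum>i\<le>j. c i * q i \<xi>)"
        unfolding S_def sum_distrib_right by (intro sum.cong) auto
      moreover have "x ^ Suc j * \<rho> x * q j \<xi> * exp (\<xi> * z) = B \<xi>"
        using s0[OF \<xi>] by (simp add: x_def B_def q_def power_mult_distrib power_inverse del: power_Suc)
      moreover have "\<phi> w ^ n * (S + x ^ Suc j * \<rho> x) * q j \<xi> * exp (\<xi> * z) =
          \<phi> w ^ n * (S * q j \<xi> * exp (\<xi> * z) + x ^ Suc j * \<rho> x * q j \<xi> * exp (\<xi> * z))"
        by (simp only: algebra_simps)
      ultimately show ?thesis
        by (simp only: sum_distrib_right mult.assoc)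
    qed
    have B_cont: "continuous_on (sphere w r0) B"
      using holomorphic_on_imp_continuous_on[OF B_hol] by (auto elim: continuous_on_subset)
    have "exp_transform w R (\<lambda>\<xi>. \<phi> \<xi> ^ n * E j \<xi>) z =
        cint w r0 (\<lambda>\<xi>. \<phi> w ^ n * ((\<Sum>i\<le>j. c i * (q i \<xi> * exp (\<xi> * z))) + B \<xi>))"
      unfolding small using expand by (intro cint_cong r0(1))
    also have "\<dots> = \<phi> w ^ n * (cint w r0 (\<lambda>\<xi>. \<Sum>i\<le>j. c i * (q i \<xi> * exp (\<xi> * z))) + cint w r0 B)"
      by (subst cint_cmult cint_add; (intro r0(1) continuous_intros q_cont B_cont | simp)?)+
    also have "cint w r0 (\<lambda>\<xi>. \<Sum>i\<le>j. c i * (q i \<xi> * exp (\<xi> * z))) =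
        (\<Sum>i\<le>j. c i * cint w r0 (\<lambda>\<xi>. q i \<xi> * exp (\<xi> * z)))"
    proof -
      have qe: "continuous_on (sphere w r0) (\<lambda>\<xi>. q i \<xi> * exp (\<xi> * z))" for i
        by (intro continuous_intros q_cont)
      show ?thesis
        using cint_sum[OF r0(1), of "{..j}" w "\<lambda>i \<xi>. c i * (q i \<xi> * exp (\<xi> * z))"]
          cint_cmult[OF r0(1) qe] continuous_on_mult[OF continuous_on_const qe] by simp
    qed
    also have "cint w r0 B = 0"
      by (rule cint_holomorphic[OF r0(1) B_hol])
    finally show ?thesis
      using small[of 0] by (simp add: c_def)
  qed
  with E Em show ?thesis by (rule that)
qed

section \<open>Steering from one principal part to another\<close>

lemma coeff_mult_tendsto:
  fixes p q :: "nat \<Rightarrow> complex poly"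
  assumes "\<And>i. (\<lambda>n. coeff (p n) i) \<longlonglongrightarrow> coeff p' i" "\<And>i. (\<lambda>n. coeff (q n) i) \<longlonglongrightarrow> coeff q' i"
  shows "(\<lambda>n. coeff (p n * q n) i) \<longlonglongrightarrow> coeff (p' * q') i"
  unfolding coeff_mult by (intro tendsto_intros assms)

lemma coeff_power_tendsto:
  fixes p :: "nat \<Rightarrow> complex poly"
  assumes "\<And>i. (\<lambda>n. coeff (p n) i) \<longlonglongrightarrow> coeff p' i"
  shows "(\<lambda>n. coeff (p n ^ k) i) \<longlonglongrightarrow> coeff (p' ^ k) i"
proof (induction k arbitrary: i)
  case (Suc k)
  show ?case using coeff_mult_tendsto[of p p' "\<lambda>n. p n ^ k" "p' ^ k" i, OF assms Suc] by simp
qed simp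

lemma pcompose_power: "pcompose (p ^ n) q = pcompose p q ^ n"
  for p :: "'a :: comm_semiring_1 poly"
  by (induction n) (simp_all add: pcompose_mult pcompose_1)

text \<open>The matrix of a translation in the monomial basis; for \<open>a = of_nat n\<close> its
  entries are those in \<open>translation_chain\<close>.\<close>

lemma coeff_pcompose_shift:
  fixes p :: "complex poly"
  assumes "degree p \<le> N"
  shows "coeff (pcompose p [:a, 1:]) i = (\<Sum>j\<le>N. coeff p j * (of_nat (j choose i) * a ^ (j - i)))"
proof -
  have "coeff ([:a, 1:] ^ j) i = of_nat (j choose i) * a ^ (j - i)" for j
  proof (cases "i \<le> j")
    case True
    then show ?thesis by (simp add: coeff_linear_poly_power)
  next
    case False
    then show ?thesis by (simp add: coeff_eq_0 degree_linear_power)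
  qed
  moreover have "pcompose p [:a, 1:] = (\<Sum>j\<le>N. smult (coeff p j) ([:a, 1:] ^ j))"
  proof -
    have "pcompose p [:a, 1:] = pcompose (\<Sum>j\<le>N. monom (coeff p j) j) [:a, 1:]"
      using poly_as_sum_of_monoms'[OF assms] by simp
    then show ?thesis
      by (simp add: pcompose_sum monom_altdef pcompose_smult pcompose_power pcompose_pCons)
  qed
  ultimately show ?thesis by (simp add: coeff_sum)
qed

lemma uniform_limit_lincomb:
  fixes E :: "nat \<Rightarrow> 'a \<Rightarrow> complex"
  assumes "\<And>j. (\<lambda>n. a n j) \<longlonglongrightarrow> b j" "\<And>j. bounded (E j ` X)"
  shows "uniform_limit X (\<lambda>n x. \<Sum>j\<le>N. a n j * E j x) (\<lambda>x. \<Sum>j\<le>N. b j * E j x) sequentially"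
proof -
  have "uniform_limit X (\<lambda>n x. a n j) (\<lambda>x. b j) sequentially" for j
    using assms(1)[of j] by (auto simp: uniform_limit_iff tendsto_iff elim!: allE eventually_mono)
  then have *: "uniform_limit X (\<lambda>n x. a n j * E j x) (\<lambda>x. b j * E j x) sequentially" for j
    using assms(2) by (intro uniform_lim_mult uniform_limit_const) (auto simp: bounded_iff)
  show ?thesis
    by (induction N) (auto intro!: * uniform_limit_add)
qed

lemma exp_transform_add:
  assumes "0 < R" "continuous_on (sphere w R) g" "continuous_on (sphere w R) h"
  shows "exp_transform w R (\<lambda>\<xi>. g \<xi> + h \<xi>) z = exp_transform w R g z + exp_transform w R h z"
proof -
  have "exp_transform w R (\<lambda>\<xi>. g \<xi> + h \<xi>) z = cint w R (\<lambda>\<xi>. g \<xi> * exp (\<xi> * z) + h \<xi> * exp (\<xi> * z))"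
    by (simp add: exp_transform_def distrib_right)
  also have "\<dots> = exp_transform w R g z + exp_transform w R h z"
    unfolding exp_transform_def using assms by (intro cint_add continuous_intros)
  finally show ?thesis .
qed

lemma exp_transform_cmult:
  assumes "0 < R" "continuous_on (sphere w R) g"
  shows "exp_transform w R (\<lambda>\<xi>. c * g \<xi>) z = c * exp_transform w R g z"
proof -
  have "continuous_on (sphere w R) (\<lambda>\<xi>. g \<xi> * exp (\<xi> * z))"
    using assms(2) by (intro continuous_intros)
  from cint_cmult[OF assms(1) this] show ?thesis by (simp add: exp_transform_def mult.assoc)
qed

lemma exp_transform_lincomb:
  fixes N :: nat
  assumes "0 < R" "\<And>j. continuous_on (sphere w R) (E j)"
  shows "exp_transform w R (\<lambda>\<xi>. \<Sum>j\<le>N. a j * E j \<xi>) z = (\<Sum>j\<le>N. a j * exp_transform w R (E j) z)"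
proof (induction N)
  case (Suc N)
  have "continuous_on (sphere w R) (\<lambda>\<xi>. \<Sum>j\<le>N. a j * E j \<xi>)" "continuous_on (sphere w R) (\<lambda>\<xi>. a (Suc N) * E (Suc N) \<xi>)"
    using assms(2) by (auto intro!: continuous_intros)
  from exp_transform_add[OF assms(1) this] Suc show ?case
    using assms by (simp add: exp_transform_cmult)
qed (use assms in \<open>simp add: exp_transform_cmult\<close>)

lemma bounded_exp_transform:
  assumes "0 < R" "continuous_on (sphere w R) g"
  shows "bounded (exp_transform w R g ` cball 0 B)"
proof -
  have "exp_transform w R g holomorphic_on cball 0 B"
    using exp_transform_entire[OF assms] by (auto simp: entire_def intro: holomorphic_on_subset)
  then show ?thesis
    by (intro compact_imp_bounded compact_continuous_image holomorphic_on_imp_continuous_on) auto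
qed

lemma princ_continuous_on_sphere:
  assumes "F \<in> princ w" "0 < R"
  shows "continuous_on (sphere w R) F"
  using assms by (intro holomorphic_on_imp_continuous_on princ_holomorphic) auto

text \<open>The functions \<open>G n\<close> start near \<open>F\<close>, and exactly
  \<open>n\<close> steps carry their transforms close to that of \<open>Q\<close>. Asking for a
  limit along all \<open>n\<close>, rather than for one good \<open>n\<close>, makes the relation
  linear in the pair \<open>F\<close>, \<open>Q\<close>, so that single poles suffice.\<close>

definition steerable :: "(complex \<Rightarrow> complex) \<Rightarrow> complex \<Rightarrow> real \<Rightarrow> (complex \<Rightarrow> complex) \<Rightarrow> (complex \<Rightarrow> complex) \<Rightarrow> bool" where
  "steerable \<phi> w R F Q \<longleftrightarrow> (\<exists>G. (\<forall>n. G n \<in> princ w) \<and>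
     (\<forall>\<delta>>0. uniform_limit {\<xi>. \<delta> \<le> dist w \<xi>} G F sequentially) \<and>
     (\<forall>B. uniform_limit (cball 0 B) (\<lambda>n. exp_transform w R (\<lambda>\<xi>. \<phi> \<xi> ^ n * G n \<xi>)) (exp_transform w R Q) sequentially))"

lemma entire_continuous_on: "\<phi> \<in> entire \<Longrightarrow> continuous_on S \<phi>"
  by (auto simp: entire_def intro: holomorphic_on_imp_continuous_on holomorphic_on_subset)

lemma steerable_add:
  assumes \<phi>: "\<phi> \<in> entire" and R: "0 < R" and Q: "Q \<in> princ w" "Q' \<in> princ w"
    and s: "steerable \<phi> w R F Q" "steerable \<phi> w R F' Q'"
  shows "steerable \<phi> w R (\<lambda>\<xi>. F \<xi> + F' \<xi>) (\<lambda>\<xi>. Q \<xi> + Q' \<xi>)"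
proof -
  obtain G G' where G: "\<And>n. G n \<in> princ w" "\<And>\<delta>. 0 < \<delta> \<Longrightarrow> uniform_limit {\<xi>. \<delta> \<le> dist w \<xi>} G F sequentially"
    "\<And>B. uniform_limit (cball 0 B) (\<lambda>n. exp_transform w R (\<lambda>\<xi>. \<phi> \<xi> ^ n * G n \<xi>)) (exp_transform w R Q) sequentially"
    and G': "\<And>n. G' n \<in> princ w" "\<And>\<delta>. 0 < \<delta> \<Longrightarrow> uniform_limit {\<xi>. \<delta> \<le> dist w \<xi>} G' F' sequentially"
    "\<And>B. uniform_limit (cball 0 B) (\<lambda>n. exp_transform w R (\<lambda>\<xi>. \<phi> \<xi> ^ n * G' n \<xi>)) (exp_transform w R Q') sequentially"
    using s unfolding steerable_def by auto
  have 1: "exp_transform w R (\<lambda>\<xi>. Q \<xi> + Q' \<xi>) = (\<lambda>z. exp_transform w R Q z + exp_transform w R Q' z)"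
    using R Q by (intro ext exp_transform_add princ_continuous_on_sphere)
  have 2: "exp_transform w R (\<lambda>\<xi>. \<phi> \<xi> ^ n * (G n \<xi> + G' n \<xi>)) =
      (\<lambda>z. exp_transform w R (\<lambda>\<xi>. \<phi> \<xi> ^ n * G n \<xi>) z + exp_transform w R (\<lambda>\<xi>. \<phi> \<xi> ^ n * G' n \<xi>) z)" for n
    unfolding distrib_left using R G(1) G'(1) \<phi>
    by (intro ext exp_transform_add continuous_intros princ_continuous_on_sphere entire_continuous_on)
  show ?thesis
    unfolding steerable_def
  proof (intro exI[of _ "\<lambda>n \<xi>. G n \<xi> + G' n \<xi>"] conjI allI impI)
    show "(\<lambda>\<xi>. G n \<xi> + G' n \<xi>) \<in> princ w" for n
      using G(1) G'(1) by (rule princ_add)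
    show "uniform_limit {\<xi>. \<delta> \<le> dist w \<xi>} (\<lambda>n \<xi>. G n \<xi> + G' n \<xi>) (\<lambda>\<xi>. F \<xi> + F' \<xi>) sequentially" if "0 < \<delta>" for \<delta>
      using that by (intro uniform_limit_add G G')
    show "uniform_limit (cball 0 B) (\<lambda>n. exp_transform w R (\<lambda>\<xi>. \<phi> \<xi> ^ n * (G n \<xi> + G' n \<xi>)))
        (exp_transform w R (\<lambda>\<xi>. Q \<xi> + Q' \<xi>)) sequentially" for B
      unfolding 1 2 by (intro uniform_limit_add G G')
  qed
qed

lemma steerable_cmult:
  assumes \<phi>: "\<phi> \<in> entire" and R: "0 < R" and Q: "Q \<in> princ w" and s: "steerable \<phi> w R F Q"
  shows "steerable \<phi> w R (\<lambda>\<xi>. c * F \<xi>) (\<lambda>\<xi>. c * Q \<xi>)"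
proof -
  obtain G where G: "\<And>n. G n \<in> princ w" "\<And>\<delta>. 0 < \<delta> \<Longrightarrow> uniform_limit {\<xi>. \<delta> \<le> dist w \<xi>} G F sequentially"
    "\<And>B. uniform_limit (cball 0 B) (\<lambda>n. exp_transform w R (\<lambda>\<xi>. \<phi> \<xi> ^ n * G n \<xi>)) (exp_transform w R Q) sequentially"
    using s unfolding steerable_def by auto
  have 1: "exp_transform w R (\<lambda>\<xi>. c * Q \<xi>) = (\<lambda>z. c * exp_transform w R Q z)"
    using R Q by (intro ext exp_transform_cmult princ_continuous_on_sphere)
  have "continuous_on (sphere w R) (\<lambda>\<xi>. \<phi> \<xi> ^ n * G n \<xi>)" for n
    using R G(1) \<phi> by (intro continuous_intros princ_continuous_on_sphere entire_continuous_on)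
  then have 2: "exp_transform w R (\<lambda>\<xi>. \<phi> \<xi> ^ n * (c * G n \<xi>)) =
      (\<lambda>z. c * exp_transform w R (\<lambda>\<xi>. \<phi> \<xi> ^ n * G n \<xi>) z)" for n
    unfolding mult.left_commute[of _ c] using R by (intro ext exp_transform_cmult)
  have lim: "uniform_limit X (\<lambda>n x. c * f n x) (\<lambda>x. c * l x) sequentially"
    if "uniform_limit X f l sequentially" for X :: "complex set" and f l
    by (rule bounded_linear.uniform_limit[OF bounded_linear_mult_right that])
  show ?thesis
    unfolding steerable_def
  proof (intro exI[of _ "\<lambda>n \<xi>. c * G n \<xi>"] conjI allI impI)
    show "(\<lambda>\<xi>. c * G n \<xi>) \<in> princ w" for n
      using G(1) by (rule princ_cmult)
    show "uniform_limit {\<xi>. \<delta> \<le> dist w \<xi>} (\<lambda>n \<xi>. c * G n \<xi>) (\<lambda>\<xi>. c * F \<xi>) sequentially" if "0 < \<delta>" for \<delta>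
      using that by (intro lim G)
    show "uniform_limit (cball 0 B) (\<lambda>n. exp_transform w R (\<lambda>\<xi>. \<phi> \<xi> ^ n * (c * G n \<xi>)))
        (exp_transform w R (\<lambda>\<xi>. c * Q \<xi>)) sequentially" for B
      unfolding 1 2 by (intro lim G)
  qed
qed

text \<open>Let a polynomial with coefficients \<open>p j\<close> stand for the sum of the
  \<open>p j * E j\<close>. Then \<open>n\<close> steps act as \<open>\<phi> w ^ n\<close> times the
  substitution of \<open>x + n\<close>. As the degrees are bounded by \<open>N\<close>,
  coefficientwise limits yield the uniform limits at both ends.\<close>

lemma steerable_chain:
  assumes \<phi>: "\<phi> \<in> entire" and R: "0 < R" and E: "\<And>j. E j \<in> princ w"
    and chain: "\<And>n j z. exp_transform w R (\<lambda>\<xi>. \<phi> \<xi> ^ n * E j \<xi>) z = \<phi> w ^ n *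
      (\<Sum>i\<le>j. of_nat (j choose i) * of_nat n ^ (j - i) * exp_transform w R (E i) z)"
    and deg: "\<And>n. degree (P n) \<le> N"
    and a: "\<And>j. (\<lambda>n. coeff (P n) j) \<longlonglongrightarrow> a j"
    and b: "\<And>j. (\<lambda>n. \<phi> w ^ n * coeff (pcompose (P n) [:of_nat n, 1:]) j) \<longlonglongrightarrow> b j"
  shows "steerable \<phi> w R (\<lambda>\<xi>. \<Sum>j\<le>N. a j * E j \<xi>) (\<lambda>\<xi>. \<Sum>j\<le>N. b j * E j \<xi>)"
proof -
  have E_cont: "continuous_on (sphere w R) (E j)" for j
    using E R by (intro princ_continuous_on_sphere)
  define e where "e = (\<lambda>j. exp_transform w R (E j))"
  define G where "G = (\<lambda>n \<xi>. \<Sum>j\<le>N. coeff (P n) j * E j \<xi>)"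
  have orbit: "exp_transform w R (\<lambda>\<xi>. \<phi> \<xi> ^ n * G n \<xi>) =
      (\<lambda>z. \<Sum>i\<le>N. (\<phi> w ^ n * coeff (pcompose (P n) [:of_nat n, 1:]) i) * e i z)" for n
  proof
    fix z
    have "exp_transform w R (\<lambda>\<xi>. \<phi> \<xi> ^ n * G n \<xi>) z =
        exp_transform w R (\<lambda>\<xi>. \<Sum>j\<le>N. coeff (P n) j * (\<phi> \<xi> ^ n * E j \<xi>)) z"
      by (simp add: G_def sum_distrib_left mult_ac)
    also have "\<dots> = (\<Sum>j\<le>N. coeff (P n) j * exp_transform w R (\<lambda>\<xi>. \<phi> \<xi> ^ n * E j \<xi>) z)"
      by (intro exp_transform_lincomb R continuous_intros entire_continuous_on \<phi> E_cont)
    also have "\<dots> = (\<Sum>j\<le>N. \<Sum>i\<le>N. \<phi> w ^ n * (coeff (P n) j * (of_nat (j choose i) * of_nat n ^ (j - i))) * e i z)"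
    proof (intro sum.cong refl)
      fix j assume "j \<in> {..N}"
      \<comment> \<open>The binomial vanishes for \<open>i > j\<close>, so every inner sum may run
        up to \<open>N\<close>, ready for the interchange.\<close>
      then have "(\<Sum>i\<le>j. of_nat (j choose i) * of_nat n ^ (j - i) * e i z) =
          (\<Sum>i\<le>N. of_nat (j choose i) * of_nat n ^ (j - i) * e i z)"
        by (intro sum.mono_neutral_left) auto
      then have "exp_transform w R (\<lambda>\<xi>. \<phi> \<xi> ^ n * E j \<xi>) z =
          \<phi> w ^ n * (\<Sum>i\<le>N. of_nat (j choose i) * of_nat n ^ (j - i) * e i z)"
        unfolding chain by (simp add: e_def)
      then show "coeff (P n) j * exp_transform w R (\<lambda>\<xi>. \<phi> \<xi> ^ n * E j \<xi>) z =
          (\<Sum>i\<le>N. \<phi> w ^ n * (coeff (P n) j * (of_nat (j choose i) * of_nat n ^ (j - i))) * e i z)"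
        by (simp add: sum_distrib_left mult_ac)
    qed
    also have "\<dots> = (\<Sum>i\<le>N. (\<phi> w ^ n * coeff (pcompose (P n) [:of_nat n, 1:]) i) * e i z)"
      unfolding coeff_pcompose_shift[OF deg] sum_distrib_left sum_distrib_right by (rule sum.swap)
    finally show "exp_transform w R (\<lambda>\<xi>. \<phi> \<xi> ^ n * G n \<xi>) z =
        (\<Sum>i\<le>N. (\<phi> w ^ n * coeff (pcompose (P n) [:of_nat n, 1:]) i) * e i z)" .
  qed
  have target: "exp_transform w R (\<lambda>\<xi>. \<Sum>j\<le>N. b j * E j \<xi>) = (\<lambda>z. \<Sum>j\<le>N. b j * e j z)"
    unfolding e_def by (intro ext exp_transform_lincomb R E_cont)
  show ?thesis
    unfolding steerable_def
  proof (intro exI[of _ G] conjI allI impI)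
    show "G n \<in> princ w" for n
      unfolding G_def by (intro princ_sum princ_cmult E)
    show "uniform_limit {\<xi>. \<delta> \<le> dist w \<xi>} G (\<lambda>\<xi>. \<Sum>j\<le>N. a j * E j \<xi>) sequentially" if "0 < \<delta>" for \<delta>
      unfolding G_def
    proof (rule uniform_limit_lincomb[OF a])
      show "bounded (E j ` {\<xi>. \<delta> \<le> dist w \<xi>})" for j
        using princ_bounded[OF E that] by (force simp: bounded_iff)
    qed
    show "uniform_limit (cball 0 B) (\<lambda>n. exp_transform w R (\<lambda>\<xi>. \<phi> \<xi> ^ n * G n \<xi>))
        (exp_transform w R (\<lambda>\<xi>. \<Sum>j\<le>N. b j * E j \<xi>)) sequentially" for B
      unfolding orbit target using bounded_exp_transform[OF R E_cont]
      by (intro uniform_limit_lincomb b) (simp add: e_def)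
  qed
qed

lemma pcompose_shift_scaled:
  fixes \<nu> a c :: complex
  shows "pcompose [:c, \<nu>:] [:a, 1:] = [:c + \<nu> * a, \<nu>:]"
  by (simp add: pcompose_pCons)

lemma coeff_linear_tendsto:
  fixes \<nu> :: "nat \<Rightarrow> complex"
  assumes "\<nu> \<longlonglongrightarrow> l"
  shows "(\<lambda>n. coeff [:c, \<nu> n:] i) \<longlonglongrightarrow> coeff [:c, l:] i"
proof (cases i)
  case (Suc k)
  then show ?thesis using assms by (cases k) simp_all
qed simp

lemma coeff_X_power: "coeff ([:0, 1:] ^ m) j = (if j = m then 1 else 0 :: complex)"
proof -
  have "[:0, 1:] ^ m = monom (1 :: complex) m" by (simp add: monom_altdef)
  then show ?thesis by simp
qed

lemma degree_linear_power_le: "degree ([:a, b:] ^ m) \<le> m" for a b :: complex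
proof -
  have "degree [:a, b:] \<le> 1" by simp
  then show ?thesis
    using degree_power_le[of "[:a, b:]" m] mult_le_mono1[of "degree [:a, b:]" 1 m] by linarith
qed

text \<open>Up to a unimodular factor, \<open>P n\<close> is
  \<open>X ^ Suc m * (X - n) ^ m / n ^ Suc m\<close>, with coefficients of order
  \<open>1 / n\<close>. Substituting \<open>X + n\<close> moves the zeros and leaves
  \<open>X ^ m * (1 + X / n) ^ Suc m\<close>, which tends to \<open>X ^ m\<close>.\<close>

lemma steerable_to_power:
  assumes \<phi>: "\<phi> \<in> entire" "\<not> \<phi> constant_on UNIV" and w: "norm (\<phi> w) = 1" and R: "0 < R"
  shows "steerable \<phi> w R (\<lambda>\<xi>. 0) (\<lambda>\<xi>. inverse (\<xi> - w) ^ Suc m)"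
proof -
  have w0: "\<phi> w \<noteq> 0" using w by auto
  obtain E where E: "\<And>j. E j \<in> princ w" and Em: "E m = (\<lambda>\<xi>. fact m * inverse (\<xi> - w) ^ Suc m)"
    and chain: "\<And>n j z. exp_transform w R (\<lambda>\<xi>. \<phi> \<xi> ^ n * E j \<xi>) z = \<phi> w ^ n *
      (\<Sum>i\<le>j. of_nat (j choose i) * of_nat n ^ (j - i) * exp_transform w R (E i) z)"
    by (rule translation_chain[OF \<phi> w0 R, of m]) (rule that)
  define \<nu> :: "nat \<Rightarrow> complex" where "\<nu> = (\<lambda>n. inverse (of_nat n))"
  have \<nu>: "\<nu> \<longlonglongrightarrow> 0"
    unfolding \<nu>_def by (rule lim_inverse_n)
  define X :: "complex poly" where "X = [:0, 1:]"
  \<comment> \<open>Undoes the rotation \<open>\<phi> w ^ n\<close>; its modulus is 1, so it does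
    not disturb the convergence of \<open>P n\<close> to 0.\<close>
  define u where "u = (\<lambda>n. inverse (\<phi> w) ^ n)"
  define P where "P = (\<lambda>n. smult (u n * \<nu> n) (X ^ Suc m * [:-1, \<nu> n:] ^ m))"
  define Q where "Q = (\<lambda>n. [:1, \<nu> n:] ^ Suc m * X ^ m)"
  have lin: "(\<lambda>n. coeff [:c, \<nu> n:] i) \<longlonglongrightarrow> coeff [:c, 0:] i" for c i
    by (rule coeff_linear_tendsto[OF \<nu>])
  \<comment> \<open>The identity fails at \<open>n = 0\<close>, where \<open>\<nu>\<close> has the
    default value \<open>inverse 0 = 0\<close>; limits do not see this.\<close>
  have shift: "\<phi> w ^ n * coeff (pcompose (P n) [:of_nat n, 1:]) i = coeff (Q n) i" if "0 < n" for n i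
  proof -
    have "pcompose (P n) [:of_nat n, 1:] =
        smult (u n * \<nu> n) ([:of_nat n, 1:] ^ Suc m * [:0, \<nu> n:] ^ m)"
      using that by (simp add: P_def X_def pcompose_smult pcompose_mult pcompose_power pcompose_shift_scaled
          \<nu>_def pcompose_pCons del: power_Suc)
    also have "[:0, \<nu> n:] = smult (\<nu> n) X" by (simp add: X_def)
    also have "smult (u n * \<nu> n) ([:of_nat n, 1:] ^ Suc m * smult (\<nu> n) X ^ m) =
        smult (u n) (smult (\<nu> n) [:of_nat n, 1:] ^ Suc m * X ^ m)"
      by (simp only: smult_power mult_smult_left mult_smult_right smult_smult power_Suc mult_ac)
    also have "smult (\<nu> n) [:of_nat n, 1:] = [:1, \<nu> n:]"
      using that by (simp add: \<nu>_def)
    finally have "pcompose (P n) [:of_nat n, 1:] = smult (u n) (Q n)"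
      by (simp add: Q_def)
    then show ?thesis
      using w0 by (simp add: u_def power_inverse)
  qed
  have "steerable \<phi> w R (\<lambda>\<xi>. \<Sum>j\<le>2 * m + 1. 0 * E j \<xi>) (\<lambda>\<xi>. \<Sum>j\<le>2 * m + 1. coeff (X ^ m) j * E j \<xi>)"
  proof (rule steerable_chain[OF \<phi>(1) R E chain])
    show "degree (P n) \<le> 2 * m + 1" for n
    proof -
      have "degree (X ^ Suc m * [:-1, \<nu> n:] ^ m) \<le> degree (X ^ Suc m) + degree ([:-1, \<nu> n:] ^ m)"
        by (rule degree_mult_le)
      also have "degree (X ^ Suc m) \<le> Suc m"
        using degree_power_le[of X "Suc m"] by (simp add: X_def)
      also have "degree ([:-1, \<nu> n:] ^ m) \<le> m"
        by (rule degree_linear_power_le)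
      finally show ?thesis
        unfolding P_def using degree_smult_le[of "u n * \<nu> n" "X ^ Suc m * [:-1, \<nu> n:] ^ m"] by linarith
    qed
    show "(\<lambda>n. coeff (P n) j) \<longlonglongrightarrow> 0" for j
    proof -
      have "norm (u n * \<nu> n) = norm (\<nu> n)" for n
        using w by (simp add: u_def norm_mult norm_power norm_inverse)
      then have "(\<lambda>n. norm (u n * \<nu> n)) \<longlonglongrightarrow> 0"
        using tendsto_norm_zero[OF \<nu>] by simp
      then have "(\<lambda>n. u n * \<nu> n) \<longlonglongrightarrow> 0"
        by (rule tendsto_norm_zero_cancel)
      moreover have "(\<lambda>n. coeff (X ^ Suc m * [:-1, \<nu> n:] ^ m) j) \<longlonglongrightarrow> coeff (X ^ Suc m * [:-1, 0:] ^ m) j"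
        by (intro coeff_mult_tendsto tendsto_const coeff_power_tendsto lin)
      ultimately have "(\<lambda>n. u n * \<nu> n * coeff (X ^ Suc m * [:-1, \<nu> n:] ^ m) j) \<longlonglongrightarrow>
          0 * coeff (X ^ Suc m * [:-1, 0:] ^ m) j"
        by (rule tendsto_mult)
      then show ?thesis
        by (simp only: P_def coeff_smult mult_zero_left)
    qed
    have "(\<lambda>n. coeff (Q n) j) \<longlonglongrightarrow> coeff ([:1, 0:] ^ Suc m * X ^ m) j" for j
      unfolding Q_def by (intro coeff_mult_tendsto tendsto_const coeff_power_tendsto lin)
    then have "(\<lambda>n. coeff (Q n) j) \<longlonglongrightarrow> coeff (X ^ m) j" for j
      by (simp flip: one_pCons)
    then show "(\<lambda>n. \<phi> w ^ n * coeff (pcompose (P n) [:of_nat n, 1:]) j) \<longlonglongrightarrow> coeff (X ^ m) j" for j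
      by (rule Lim_transform_eventually) (use shift in \<open>auto intro!: eventually_sequentiallyI[of 1]\<close>)
  qed
  moreover have "(\<Sum>j\<le>2 * m + 1. coeff (X ^ m) j * E j \<xi>) = E m \<xi>" for \<xi>
  proof -
    have "coeff (X ^ m) j = (if j = m then 1 else 0)" for j
      unfolding X_def by (rule coeff_X_power)
    then show ?thesis by (simp add: if_distrib[of "\<lambda>x. x * _"] cong: if_cong)
  qed
  ultimately have "steerable \<phi> w R (\<lambda>\<xi>. 0) (E m)"
    by simp
  from steerable_cmult[OF \<phi>(1) R E this, of "inverse (fact m)"] show ?thesis
    by (simp add: Em del: power_Suc flip: mult.assoc)
qed

text \<open>The reverse direction: \<open>X ^ m * (1 - X / n) ^ Suc m\<close> tends to
  \<open>X ^ m\<close>, while substituting \<open>X + n\<close> leaves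
  \<open>(X + n) ^ m * (- X / n) ^ Suc m\<close>, of order \<open>1 / n\<close>. The limit being 0,
  the rotation by \<open>\<phi> w ^ n\<close> is harmless.\<close>

lemma steerable_from_power:
  assumes \<phi>: "\<phi> \<in> entire" "\<not> \<phi> constant_on UNIV" and w: "norm (\<phi> w) = 1" and R: "0 < R"
  shows "steerable \<phi> w R (\<lambda>\<xi>. inverse (\<xi> - w) ^ Suc m) (\<lambda>\<xi>. 0)"
proof -
  have w0: "\<phi> w \<noteq> 0" using w by auto
  obtain E where E: "\<And>j. E j \<in> princ w" and Em: "E m = (\<lambda>\<xi>. fact m * inverse (\<xi> - w) ^ Suc m)"
    and chain: "\<And>n j z. exp_transform w R (\<lambda>\<xi>. \<phi> \<xi> ^ n * E j \<xi>) z = \<phi> w ^ n *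
      (\<Sum>i\<le>j. of_nat (j choose i) * of_nat n ^ (j - i) * exp_transform w R (E i) z)"
    by (rule translation_chain[OF \<phi> w0 R, of m]) (rule that)
  define \<nu> :: "nat \<Rightarrow> complex" where "\<nu> = (\<lambda>n. inverse (of_nat n))"
  have \<nu>: "\<nu> \<longlonglongrightarrow> 0"
    unfolding \<nu>_def by (rule lim_inverse_n)
  define X :: "complex poly" where "X = [:0, 1:]"
  define P where "P = (\<lambda>n. X ^ m * [:1, - \<nu> n:] ^ Suc m)"
  define Q where "Q = (\<lambda>n. [:1, \<nu> n:] ^ m * (- X) ^ Suc m)"
  have lin: "(\<lambda>n. coeff [:c, \<nu> n:] i) \<longlonglongrightarrow> coeff [:c, 0:] i"
    "(\<lambda>n. coeff [:c, - \<nu> n:] i) \<longlonglongrightarrow> coeff [:c, 0:] i" for c i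
    using coeff_linear_tendsto[OF \<nu>] coeff_linear_tendsto[OF tendsto_minus[OF \<nu>]] by simp_all
  have shift: "coeff (pcompose (P n) [:of_nat n, 1:]) i = \<nu> n * coeff (Q n) i" if "0 < n" for n i
  proof -
    have "pcompose (P n) [:of_nat n, 1:] = [:of_nat n, 1:] ^ m * [:0, - \<nu> n:] ^ Suc m"
      using that by (simp add: P_def X_def pcompose_mult pcompose_power pcompose_shift_scaled
          \<nu>_def pcompose_pCons del: power_Suc)
    also have "[:0, - \<nu> n:] = smult (\<nu> n) (- X)" by (simp add: X_def)
    also have "[:of_nat n, 1:] ^ m * smult (\<nu> n) (- X) ^ Suc m =
        smult (\<nu> n) (smult (\<nu> n) [:of_nat n, 1:] ^ m * (- X) ^ Suc m)"
      by (simp only: smult_power mult_smult_left mult_smult_right smult_smult power_Suc mult_ac)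
    also have "smult (\<nu> n) [:of_nat n, 1:] = [:1, \<nu> n:]"
      using that by (simp add: \<nu>_def)
    finally show ?thesis by (simp add: Q_def)
  qed
  have "steerable \<phi> w R (\<lambda>\<xi>. \<Sum>j\<le>2 * m + 1. coeff (X ^ m) j * E j \<xi>) (\<lambda>\<xi>. \<Sum>j\<le>2 * m + 1. 0 * E j \<xi>)"
  proof (rule steerable_chain[OF \<phi>(1) R E chain])
    show "degree (P n) \<le> 2 * m + 1" for n
    proof -
      have "degree (P n) \<le> degree (X ^ m) + degree ([:1, - \<nu> n:] ^ Suc m)"
        unfolding P_def by (rule degree_mult_le)
      also have "degree (X ^ m) \<le> m"
        using degree_power_le[of X "m"] by (simp add: X_def)
      also have "degree ([:1, - \<nu> n:] ^ Suc m) \<le> Suc m"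
        by (rule degree_linear_power_le)
      finally show ?thesis by simp
    qed
    have "(\<lambda>n. coeff (P n) j) \<longlonglongrightarrow> coeff (X ^ m * [:1, 0:] ^ Suc m) j" for j
      unfolding P_def by (intro coeff_mult_tendsto tendsto_const coeff_power_tendsto lin)
    then show "(\<lambda>n. coeff (P n) j) \<longlonglongrightarrow> coeff (X ^ m) j" for j
      by (simp flip: one_pCons)
    have "norm (\<phi> w ^ n * \<nu> n) = norm (\<nu> n)" for n
      using w by (simp add: norm_mult norm_power)
    then have "(\<lambda>n. norm (\<phi> w ^ n * \<nu> n)) \<longlonglongrightarrow> 0"
      using tendsto_norm_zero[OF \<nu>] by simp
    then have 1: "(\<lambda>n. \<phi> w ^ n * \<nu> n) \<longlonglongrightarrow> 0"
      by (rule tendsto_norm_zero_cancel)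
    have 2: "(\<lambda>n. coeff (Q n) j) \<longlonglongrightarrow> coeff ([:1, 0:] ^ m * (- X) ^ Suc m) j" for j
      unfolding Q_def by (intro coeff_mult_tendsto tendsto_const coeff_power_tendsto lin)
    have "(\<lambda>n. \<phi> w ^ n * \<nu> n * coeff (Q n) j) \<longlonglongrightarrow> 0" for j
      using tendsto_mult[OF 1 2] by simp
    then show "(\<lambda>n. \<phi> w ^ n * coeff (pcompose (P n) [:of_nat n, 1:]) j) \<longlonglongrightarrow> 0" for j
      by (rule Lim_transform_eventually) (use shift in \<open>auto intro!: eventually_sequentiallyI[of 1]\<close>)
  qed
  moreover have "(\<Sum>j\<le>2 * m + 1. coeff (X ^ m) j * E j \<xi>) = E m \<xi>" for \<xi>
  proof -
    have "coeff (X ^ m) j = (if j = m then 1 else 0)" for j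
      unfolding X_def by (rule coeff_X_power)
    then show ?thesis by (simp add: if_distrib[of "\<lambda>x. x * _"] cong: if_cong)
  qed
  ultimately have "steerable \<phi> w R (E m) (\<lambda>\<xi>. 0)"
    by simp
  from steerable_cmult[OF \<phi>(1) R princ_0 this, of "inverse (fact m)"] show ?thesis
    by (simp add: Em del: power_Suc flip: mult.assoc)
qed

text \<open>Superposition: steer \<open>F\<close> to 0 and 0 to \<open>Q\<close>, and add the two
  sequences.\<close>

lemma steerable_princ:
  assumes \<phi>: "\<phi> \<in> entire" "\<not> \<phi> constant_on UNIV" and w: "norm (\<phi> w) = 1" and R: "0 < R"
    and F: "F \<in> princ w" and Q: "Q \<in> princ w"
  shows "steerable \<phi> w R F Q"
proof -
  have zero: "steerable \<phi> w R (\<lambda>\<xi>. 0) (\<lambda>\<xi>. 0)"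
    using steerable_cmult[OF \<phi>(1) R princ_power steerable_to_power[OF \<phi> w R, of 0], of 0] by simp
  have 1: "steerable \<phi> w R F (\<lambda>\<xi>. 0)"
    using F
  proof (induction rule: princ_induct)
    case (add F G)
    then show ?case using steerable_add[OF \<phi>(1) R princ_0 princ_0 add(3,4)] by simp
  next
    case (cmult c F)
    then show ?case using steerable_cmult[OF \<phi>(1) R princ_0 cmult(2), of c] by simp
  qed (rule zero steerable_from_power[OF \<phi> w R])+
  have 2: "steerable \<phi> w R (\<lambda>\<xi>. 0) Q"
    using Q
  proof (induction rule: princ_induct)
    case (add F G)
    then show ?case using steerable_add[OF \<phi>(1) R add(1,2,3,4)] by simp
  next
    case (cmult c F)
    then show ?case using steerable_cmult[OF \<phi>(1) R cmult(1,2), of c] by simp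
  qed (rule zero steerable_to_power[OF \<phi> w R])+
  from steerable_add[OF \<phi>(1) R princ_0 Q 1 2] show ?thesis by simp
qed

section \<open>Generic limits of principal parts\<close>

text \<open>As \<open>\<delta>\<close> decreases, these sets exhaust the complement of a closed
  \<open>K\<close>; for bounded \<open>K\<close> each contains a neighbourhood of infinity, so
  uniform estimates on them control the germ there.\<close>

definition away :: "complex set \<Rightarrow> real \<Rightarrow> complex set" where
  "away K \<delta> = {\<xi>. \<forall>x\<in>K. \<delta> \<le> dist x \<xi>}"

lemma away_mono: "\<delta>' \<le> \<delta> \<Longrightarrow> away K \<delta> \<subseteq> away K \<delta>'"
  by (force simp: away_def)

definition princ_approx :: "complex \<Rightarrow> complex set \<Rightarrow> (complex \<Rightarrow> complex) \<Rightarrow> bool" where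
  "princ_approx w X G \<longleftrightarrow> (\<forall>e>0. \<exists>F\<in>princ w. \<forall>\<xi>\<in>X. norm (F \<xi> - G \<xi>) < e)"

lemma princ_approx_princ: "F \<in> princ w \<Longrightarrow> princ_approx w X F"
  by (auto simp: princ_approx_def intro!: bexI[of _ F])

lemma princ_approx_limit:
  assumes "\<And>e. 0 < e \<Longrightarrow> \<exists>H. princ_approx w X H \<and> (\<forall>\<xi>\<in>X. norm (H \<xi> - G \<xi>) < e)"
  shows "princ_approx w X G"
  unfolding princ_approx_def
proof (intro allI impI)
  fix e :: real assume e: "0 < e"
  obtain H where H: "princ_approx w X H" "\<forall>\<xi>\<in>X. norm (H \<xi> - G \<xi>) < e / 2"
    using assms[of "e / 2"] e by auto
  obtain F where F: "F \<in> princ w" "\<forall>\<xi>\<in>X. norm (F \<xi> - H \<xi>) < e / 2"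
    using H(1) e unfolding princ_approx_def by (meson half_gt_zero)
  have "norm (F \<xi> - G \<xi>) < e" if "\<xi> \<in> X" for \<xi>
    using norm_diff_triangle_less[OF bspec[OF F(2) that] bspec[OF H(2) that]] by simp
  then show "\<exists>F\<in>princ w. \<forall>\<xi>\<in>X. norm (F \<xi> - G \<xi>) < e"
    by (intro bexI[OF _ F(1)]) simp
qed

lemma princ_approx_add:
  assumes "princ_approx w X G" "princ_approx w X H"
  shows "princ_approx w X (\<lambda>\<xi>. G \<xi> + H \<xi>)"
  unfolding princ_approx_def
proof (intro allI impI)
  fix e :: real assume e: "0 < e"
  obtain F where F: "F \<in> princ w" "\<forall>\<xi>\<in>X. norm (F \<xi> - G \<xi>) < e / 2"
    using assms(1) e unfolding princ_approx_def by (meson half_gt_zero)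
  obtain F' where F': "F' \<in> princ w" "\<forall>\<xi>\<in>X. norm (F' \<xi> - H \<xi>) < e / 2"
    using assms(2) e unfolding princ_approx_def by (meson half_gt_zero)
  have "norm ((F \<xi> + F' \<xi>) - (G \<xi> + H \<xi>)) < e" if "\<xi> \<in> X" for \<xi>
    using norm_diff_triangle_ineq[of "F \<xi>" "F' \<xi>" "G \<xi>" "H \<xi>"] bspec[OF F(2) that] bspec[OF F'(2) that]
    by linarith
  then show "\<exists>F\<in>princ w. \<forall>\<xi>\<in>X. norm (F \<xi> - (G \<xi> + H \<xi>)) < e"
    by (intro bexI[OF _ princ_add[OF F(1) F'(1)]]) simp
qed

lemma princ_approx_bounded:
  assumes "princ_approx w (away K \<delta>) G" "w \<in> K" "0 < \<delta>"
  shows "\<exists>B\<ge>0. \<forall>\<xi>\<in>away K \<delta>. norm (G \<xi>) \<le> B"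
proof -
  obtain F where F: "F \<in> princ w" "\<forall>\<xi>\<in>away K \<delta>. norm (F \<xi> - G \<xi>) < 1"
    using assms(1) unfolding princ_approx_def by (meson zero_less_one)
  obtain B where B: "0 \<le> B" "\<forall>\<xi>. \<delta> \<le> dist w \<xi> \<longrightarrow> norm (F \<xi>) \<le> B"
    using princ_bounded[OF F(1) assms(3)] by auto
  have "norm (G \<xi>) \<le> B + 1" if "\<xi> \<in> away K \<delta>" for \<xi>
  proof -
    have "norm (F \<xi>) \<le> B" using B(2) that assms(2) by (auto simp: away_def)
    moreover have "norm (G \<xi>) \<le> norm (F \<xi>) + norm (F \<xi> - G \<xi>)"
      using norm_triangle_sub[of "G \<xi>" "F \<xi>"] by (simp add: norm_minus_commute)
    ultimately show ?thesis using bspec[OF F(2) that] by linarith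
  qed
  with B(1) show ?thesis by (intro exI[of _ "B + 1"]) auto
qed

lemma princ_approx_mult:
  assumes G: "princ_approx w (away K \<delta>) G" and H: "princ_approx w (away K \<delta>) H"
    and "w \<in> K" "0 < \<delta>"
  shows "princ_approx w (away K \<delta>) (\<lambda>\<xi>. G \<xi> * H \<xi>)"
  unfolding princ_approx_def
proof (intro allI impI)
  fix e :: real assume e: "0 < e"
  obtain B where B: "0 \<le> B" "\<forall>\<xi>\<in>away K \<delta>. norm (G \<xi>) \<le> B"
    using princ_approx_bounded[OF G assms(3,4)] by auto
  obtain C where C: "0 \<le> C" "\<forall>\<xi>\<in>away K \<delta>. norm (H \<xi>) \<le> C"
    using princ_approx_bounded[OF H assms(3,4)] by auto
  \<comment> \<open>The product rule produces the error
    \<open>\<eta> * (C + 1) + B * \<eta>\<close>; the bound \<open>\<eta> \<le> 1\<close> is what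
    gives \<open>norm (F' \<xi>) \<le> C + 1\<close>.\<close>
  define \<eta> where "\<eta> = min 1 (e / (B + C + 2))"
  have \<eta>: "0 < \<eta>" "\<eta> \<le> 1" "\<eta> * (B + C + 2) \<le> e"
  proof -
    have pos: "0 < B + C + 2" using B(1) C(1) by linarith
    then show "0 < \<eta>" "\<eta> \<le> 1" using e by (simp_all add: \<eta>_def)
    have "\<eta> \<le> e / (B + C + 2)" by (simp add: \<eta>_def)
    then show "\<eta> * (B + C + 2) \<le> e" using pos by (simp add: pos_le_divide_eq)
  qed
  obtain F where F: "F \<in> princ w" "\<forall>\<xi>\<in>away K \<delta>. norm (F \<xi> - G \<xi>) < \<eta>"
    using G \<eta>(1) unfolding princ_approx_def by blast
  obtain F' where F': "F' \<in> princ w" "\<forall>\<xi>\<in>away K \<delta>. norm (F' \<xi> - H \<xi>) < \<eta>"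
    using H \<eta>(1) unfolding princ_approx_def by blast
  have "norm (F \<xi> * F' \<xi> - G \<xi> * H \<xi>) < e" if \<xi>: "\<xi> \<in> away K \<delta>" for \<xi>
  proof -
    have F'b: "norm (F' \<xi>) \<le> C + 1"
      using norm_triangle_sub[of "F' \<xi>" "H \<xi>"] bspec[OF C(2) \<xi>] bspec[OF F'(2) \<xi>] \<eta>(2) by linarith
    have "F \<xi> * F' \<xi> - G \<xi> * H \<xi> = (F \<xi> - G \<xi>) * F' \<xi> + G \<xi> * (F' \<xi> - H \<xi>)"
      by (simp add: algebra_simps)
    then have "norm (F \<xi> * F' \<xi> - G \<xi> * H \<xi>) \<le> norm (F \<xi> - G \<xi>) * norm (F' \<xi>) + norm (G \<xi>) * norm (F' \<xi> - H \<xi>)"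
      by (metis norm_mult norm_triangle_ineq)
    also have "\<dots> \<le> \<eta> * (C + 1) + B * \<eta>"
      using F(2) F'(2) B C(1) F'b \<eta>(1) \<xi> by (intro add_mono mult_mono) (auto intro: less_imp_le)
    also have "\<dots> < \<eta> * (B + C + 2)"
      using \<eta>(1) by (simp add: algebra_simps)
    finally show ?thesis using \<eta>(3) by linarith
  qed
  then show "\<exists>F\<in>princ w. \<forall>\<xi>\<in>away K \<delta>. norm (F \<xi> - G \<xi> * H \<xi>) < e"
    by (intro bexI[OF _ princ_mult[OF F(1) F'(1)]]) simp
qed

lemma princ_approx_power:
  assumes G: "princ_approx w (away K \<delta>) G" and "w \<in> K" "0 < \<delta>"
  shows "princ_approx w (away K \<delta>) (\<lambda>\<xi>. G \<xi> ^ Suc n)"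
proof (induction n)
  case (Suc n)
  from princ_approx_mult[OF G Suc assms(2,3)] show ?case by simp
qed (simp add: G)

lemma princ_approx_cmult:
  assumes "princ_approx w X G"
  shows "princ_approx w X (\<lambda>\<xi>. c * G \<xi>)"
  unfolding princ_approx_def
proof (intro allI impI)
  fix e :: real assume e: "0 < e"
  obtain F where F: "F \<in> princ w" "\<forall>\<xi>\<in>X. norm (F \<xi> - G \<xi>) < e / (norm c + 1)"
    using assms e unfolding princ_approx_def by (meson add_nonneg_pos divide_pos_pos norm_ge_zero zero_less_one)
  have "norm (c * F \<xi> - c * G \<xi>) < e" if "\<xi> \<in> X" for \<xi>
  proof -
    have "norm (c * F \<xi> - c * G \<xi>) = norm c * norm (F \<xi> - G \<xi>)"
      by (simp flip: right_diff_distrib norm_mult)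
    also have "\<dots> \<le> norm c * (e / (norm c + 1))"
      using F(2) that by (intro mult_left_mono) (auto intro: less_imp_le)
    also have "\<dots> < (norm c + 1) * (e / (norm c + 1))"
      using e by (intro mult_strict_right_mono divide_pos_pos) (simp_all add: add_nonneg_pos)
    also have "\<dots> = e"
      using add_nonneg_pos[OF norm_ge_zero zero_less_one, of c] by simp
    finally show ?thesis .
  qed
  then show "\<exists>F\<in>princ w. \<forall>\<xi>\<in>X. norm (F \<xi> - c * G \<xi>) < e"
    by (intro bexI[OF _ princ_cmult[OF F(1), of c]]) simp
qed

lemma princ_approx_sum:
  fixes n :: nat
  assumes "\<And>i. i < n \<Longrightarrow> princ_approx w X (G i)"
  shows "princ_approx w X (\<lambda>\<xi>. \<Sum>i<n. G i \<xi>)"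
  using assms
proof (induction n)
  case (Suc n)
  then show ?case using princ_approx_add[of w X "\<lambda>\<xi>. \<Sum>i<n. G i \<xi>" "G n"] by simp
qed (simp add: princ_approx_princ princ_0)

section \<open>Moving poles within \<open>K\<close>\<close>

text \<open>Expand \<open>1 / (\<xi> - \<mu>')\<close> as a geometric series in \<open>(\<mu>' - \<mu>) / (\<xi> - \<mu>)\<close>.\<close>

lemma princ_approx_move_pole:
  assumes G: "princ_approx w (away K \<delta>) (\<lambda>\<xi>. inverse (\<xi> - \<mu>))" and "w \<in> K" "0 < \<delta>"
    and \<mu>: "\<mu> \<in> K" "\<mu>' \<in> K" "norm (\<mu>' - \<mu>) \<le> \<delta> / 2"
  shows "princ_approx w (away K \<delta>) (\<lambda>\<xi>. inverse (\<xi> - \<mu>'))"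
proof (rule princ_approx_limit)
  fix e :: real assume e: "0 < e"
  \<comment> \<open>The tail after \<open>n\<close> terms is \<open>t ^ n / (\<xi> - \<mu>')\<close>
    with \<open>norm t \<le> 1 / 2\<close>, hence at most
    \<open>(1 / 2) ^ n / \<delta>\<close>.\<close>
  obtain n where n: "(1 / 2) ^ n < e * \<delta>"
    using real_arch_pow_inv[of "e * \<delta>" "1 / 2"] e assms(3) by auto
  define H where "H = (\<lambda>\<xi>. \<Sum>i<n. (\<mu>' - \<mu>) ^ i * inverse (\<xi> - \<mu>) ^ Suc i)"
  have "princ_approx w (away K \<delta>) H"
    unfolding H_def using assms by (intro princ_approx_sum princ_approx_cmult princ_approx_power)
  moreover have "norm (H \<xi> - inverse (\<xi> - \<mu>')) < e" if \<xi>: "\<xi> \<in> away K \<delta>" for \<xi>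
  proof -
    have dist: "\<delta> \<le> norm (\<xi> - \<mu>)" "\<delta> \<le> norm (\<xi> - \<mu>')"
      using \<xi> \<mu> by (auto simp: away_def dist_norm norm_minus_commute)
    then have nz: "\<xi> - \<mu> \<noteq> 0" "\<xi> - \<mu>' \<noteq> 0" using assms(3) by auto
    define t where "t = (\<mu>' - \<mu>) * inverse (\<xi> - \<mu>)"
    have inv: "inverse (\<xi> - \<mu>) = (1 - t) * inverse (\<xi> - \<mu>')"
      using nz by (simp add: t_def field_simps)
    have "H \<xi> = inverse (\<xi> - \<mu>) * (\<Sum>i<n. t ^ i)"
      by (simp add: H_def t_def power_mult_distrib sum_distrib_left mult_ac)
    also have "\<dots> = inverse (\<xi> - \<mu>') * (1 - t ^ n)"
      unfolding inv by (simp add: one_diff_power_eq mult_ac)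
    finally have "H \<xi> - inverse (\<xi> - \<mu>') = - (t ^ n * inverse (\<xi> - \<mu>'))"
      by (simp add: algebra_simps)
    then have "norm (H \<xi> - inverse (\<xi> - \<mu>')) = norm t ^ n * inverse (norm (\<xi> - \<mu>'))"
      by (simp add: norm_mult norm_power norm_inverse)
    also have "\<dots> \<le> (1 / 2) ^ n * inverse \<delta>"
    proof (intro mult_mono power_mono)
      have "norm t = norm (\<mu>' - \<mu>) / norm (\<xi> - \<mu>)"
        by (simp add: t_def norm_mult norm_inverse divide_inverse)
      also have "\<dots> \<le> (\<delta> / 2) / \<delta>"
        using dist \<mu>(3) assms(3) by (intro frac_le) auto
      finally show "norm t \<le> 1 / 2" using assms(3) by simp
      show "inverse (norm (\<xi> - \<mu>')) \<le> inverse \<delta>"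
        using dist assms(3) by (intro le_imp_inverse_le)
    qed auto
    also have "\<dots> < e"
      using n assms(3) by (simp add: field_simps)
    finally show ?thesis .
  qed
  ultimately show "\<exists>H. princ_approx w (away K \<delta>) H \<and> (\<forall>\<xi>\<in>away K \<delta>. norm (H \<xi> - inverse (\<xi> - \<mu>')) < e)"
    by blast
qed

text \<open>Convexity keeps the segment from \<open>w\<close> to \<open>\<mu>\<close> inside
  \<open>K\<close>; the pole walks along it in \<open>n\<close> steps of length at most
  \<open>\<delta> / 2\<close>, each covered by the geometric series.\<close>

lemma princ_approx_pole:
  assumes K: "convex K" "w \<in> K" "\<mu> \<in> K" and \<delta>: "0 < \<delta>"
  shows "princ_approx w (away K \<delta>) (\<lambda>\<xi>. inverse (\<xi> - \<mu>))"
proof -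
  obtain n :: nat where large: "2 * norm (\<mu> - w) / \<delta> < of_nat n"
    using reals_Archimedean2 by blast
  have n: "0 < n" "norm (\<mu> - w) / of_nat n \<le> \<delta> / 2"
  proof -
    have "0 \<le> 2 * norm (\<mu> - w) / \<delta>" using \<delta> by simp
    with large have pos: "0 < real n" by linarith
    then show "0 < n" by simp
    have "2 * norm (\<mu> - w) < of_nat n * \<delta>"
      using large \<delta> by (simp add: pos_divide_less_eq)
    then show "norm (\<mu> - w) / of_nat n \<le> \<delta> / 2"
      using pos by (simp add: pos_divide_le_eq mult.commute)
  qed
  define p where "p = (\<lambda>i. w + (of_nat i / of_nat n) *\<^sub>R (\<mu> - w))"
  have p: "p i \<in> K" if "i \<le> n" for i
  proof -
    have "p i = (1 - of_nat i / of_nat n) *\<^sub>R w + (of_nat i / of_nat n) *\<^sub>R \<mu>"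
      by (simp add: p_def algebra_simps)
    then show ?thesis
      using K that n(1) by (auto intro!: convexD)
  qed
  have "princ_approx w (away K \<delta>) (\<lambda>\<xi>. inverse (\<xi> - p i))" if "i \<le> n" for i
    using that
  proof (induction i)
    case 0
    show ?case using princ_approx_princ[OF princ_power[of w 0]] by (simp add: p_def)
  next
    case (Suc i)
    have "p (Suc i) - p i = (1 / of_nat n) *\<^sub>R (\<mu> - w)"
      by (simp add: p_def add_divide_distrib scaleR_add_left)
    then have "norm (p (Suc i) - p i) \<le> \<delta> / 2"
      using n by simp
    with Suc show ?case
      using p K(2) \<delta> by (intro princ_approx_move_pole[of w K \<delta> "p i" "p (Suc i)"]) auto
  qed
  from this[of n] show ?thesis using n(1) by (simp add: p_def)
qed

text \<open>The closure of the principal parts at \<open>w\<close> for uniform convergence on every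
  \<open>away K \<delta>\<close>; an approximant for one \<open>\<delta>\<close> also serves all
  larger ones.\<close>

definition princ_limit :: "complex \<Rightarrow> complex set \<Rightarrow> (complex \<Rightarrow> complex) \<Rightarrow> bool" where
  "princ_limit w K G \<longleftrightarrow> (\<forall>\<delta>>0. princ_approx w (away K \<delta>) G)"

text \<open>Baire's argument carried out by hand: shrinking balls about principal parts, each placed
  inside the next requirement. The premise \<open>dense\<close> combines density, through
  \<open>F'\<close>, with openness, through \<open>e'\<close>.\<close>

lemma generic_princ_limit:
  fixes \<P> :: "((complex \<Rightarrow> complex) \<Rightarrow> bool) set"
  assumes "countable \<P>"
    and dense: "\<And>P F \<delta> e. P \<in> \<P> \<Longrightarrow> F \<in> princ w \<Longrightarrow> 0 < \<delta> \<Longrightarrow> 0 < e \<Longrightarrow>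
      \<exists>F'\<in>princ w. \<exists>e'>0. (\<forall>\<xi>\<in>away K \<delta>. norm (F' \<xi> - F \<xi>) < e) \<and>
        (\<forall>G. princ_limit w K G \<longrightarrow> (\<forall>\<xi>\<in>away K 1. norm (G \<xi> - F' \<xi>) \<le> e') \<longrightarrow> P G)"
  shows "\<exists>G. princ_limit w K G \<and> (\<forall>P\<in>\<P>. P G)"
proof (cases "\<P> = {}")
  case True
  then show ?thesis
    by (intro exI[of _ "\<lambda>\<xi>. 0"]) (simp add: princ_limit_def princ_approx_princ princ_0)
next
  case False
  define A where "A = (\<lambda>n. away K (inverse (of_nat (Suc n))))"
  have A_mono: "A m \<subseteq> A n" if "m \<le> n" for m n
    unfolding A_def using that by (intro away_mono le_imp_inverse_le) auto
  \<comment> \<open>invariant of the nested approximation: requirement \<open>n\<close> holds on the closed ball of radius \<open>e\<close> about \<open>F\<close>\<close>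
  define good where "good = (\<lambda>n F e. \<forall>G. princ_limit w K G \<longrightarrow> (\<forall>\<xi>\<in>away K 1. norm (G \<xi> - F \<xi>) \<le> e) \<longrightarrow> from_nat_into \<P> n G)"
  have "\<exists>s. \<forall>n. (case s n of (F, e) \<Rightarrow> F \<in> princ w \<and> 0 < (e :: real)) \<and>
      (case (s n, s (Suc n)) of ((F, e), (F', e')) \<Rightarrow>
        (\<forall>\<xi>\<in>A n. norm (F' \<xi> - F \<xi>) < e / 2) \<and> e' \<le> e / 2 \<and> good n F' e')"
  proof (rule dependent_nat_choice)
    show "\<exists>s. case s of (F, e) \<Rightarrow> F \<in> princ w \<and> 0 < (e :: real)"
      using princ_0 by (intro exI[of _ "(\<lambda>\<xi>. 0, 1)"]) simp
    fix s :: "(complex \<Rightarrow> complex) \<times> real" and n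
    assume "case s of (F, e) \<Rightarrow> F \<in> princ w \<and> 0 < e"
    then obtain F e where s: "s = (F, e)" "F \<in> princ w" "0 < e" by auto
    have "from_nat_into \<P> n \<in> \<P>" using False by (rule from_nat_into)
    then obtain F' e' where *: "F' \<in> princ w" "0 < e'" "\<forall>\<xi>\<in>A n. norm (F' \<xi> - F \<xi>) < e / 2" "good n F' e'"
      using dense[of "from_nat_into \<P> n" F "inverse (of_nat (Suc n))" "e / 2"] s
      unfolding A_def good_def by auto
    have "good n F' (min e' (e / 2))"
      using *(4) unfolding good_def by auto
    then show "\<exists>s'. (case s' of (F, e) \<Rightarrow> F \<in> princ w \<and> 0 < e) \<and>
        (case (s, s') of ((F, e), (F', e')) \<Rightarrow>
          (\<forall>\<xi>\<in>A n. norm (F' \<xi> - F \<xi>) < e / 2) \<and> e' \<le> e / 2 \<and> good n F' e')"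
      using * s by (intro exI[of _ "(F', min e' (e / 2))"]) auto
  qed
  then obtain s where s: "\<forall>n. (case s n of (F, e) \<Rightarrow> F \<in> princ w \<and> 0 < (e :: real)) \<and>
      (case (s n, s (Suc n)) of ((F, e), (F', e')) \<Rightarrow>
        (\<forall>\<xi>\<in>A n. norm (F' \<xi> - F \<xi>) < e / 2) \<and> e' \<le> e / 2 \<and> good n F' e')"
    ..
  define F e where "F = fst \<circ> s" and "e = snd \<circ> s"
  have F: "F n \<in> princ w" and e: "0 < e n" and step: "\<And>\<xi>. \<xi> \<in> A n \<Longrightarrow> norm (F (Suc n) \<xi> - F n \<xi>) < e n / 2"
    and e2: "e (Suc n) \<le> e n / 2" and good: "good n (F (Suc n)) (e (Suc n))" for n
    using s[rule_format, of n] by (auto simp: F_def e_def case_prod_beta)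
  \<comment> \<open>The estimate telescopes, because \<open>e n / 2 \<le> e n - e (Suc n)\<close>.
    The limit thus stays in every closed ball chosen on the way.\<close>
  have close: "norm (F (n + k) \<xi> - F n \<xi>) \<le> e n - e (n + k)" if "\<xi> \<in> A n" for n k \<xi>
  proof (induction k)
    case (Suc k)
    have "\<xi> \<in> A (n + k)" using that A_mono[of n "n + k"] by auto
    then have "norm (F (n + Suc k) \<xi> - F (n + k) \<xi>) < e (n + k) / 2"
      using step[of \<xi> "n + k"] by simp
    moreover have "norm (F (n + Suc k) \<xi> - F n \<xi>) \<le>
        norm (F (n + Suc k) \<xi> - F (n + k) \<xi>) + norm (F (n + k) \<xi> - F n \<xi>)"
      using norm_triangle_ineq[of "F (n + Suc k) \<xi> - F (n + k) \<xi>" "F (n + k) \<xi> - F n \<xi>"] by simp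
    ultimately show ?case using Suc e2[of "n + k"] by simp
  qed simp
  have e_small: "e n \<le> e 0 / 2 ^ n" for n
  proof (induction n)
    case (Suc n)
    have "e n / 2 \<le> e 0 / 2 ^ n / 2" using Suc by simp
    then show ?case using e2[of n] by simp
  qed simp
  have e_lim: "\<exists>n\<ge>N. e n < \<epsilon>" if "0 < \<epsilon>" for \<epsilon> N
  proof -
    have "(\<lambda>n. e 0 * (1 / 2) ^ n) \<longlonglongrightarrow> e 0 * 0"
      by (intro tendsto_mult tendsto_const LIMSEQ_power_zero) simp
    then have "eventually (\<lambda>n. e 0 * (1 / 2) ^ n < \<epsilon>) sequentially"
      using that by (intro order_tendstoD) auto
    then obtain M where "\<forall>n\<ge>M. e 0 * (1 / 2) ^ n < \<epsilon>"
      by (auto simp: eventually_sequentially)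
    then have "e 0 * (1 / 2) ^ max M N < \<epsilon>" by simp
    then show ?thesis
      using e_small[of "max M N"] by (intro exI[of _ "max M N"]) (auto simp: power_divide)
  qed
  have close': "norm (F m \<xi> - F n \<xi>) \<le> e n" if "\<xi> \<in> A n" "n \<le> m" for n m \<xi>
    using close[OF that(1), of "m - n"] that(2) e[of m] by simp
  define G where "G = (\<lambda>\<xi>. lim (\<lambda>n. F n \<xi>))"
  have G: "norm (G \<xi> - F n \<xi>) \<le> e n" if "\<xi> \<in> A n" for n \<xi>
  proof -
    have "Cauchy (\<lambda>n. F n \<xi>)"
    proof (rule metric_CauchyI)
      fix \<epsilon> :: real assume "0 < \<epsilon>"
      then obtain M where M: "n \<le> M" "e M < \<epsilon> / 2"
        using e_lim[of "\<epsilon> / 2" n] by auto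
      then have "\<xi> \<in> A M" using that A_mono by blast
      have "dist (F m \<xi>) (F m' \<xi>) < \<epsilon>" if "M \<le> m" "M \<le> m'" for m m'
        using close'[OF \<open>\<xi> \<in> A M\<close> that(1)] close'[OF \<open>\<xi> \<in> A M\<close> that(2)] M(2)
          dist_triangle2[of "F m \<xi>" "F m' \<xi>" "F M \<xi>"] by (simp add: dist_norm)
      then show "\<exists>M. \<forall>m\<ge>M. \<forall>n\<ge>M. dist (F m \<xi>) (F n \<xi>) < \<epsilon>" by blast
    qed
    then have "(\<lambda>m. F m \<xi>) \<longlonglongrightarrow> G \<xi>"
      unfolding G_def by (simp add: Cauchy_convergent convergent_LIMSEQ_iff[symmetric])
    then have "(\<lambda>m. norm (F m \<xi> - F n \<xi>)) \<longlonglongrightarrow> norm (G \<xi> - F n \<xi>)"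
      by (intro tendsto_intros)
    then show ?thesis
      by (rule LIMSEQ_le_const2) (use close'[OF that] in blast)
  qed
  have "princ_limit w K G"
    unfolding princ_limit_def princ_approx_def
  proof (intro allI impI)
    fix \<delta> \<epsilon> :: real assume "0 < \<delta>" "0 < \<epsilon>"
    obtain N where N: "inverse (of_nat (Suc N)) < \<delta>"
      using reals_Archimedean[OF \<open>0 < \<delta>\<close>] by auto
    obtain n where n: "N \<le> n" "e n < \<epsilon>"
      using e_lim[OF \<open>0 < \<epsilon>\<close>] by blast
    have "away K \<delta> \<subseteq> A n"
    proof (rule order_trans)
      show "away K \<delta> \<subseteq> A N" unfolding A_def using N by (intro away_mono) simp
    qed (rule A_mono[OF n(1)])
    then have "norm (F n \<xi> - G \<xi>) < \<epsilon>" if "\<xi> \<in> away K \<delta>" for \<xi>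
      using G[of \<xi> n] n(2) that by (simp add: norm_minus_commute subset_eq)
    then show "\<exists>F\<in>princ w. \<forall>\<xi>\<in>away K \<delta>. norm (F \<xi> - G \<xi>) < \<epsilon>"
      by (intro bexI[OF _ F[of n]]) simp
  qed
  moreover have "P G" if P: "P \<in> \<P>" for P
  proof -
    obtain n where "from_nat_into \<P> n = P"
      using from_nat_into_surj[OF assms(1) P] ..
    \<comment> \<open>Requirement \<open>n\<close> is secured by the ball about
      \<open>F (Suc n)\<close>, measured on \<open>away K 1\<close>, which lies inside
      \<open>A (Suc n)\<close>.\<close>
    moreover have "inverse (real (Suc (Suc n))) \<le> inverse 1"
      by (rule le_imp_inverse_le) simp_all
    then have "away K 1 \<subseteq> A (Suc n)"
      unfolding A_def inverse_1 by (rule away_mono)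
    then have "\<forall>\<xi>\<in>away K 1. norm (G \<xi> - F (Suc n) \<xi>) \<le> e (Suc n)"
      using G by (simp only: subset_eq) blast
    then have "from_nat_into \<P> n G"
      using good[of n] \<open>princ_limit w K G\<close> unfolding good_def by simp
    ultimately show ?thesis by simp
  qed
  ultimately show ?thesis
    by (intro exI[of _ G] conjI ballI)
qed

section \<open>Holomorphy and Laurent expansion of the limits\<close>

text \<open>A diagonal choice: the \<open>n\<close>-th approximant is good to
  \<open>1 / (n + 1)\<close> on \<open>away K (1 / (n + 1))\<close>, and a small closed disc off
  \<open>K\<close> lies in these sets eventually. Thus \<open>G\<close> is a locally uniform
  limit.\<close>

lemma princ_limit_holomorphic:
  assumes K: "compact K" and "w \<in> K" and G: "princ_limit w K G"
  shows "G holomorphic_on - K"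
proof -
  have "\<exists>F\<in>princ w. \<forall>\<xi>\<in>away K (inverse (of_nat (Suc n))). norm (F \<xi> - G \<xi>) < inverse (of_nat (Suc n))" for n
    using G unfolding princ_limit_def princ_approx_def by simp
  then obtain F where F: "\<And>n. F n \<in> princ w"
    "\<And>n \<xi>. \<xi> \<in> away K (inverse (of_nat (Suc n))) \<Longrightarrow> norm (F n \<xi> - G \<xi>) < inverse (of_nat (Suc n))"
    by metis
  show ?thesis
  proof (rule holomorphic_uniform_sequence)
    show "open (- K)" using K by (simp add: compact_imp_closed open_Compl)
    show "F n holomorphic_on - K" for n
      using F(1) \<open>w \<in> K\<close> by (intro princ_holomorphic) auto
    fix x assume "x \<in> - K"
    then obtain r where r: "0 < r" "ball x r \<subseteq> - K"
      using \<open>open (- K)\<close> openE by blast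
    have away: "cball x (r / 2) \<subseteq> away K (r / 2)"
    proof
      fix y assume y: "y \<in> cball x (r / 2)"
      have "r / 2 \<le> dist k y" if "k \<in> K" for k
      proof -
        have "k \<notin> ball x r" using r(2) that by blast
        then show ?thesis
          using y dist_triangle[of x k y] by (simp add: dist_commute)
      qed
      then show "y \<in> away K (r / 2)" by (simp add: away_def)
    qed
    have "uniform_limit (cball x (r / 2)) F G sequentially"
      unfolding uniform_limit_iff
    proof (intro allI impI)
      fix e :: real assume e: "0 < e"
      then have "0 < min e (r / 2)" using r(1) by simp
      then obtain N where N: "inverse (of_nat (Suc N)) < min e (r / 2)"
        using reals_Archimedean by blast
      have "dist (F n y) (G y) < e" if n: "N \<le> n" and y: "y \<in> cball x (r / 2)" for n y
      proof -
        have le: "inverse (real (Suc n)) \<le> inverse (real (Suc N))"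
          using n by (intro le_imp_inverse_le) auto
        then have "inverse (real (Suc n)) \<le> r / 2"
          using N by linarith
        then have "y \<in> away K (inverse (of_nat (Suc n)))"
          using subsetD[OF away_mono subsetD[OF away y]] by blast
        from F(2)[OF this] show ?thesis using le N unfolding dist_norm by linarith
      qed
      then show "\<forall>\<^sub>F n in sequentially. \<forall>y\<in>cball x (r / 2). dist (F n y) (G y) < e"
        by (intro eventually_sequentiallyI[of N]) auto
    qed
    moreover have "cball x (r / 2) \<subseteq> - K"
      using r by (intro order_trans[OF _ r(2)]) auto
    ultimately show "\<exists>d>0. cball x d \<subseteq> - K \<and> uniform_limit (cball x d) F G sequentially"
      using r(1) by (intro exI[of _ "r / 2"]) simp
  qed
qed

text \<open>Because \<open>R\<close> leaves a unit margin around \<open>K\<close>, closeness on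
  \<open>away K 1\<close> controls every integral over the circle.\<close>

lemma exterior_subset_away:
  assumes "K \<subseteq> cball w (R - 1)"
  shows "{\<xi>. R \<le> dist w \<xi>} \<subseteq> away K 1"
proof
  fix \<xi> assume \<xi>: "\<xi> \<in> {\<xi>. R \<le> dist w \<xi>}"
  have "1 \<le> dist k \<xi>" if "k \<in> K" for k
    using subsetD[OF assms that] \<xi> dist_triangle[of w \<xi> k] by simp
  then show "\<xi> \<in> away K 1" by (simp add: away_def)
qed

lemma princ_limit_continuous_on_sphere:
  assumes K: "compact K" "K \<subseteq> cball w (R - 1)" and "w \<in> K" "princ_limit w K G"
  shows "continuous_on (sphere w R) G"
proof -
  have "sphere w R \<subseteq> - K"
    using K(2) by force
  then show ?thesis
    using princ_limit_holomorphic[OF K(1) assms(3,4)]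
    by (meson holomorphic_on_imp_continuous_on holomorphic_on_subset)
qed

lemma cint_close:
  assumes R: "0 < R" and c: "continuous_on (sphere w R) \<psi>" "continuous_on (sphere w R) G" "continuous_on (sphere w R) H"
    and B: "\<And>\<xi>. \<xi> \<in> sphere w R \<Longrightarrow> norm (\<psi> \<xi>) \<le> B"
    and \<eta>: "\<And>\<xi>. \<xi> \<in> sphere w R \<Longrightarrow> norm (G \<xi> - H \<xi>) \<le> \<eta>"
  shows "norm (cint w R (\<lambda>\<xi>. \<psi> \<xi> * G \<xi>) - cint w R (\<lambda>\<xi>. \<psi> \<xi> * H \<xi>)) \<le> R * (B * \<eta>)"
proof -
  have "cint w R (\<lambda>\<xi>. \<psi> \<xi> * G \<xi>) - cint w R (\<lambda>\<xi>. \<psi> \<xi> * H \<xi>) = cint w R (\<lambda>\<xi>. \<psi> \<xi> * G \<xi> - \<psi> \<xi> * H \<xi>)"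
    using R c by (intro cint_diff[symmetric] continuous_intros)
  also have "norm \<dots> \<le> R * (B * \<eta>)"
  proof (rule cint_bound[OF R])
    show "continuous_on (sphere w R) (\<lambda>\<xi>. \<psi> \<xi> * G \<xi> - \<psi> \<xi> * H \<xi>)"
      using c by (intro continuous_intros)
    show "norm (\<psi> \<xi> * G \<xi> - \<psi> \<xi> * H \<xi>) \<le> B * \<eta>" if "\<xi> \<in> sphere w R" for \<xi>
      using B[OF that] \<eta>[OF that] order_trans[OF norm_ge_zero B[OF that]]
      unfolding right_diff_distrib[symmetric] norm_mult by (intro mult_mono) simp_all
  qed
  finally show ?thesis .
qed

lemma cint_inverse_power:
  assumes "0 < R"
  shows "cint w R (\<lambda>\<zeta>. inverse (\<zeta> - w) ^ Suc m) = (if m = 0 then 1 else 0)"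
proof -
  have "cint w R (\<lambda>\<zeta>. inverse (\<zeta> - w) ^ Suc m) = cint w R (\<lambda>\<zeta>. 1 / (\<zeta> - w) ^ Suc m)"
    by (simp add: divide_inverse power_inverse)
  also have "\<dots> = (deriv ^^ m) (\<lambda>_. 1) w / fact m"
    using assms by (intro cint_Cauchy_higher) auto
  finally show ?thesis by simp
qed

text \<open>Cauchy's formula for the exterior of the circle; it holds without a constant term since
  principal parts vanish at infinity.\<close>

lemma princ_reproduce:
  assumes F: "F \<in> princ w" and R: "0 < R" and \<xi>: "R < dist w \<xi>"
  shows "cint w R (\<lambda>\<zeta>. inverse (\<xi> - \<zeta>) * F \<zeta>) = F \<xi>"
proof -
  have ker: "(\<lambda>\<zeta>. inverse (\<xi> - \<zeta>)) holomorphic_on cball w R"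
    using \<xi> by (intro holomorphic_intros) auto
  have kc: "continuous_on (sphere w R) (\<lambda>\<zeta>. inverse (\<xi> - \<zeta>))"
    using continuous_on_subset[OF holomorphic_on_imp_continuous_on[OF ker] sphere_cball] .
  have nz: "\<xi> - w \<noteq> 0" using \<xi> R by auto
  have pc: "continuous_on (sphere w R) (\<lambda>\<zeta>. inverse (\<zeta> - w) ^ n)" for n
    using R by (intro continuous_intros) auto
  show ?thesis
    using F
  proof (induction rule: princ_induct)
    case (add F G)
    have "cint w R (\<lambda>\<zeta>. inverse (\<xi> - \<zeta>) * F \<zeta> + inverse (\<xi> - \<zeta>) * G \<zeta>) = F \<xi> + G \<xi>"
      using cint_add[OF R continuous_on_mult[OF kc princ_continuous_on_sphere[OF add(1) R]]
          continuous_on_mult[OF kc princ_continuous_on_sphere[OF add(2) R]]] add(3,4) by simp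
    then show ?case by (simp add: distrib_left)
  next
    case (cmult c F)
    have "cint w R (\<lambda>\<zeta>. c * (inverse (\<xi> - \<zeta>) * F \<zeta>)) = c * F \<xi>"
      using cint_cmult[OF R continuous_on_mult[OF kc princ_continuous_on_sphere[OF cmult(1) R]], of c]
        cmult(2) by simp
    then show ?case by (simp add: mult.left_commute)
  next
    case (power m)
    define I where "I = (\<lambda>n. cint w R (\<lambda>\<zeta>. inverse (\<xi> - \<zeta>) * inverse (\<zeta> - w) ^ n))"
    \<comment> \<open>Partial fractions for \<open>1 / ((\<xi> - \<zeta>) * (\<zeta> - w))\<close>.
      The extra integral is a residue, nonzero only for the simple pole
      \<open>n = 0\<close>.\<close>
    have rec: "I (Suc n) = inverse (\<xi> - w) * ((if n = 0 then 1 else 0) + I n)" for n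
    proof -
      have "I (Suc n) = cint w R (\<lambda>\<zeta>. inverse (\<xi> - w) * (inverse (\<zeta> - w) ^ Suc n + inverse (\<xi> - \<zeta>) * inverse (\<zeta> - w) ^ n))"
        unfolding I_def
      proof (rule cint_cong[OF R])
        fix \<zeta> assume \<zeta>: "\<zeta> \<in> sphere w R"
        then have "\<zeta> - w \<noteq> 0" "\<xi> - \<zeta> \<noteq> 0" using R \<xi> by auto
        then have "inverse (\<xi> - \<zeta>) * inverse (\<zeta> - w) = inverse (\<xi> - w) * (inverse (\<zeta> - w) + inverse (\<xi> - \<zeta>))"
          using nz by (simp add: field_simps)
        then have "inverse (\<xi> - \<zeta>) * inverse (\<zeta> - w) * inverse (\<zeta> - w) ^ n =
            inverse (\<xi> - w) * (inverse (\<zeta> - w) + inverse (\<xi> - \<zeta>)) * inverse (\<zeta> - w) ^ n"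
          by simp
        then show "inverse (\<xi> - \<zeta>) * inverse (\<zeta> - w) ^ Suc n =
            inverse (\<xi> - w) * (inverse (\<zeta> - w) ^ Suc n + inverse (\<xi> - \<zeta>) * inverse (\<zeta> - w) ^ n)"
          by (simp add: algebra_simps)
      qed
      also have "\<dots> = inverse (\<xi> - w) * cint w R (\<lambda>\<zeta>. inverse (\<zeta> - w) ^ Suc n + inverse (\<xi> - \<zeta>) * inverse (\<zeta> - w) ^ n)"
        by (intro cint_cmult R continuous_intros kc pc)
      also have "cint w R (\<lambda>\<zeta>. inverse (\<zeta> - w) ^ Suc n + inverse (\<xi> - \<zeta>) * inverse (\<zeta> - w) ^ n) =
          cint w R (\<lambda>\<zeta>. inverse (\<zeta> - w) ^ Suc n) + I n"
        unfolding I_def by (intro cint_add R continuous_on_mult kc pc)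
      finally show ?thesis by (simp only: cint_inverse_power[OF R])
    qed
    have "I 0 = 0"
      using cint_holomorphic[OF R ker] by (simp add: I_def)
    then have "I (Suc m) = inverse (\<xi> - w) ^ Suc m"
      by (induction m) (simp_all add: rec)
    then show ?case by (simp add: I_def)
  qed simp
qed

lemma princ_limit_reproduce:
  assumes K: "compact K" "K \<subseteq> cball w (R - 1)" "w \<in> K" and G: "princ_limit w K G"
    and R: "0 < R" and \<xi>: "R < dist w \<xi>"
  shows "cint w R (\<lambda>\<zeta>. inverse (\<xi> - \<zeta>) * G \<zeta>) = G \<xi>"
proof -
  have kc: "continuous_on (sphere w R) (\<lambda>\<zeta>. inverse (\<xi> - \<zeta>))"
    using \<xi> by (intro continuous_intros) auto
  obtain B where B: "0 \<le> B" "\<forall>\<zeta>\<in>sphere w R. norm (inverse (\<xi> - \<zeta>)) \<le> B"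
    using norm_bounded_on_sphere[OF kc] by blast
  have Gc: "continuous_on (sphere w R) G"
    using K G by (intro princ_limit_continuous_on_sphere)
  have "norm (cint w R (\<lambda>\<zeta>. inverse (\<xi> - \<zeta>) * G \<zeta>) - G \<xi>) \<le> e" if e: "0 < e" for e
  proof -
    \<comment> \<open>Replacing \<open>G\<close> by \<open>F\<close> costs
      \<open>R * B * \<eta>\<close> in the integral and \<open>\<eta>\<close> at the point
      \<open>\<xi>\<close>, in total \<open>e\<close>.\<close>
    define \<eta> where "\<eta> = e / (R * B + 1)"
    have pos: "0 < R * B + 1" using R B(1) by (simp add: add_nonneg_pos)
    then have "0 < \<eta>" "(R * B + 1) * \<eta> = e"
      using e by (simp_all add: \<eta>_def)
    then have \<eta>: "0 < \<eta>" "R * (B * \<eta>) + \<eta> = e"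
      by (simp_all add: distrib_right mult.assoc)
    obtain F where F: "F \<in> princ w" "\<forall>\<zeta>\<in>away K 1. norm (F \<zeta> - G \<zeta>) < \<eta>"
      using G \<eta>(1) unfolding princ_limit_def princ_approx_def by (meson zero_less_one)
    have near: "norm (G \<zeta> - F \<zeta>) \<le> \<eta>" if "R \<le> dist w \<zeta>" for \<zeta>
    proof -
      have "\<zeta> \<in> away K 1" using exterior_subset_away[OF K(2)] that by blast
      then show ?thesis using F(2) by (simp add: norm_minus_commute less_imp_le)
    qed
    have "norm (cint w R (\<lambda>\<zeta>. inverse (\<xi> - \<zeta>) * G \<zeta>) - cint w R (\<lambda>\<zeta>. inverse (\<xi> - \<zeta>) * F \<zeta>)) \<le> R * (B * \<eta>)"
      using B near by (intro cint_close R kc Gc princ_continuous_on_sphere F(1)) auto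
    then have "norm (cint w R (\<lambda>\<zeta>. inverse (\<xi> - \<zeta>) * G \<zeta>) - F \<xi>) \<le> R * (B * \<eta>)"
      by (simp only: princ_reproduce[OF F(1) R \<xi>])
    moreover have "norm (F \<xi> - G \<xi>) \<le> \<eta>"
      using near[of \<xi>] \<xi> by (simp add: norm_minus_commute)
    ultimately have "norm (cint w R (\<lambda>\<zeta>. inverse (\<xi> - \<zeta>) * G \<zeta>) - G \<xi>) \<le> R * (B * \<eta>) + \<eta>"
      by (rule norm_diff_triangle_le)
    then show ?thesis using \<eta>(2) by simp
  qed
  then have "norm (cint w R (\<lambda>\<zeta>. inverse (\<xi> - \<zeta>) * G \<zeta>) - G \<xi>) \<le> 0"
    by (rule field_le_epsilon[of _ 0, simplified])
  then show ?thesis by simp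
qed

text \<open>Expand the exterior Cauchy kernel as a geometric series in
  \<open>(\<zeta> - c) / (\<xi> - c)\<close>. On the circle this ratio has modulus at most
  \<open>(R + dist w c) / dist c \<xi>\<close>, which is less than 1.\<close>

lemma Laurent_sums:
  assumes K: "compact K" "K \<subseteq> cball w (R - 1)" "w \<in> K" and G: "princ_limit w K G"
    and R: "0 < R" and \<xi>: "R + dist w c < dist c \<xi>"
  shows "(\<lambda>n. cint w R (\<lambda>\<zeta>. (\<zeta> - c) ^ n * G \<zeta>) / (\<xi> - c) ^ Suc n) sums G \<xi>"
proof -
  have Gc: "continuous_on (sphere w R) G"
    using K G by (intro princ_limit_continuous_on_sphere)
  obtain B where B: "0 \<le> B" "\<forall>\<zeta>\<in>sphere w R. norm (G \<zeta>) \<le> B"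
    using norm_bounded_on_sphere[OF Gc] by blast
  define \<rho> where "\<rho> = (R + dist w c) / dist c \<xi>"
  have d: "0 < dist c \<xi>" using \<xi> R zero_le_dist[of w c] by linarith
  have \<rho>: "0 \<le> \<rho>" "\<rho> < 1" using \<xi> R d by (auto simp: \<rho>_def)
  have far: "R < dist w \<xi>"
    using \<xi> dist_triangle[of c \<xi> w] by (simp add: dist_commute)
  have "(\<lambda>n. cint w R (\<lambda>\<zeta>. ((\<zeta> - c) ^ n * inverse (\<xi> - c) ^ Suc n) * G \<zeta>)) sums
      cint w R (\<lambda>\<zeta>. inverse (\<xi> - \<zeta>) * G \<zeta>)"
  proof (rule cint_sums[OF R, where M = "\<lambda>n. \<rho> ^ n * inverse (dist c \<xi>) * B"])
    show "continuous_on (sphere w R) (\<lambda>\<zeta>. ((\<zeta> - c) ^ n * inverse (\<xi> - c) ^ Suc n) * G \<zeta>)" for n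
      by (intro continuous_intros Gc)
    show "summable (\<lambda>n. \<rho> ^ n * inverse (dist c \<xi>) * B)"
      using \<rho> by (intro summable_mult2 summable_geometric) simp
    fix \<zeta> assume \<zeta>: "\<zeta> \<in> sphere w R"
    define t where "t = (\<zeta> - c) * inverse (\<xi> - c)"
    have "norm (\<zeta> - c) \<le> R + dist w c"
      using \<zeta> dist_triangle[of \<zeta> c w] by (simp add: dist_norm norm_minus_commute)
    then have t: "norm t \<le> \<rho>"
      using d by (simp add: t_def \<rho>_def norm_mult norm_inverse dist_norm norm_minus_commute divide_inverse
          mult_right_mono)
    have nz: "\<xi> - c \<noteq> 0" using d by auto
    have ker: "(\<zeta> - c) ^ n * inverse (\<xi> - c) ^ Suc n = t ^ n * inverse (\<xi> - c)" for n
      by (simp add: t_def power_mult_distrib)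
    have "(\<lambda>n. t ^ n * inverse (\<xi> - c)) sums (1 / (1 - t) * inverse (\<xi> - c))"
      using t \<rho> by (intro sums_mult2 geometric_sums) simp
    moreover have "1 / (1 - t) * inverse (\<xi> - c) = inverse (\<xi> - \<zeta>)"
    proof -
      have "(1 - t) * (\<xi> - c) = \<xi> - \<zeta>" using nz by (simp add: t_def field_simps)
      then show ?thesis by (metis divide_inverse inverse_mult_distrib mult_1)
    qed
    ultimately show "(\<lambda>n. ((\<zeta> - c) ^ n * inverse (\<xi> - c) ^ Suc n) * G \<zeta>) sums (inverse (\<xi> - \<zeta>) * G \<zeta>)"
      unfolding ker by (intro sums_mult2) simp
    show "norm (((\<zeta> - c) ^ n * inverse (\<xi> - c) ^ Suc n) * G \<zeta>) \<le> \<rho> ^ n * inverse (dist c \<xi>) * B" for n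
    proof -
      have "norm (t ^ n) \<le> \<rho> ^ n" unfolding norm_power using t by (rule power_mono) simp
      moreover have "norm (inverse (\<xi> - c)) = inverse (dist c \<xi>)"
        by (simp add: norm_inverse dist_norm norm_minus_commute)
      ultimately show ?thesis
        unfolding ker norm_mult using B(2) \<zeta> \<rho>(1) by (intro mult_mono) auto
    qed
  qed
  then have "(\<lambda>n. cint w R (\<lambda>\<zeta>. ((\<zeta> - c) ^ n * inverse (\<xi> - c) ^ Suc n) * G \<zeta>)) sums G \<xi>"
    by (simp only: princ_limit_reproduce[OF K G R far])
  moreover have "cint w R (\<lambda>\<zeta>. ((\<zeta> - c) ^ n * inverse (\<xi> - c) ^ Suc n) * G \<zeta>) =
      cint w R (\<lambda>\<zeta>. (\<zeta> - c) ^ n * G \<zeta>) / (\<xi> - c) ^ Suc n" for n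
  proof -
    have "continuous_on (sphere w R) (\<lambda>\<zeta>. (\<zeta> - c) ^ n * G \<zeta>)"
      by (intro continuous_intros Gc)
    from cint_cmult[OF R this, of "inverse (\<xi> - c) ^ Suc n"] show ?thesis
      by (simp add: divide_inverse power_inverse mult_ac)
  qed
  ultimately show ?thesis by simp
qed

text \<open>A pole of order \<open>m + 1\<close> at \<open>w\<close> has transform
  \<open>z ^ m * exp (w * z) / fact m\<close>, so these targets arise from principal parts.\<close>

lemma exp_transform_poly:
  assumes R: "0 < R"
  shows "\<exists>Q\<in>princ w. \<forall>z. exp_transform w R Q z = poly p z * exp (w * z)"
proof -
  have deriv: "(deriv ^^ m) (\<lambda>\<xi>. exp (\<xi> * z)) = (\<lambda>\<xi>. z ^ m * exp (\<xi> * z))" for m and z :: complex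
  proof (induction m)
    case (Suc m)
    have "deriv (\<lambda>\<xi>. z ^ m * exp (\<xi> * z)) \<xi> = z ^ Suc m * exp (\<xi> * z)" for \<xi>
      by (rule DERIV_imp_deriv) (auto intro!: derivative_eq_intros)
    with Suc show ?case by auto
  qed simp
  have mono: "exp_transform w R (\<lambda>\<xi>. inverse (\<xi> - w) ^ Suc m) z = z ^ m * exp (w * z) / fact m" for m z
  proof -
    have "exp_transform w R (\<lambda>\<xi>. inverse (\<xi> - w) ^ Suc m) z = cint w R (\<lambda>\<xi>. exp (\<xi> * z) / (\<xi> - w) ^ Suc m)"
      by (simp add: exp_transform_def divide_inverse power_inverse mult_ac)
    also have "\<dots> = (deriv ^^ m) (\<lambda>\<xi>. exp (\<xi> * z)) w / fact m"
      by (intro cint_Cauchy_higher R holomorphic_intros)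
    finally show ?thesis by (simp add: deriv)
  qed
  define Q where "Q = (\<lambda>\<xi>. \<Sum>j\<le>degree p. (coeff p j * fact j) * inverse (\<xi> - w) ^ Suc j)"
  have "Q \<in> princ w"
    unfolding Q_def by (intro princ_sum princ_cmult princ_power)
  moreover have "exp_transform w R Q z = poly p z * exp (w * z)" for z
  proof -
    have "exp_transform w R Q z = (\<Sum>j\<le>degree p. (coeff p j * fact j) * exp_transform w R (\<lambda>\<xi>. inverse (\<xi> - w) ^ Suc j) z)"
      unfolding Q_def by (intro exp_transform_lincomb R princ_continuous_on_sphere princ_power)
    also have "\<dots> = (\<Sum>j\<le>degree p. coeff p j * z ^ j * exp (w * z))"
      by (simp only: mono) (simp add: mult.assoc)
    finally show ?thesis by (simp add: poly_altdef sum_distrib_right)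
  qed
  ultimately show ?thesis by blast
qed

section \<open>Density of the requirements\<close>

text \<open>Steering supplies \<open>H n\<close> near \<open>F\<close> whose orbit is within
  \<open>\<eta> / 2\<close> of the target at time \<open>n\<close>. For this fixed \<open>n\<close>
  the orbit point depends continuously on the values on the circle, which leaves room for a whole
  ball of functions \<open>G\<close>.\<close>

lemma orbit_requirement_dense:
  assumes \<phi>: "\<phi> \<in> entire" "\<not> \<phi> constant_on UNIV" and w: "norm (\<phi> w) = 1" and R: "0 < R"
    and K: "compact K" "K \<subseteq> cball w (R - 1)" "w \<in> K"
    and F: "F \<in> princ w" and \<delta>: "0 < \<delta>" and e: "0 < e" and \<eta>: "0 < \<eta>"
  shows "\<exists>F'\<in>princ w. \<exists>e'>0. (\<forall>\<xi>\<in>away K \<delta>. norm (F' \<xi> - F \<xi>) < e) \<and>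
    (\<forall>G. princ_limit w K G \<longrightarrow> (\<forall>\<xi>\<in>away K 1. norm (G \<xi> - F' \<xi>) \<le> e') \<longrightarrow>
      (\<exists>n. \<forall>z\<in>cball 0 B. norm (exp_transform w R (\<lambda>\<xi>. \<phi> \<xi> ^ n * G \<xi>) z - poly p z * exp (w * z)) < \<eta>))"
proof -
  obtain Q where Q: "Q \<in> princ w" "\<And>z. exp_transform w R Q z = poly p z * exp (w * z)"
    using exp_transform_poly[OF R] by blast
  obtain H where H: "\<And>n. H n \<in> princ w" "uniform_limit {\<xi>. \<delta> \<le> dist w \<xi>} H F sequentially"
    "uniform_limit (cball 0 B) (\<lambda>n. exp_transform w R (\<lambda>\<xi>. \<phi> \<xi> ^ n * H n \<xi>)) (exp_transform w R Q) sequentially"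
    using steerable_princ[OF \<phi> w R F Q(1)] \<delta> unfolding steerable_def by blast
  have "0 < \<eta> / 2" using \<eta> by simp
  then obtain n where n1: "\<forall>\<xi>\<in>{\<xi>. \<delta> \<le> dist w \<xi>}. dist (H n \<xi>) (F \<xi>) < e"
    and n2: "\<forall>z\<in>cball 0 B. dist (exp_transform w R (\<lambda>\<xi>. \<phi> \<xi> ^ n * H n \<xi>) z) (exp_transform w R Q z) < \<eta> / 2"
    \<comment> \<open>Both limits hold along all large \<open>n\<close>, so a single
      \<open>n\<close> serves both.\<close>
    using eventually_happens'[OF sequentially_bot eventually_conj[OF uniform_limitD[OF H(2) e] uniform_limitD[OF H(3)]]]
    by blast
  have \<phi>c: "continuous_on (sphere w R) (\<lambda>\<xi>. \<phi> \<xi> ^ n)"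
    by (intro continuous_intros entire_continuous_on \<phi>)
  obtain M where M: "0 \<le> M" "\<forall>\<xi>\<in>sphere w R. norm (\<phi> \<xi> ^ n) \<le> M"
    using norm_bounded_on_sphere[OF \<phi>c] by blast
  define C where "C = R * M * exp ((norm w + R) * B)"
  have C: "0 \<le> C" using R M(1) by (simp add: C_def)
  define e' where "e' = \<eta> / 2 / (C + 1)"
  have e': "0 < e'" "C * e' < \<eta> / 2"
  proof -
    show "0 < e'" using \<eta> C by (simp add: e'_def)
    then have "C * e' < (C + 1) * e'" by (simp add: distrib_right)
    also have "\<dots> = \<eta> / 2"
      unfolding e'_def by (rule trans[OF times_divide_eq_right nonzero_mult_div_cancel_left]) (use C in linarith)
    finally show "C * e' < \<eta> / 2" .
  qed
  have "norm (exp_transform w R (\<lambda>\<xi>. \<phi> \<xi> ^ n * G \<xi>) z - poly p z * exp (w * z)) < \<eta>"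
    if G: "princ_limit w K G" "\<forall>\<xi>\<in>away K 1. norm (G \<xi> - H n \<xi>) \<le> e'" and z: "z \<in> cball 0 B" for G z
  proof -
    have Gc: "continuous_on (sphere w R) G"
      using K G(1) by (intro princ_limit_continuous_on_sphere)
    have Hc: "continuous_on (sphere w R) (H n)"
      using H(1) R by (intro princ_continuous_on_sphere)
    have "exp_transform w R (\<lambda>\<xi>. \<phi> \<xi> ^ n * G \<xi>) z =
        exp_transform w R (\<lambda>\<xi>. \<phi> \<xi> ^ n * H n \<xi> + \<phi> \<xi> ^ n * (G \<xi> - H n \<xi>)) z"
      by (simp add: algebra_simps)
    also have "\<dots> = exp_transform w R (\<lambda>\<xi>. \<phi> \<xi> ^ n * H n \<xi>) z + exp_transform w R (\<lambda>\<xi>. \<phi> \<xi> ^ n * (G \<xi> - H n \<xi>)) z"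
      by (intro exp_transform_add R continuous_intros entire_continuous_on \<phi> Gc Hc)
    finally have split: "exp_transform w R (\<lambda>\<xi>. \<phi> \<xi> ^ n * G \<xi>) z - exp_transform w R (\<lambda>\<xi>. \<phi> \<xi> ^ n * H n \<xi>) z =
        exp_transform w R (\<lambda>\<xi>. \<phi> \<xi> ^ n * (G \<xi> - H n \<xi>)) z"
      by simp
    have "norm (exp_transform w R (\<lambda>\<xi>. \<phi> \<xi> ^ n * (G \<xi> - H n \<xi>)) z) \<le> R * ((M * e') * exp ((norm w + R) * norm z))"
    proof (rule exp_transform_norm_le[OF R])
      show "continuous_on (sphere w R) (\<lambda>\<xi>. \<phi> \<xi> ^ n * (G \<xi> - H n \<xi>))"
        by (intro continuous_intros entire_continuous_on \<phi> Gc Hc)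
      fix \<xi> assume \<xi>: "\<xi> \<in> sphere w R"
      then have "\<xi> \<in> away K 1"
        using exterior_subset_away[OF K(2)] by auto
      then show "norm (\<phi> \<xi> ^ n * (G \<xi> - H n \<xi>)) \<le> M * e'"
        unfolding norm_mult using M \<xi> G(2) by (intro mult_mono) auto
    qed
    also have "\<dots> \<le> R * ((M * e') * exp ((norm w + R) * B))"
      using R M(1) e'(1) z by (intro mult_left_mono iffD2[OF exp_le_cancel_iff]) auto
    also have "\<dots> = C * e'" by (simp add: C_def)
    finally have "norm (exp_transform w R (\<lambda>\<xi>. \<phi> \<xi> ^ n * G \<xi>) z - exp_transform w R (\<lambda>\<xi>. \<phi> \<xi> ^ n * H n \<xi>) z) < \<eta> / 2"
      unfolding split using e'(2) by linarith
    moreover have "norm (exp_transform w R (\<lambda>\<xi>. \<phi> \<xi> ^ n * H n \<xi>) z - poly p z * exp (w * z)) < \<eta> / 2"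
      using bspec[OF n2 z] by (simp add: Q(2) dist_norm)
    ultimately show ?thesis
      using norm_diff_triangle_less by fastforce
  qed
  moreover have "norm (H n \<xi> - F \<xi>) < e" if "\<xi> \<in> away K \<delta>" for \<xi>
    using n1 that K(3) by (simp add: away_def dist_norm)
  ultimately show ?thesis
    using e'(1) by (intro bexI[OF _ H(1)[of n]] exI[of _ e'] conjI ballI allI impI exI[of _ n])
qed

text \<open>By Cauchy's formula, adding \<open>t / (\<xi> - \<mu>)\<close> changes the
  \<open>n\<close>-th Laurent coefficient about \<open>c\<close> by
  \<open>t * (\<mu> - c) ^ n\<close>, which exceeds \<open>2 * r ^ n\<close> in modulus for suitable
  large \<open>n\<close>, however small \<open>t\<close> is.\<close>

lemma growth_requirement_dense:
  assumes R: "0 < R" and K: "compact K" "convex K" "K \<subseteq> cball w (R - 1)" "w \<in> K"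
    and \<mu>: "\<mu> \<in> K" "r < dist c \<mu>" and r: "0 < r"
    and F: "F \<in> princ w" and \<delta>: "0 < \<delta>" and e: "0 < e"
  shows "\<exists>F'\<in>princ w. \<exists>e'>0. (\<forall>\<xi>\<in>away K \<delta>. norm (F' \<xi> - F \<xi>) < e) \<and>
    (\<forall>G. princ_limit w K G \<longrightarrow> (\<forall>\<xi>\<in>away K 1. norm (G \<xi> - F' \<xi>) \<le> e') \<longrightarrow>
      (\<exists>n\<ge>N. r ^ n < norm (cint w R (\<lambda>\<zeta>. (\<zeta> - c) ^ n * G \<zeta>))))"
proof -
  \<comment> \<open>Capped at 1 so that the approximation on \<open>away K \<delta>'\<close> also
    reaches the circle.\<close>
  define \<delta>' where "\<delta>' = min \<delta> 1"
  have \<delta>': "0 < \<delta>'" "\<delta>' \<le> \<delta>" "\<delta>' \<le> 1" using \<delta> by (auto simp: \<delta>'_def)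
  \<comment> \<open>On \<open>away K \<delta>'\<close> the perturbation is at most
    \<open>t / \<delta>' = e / 2\<close>.\<close>
  define t where "t = e * \<delta>' / 2"
  have t: "0 < t" using e \<delta>' by (simp add: t_def)
  have Fc: "continuous_on (sphere w R) F" using F R by (rule princ_continuous_on_sphere)
  have \<mu>w: "\<mu> \<in> ball w R" using K(3) \<mu>(1) by force
  obtain n where n: "N \<le> n" "2 * r ^ n < t * dist c \<mu> ^ n"
  proof -
    have "1 < dist c \<mu> / r" using \<mu>(2) r by simp
    then obtain k where k: "2 / t < (dist c \<mu> / r) ^ k"
      using real_arch_pow by blast
    also have "\<dots> \<le> (dist c \<mu> / r) ^ max k N"
      using \<open>1 < dist c \<mu> / r\<close> by (intro power_increasing) auto
    finally have "2 * r ^ max k N < t * dist c \<mu> ^ max k N"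
      using t r by (simp add: power_divide field_simps)
    then show ?thesis using that[of "max k N"] by simp
  qed
  define \<alpha> where "\<alpha> = (\<lambda>G. cint w R (\<lambda>\<zeta>. (\<zeta> - c) ^ n * G \<zeta>))"
  define H where "H = (\<lambda>s \<xi>. F \<xi> + of_real s * inverse (\<xi> - \<mu>))"
  have pole_c: "continuous_on (sphere w R) (\<lambda>\<xi>. inverse (\<xi> - \<mu>))"
    using \<mu>w by (intro continuous_intros) auto
  have Hc: "continuous_on (sphere w R) (H s)" for s
    unfolding H_def by (intro continuous_intros Fc pole_c)
  have "\<alpha> (H t) = \<alpha> F + of_real t * (\<mu> - c) ^ n"
  proof -
    have "\<alpha> (H t) = cint w R (\<lambda>\<zeta>. (\<zeta> - c) ^ n * F \<zeta> + of_real t * ((\<zeta> - c) ^ n / (\<zeta> - \<mu>)))"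
      by (simp add: \<alpha>_def H_def distrib_left divide_inverse mult_ac)
    also have "\<dots> = \<alpha> F + cint w R (\<lambda>\<zeta>. of_real t * ((\<zeta> - c) ^ n / (\<zeta> - \<mu>)))"
      unfolding \<alpha>_def divide_inverse by (intro cint_add R continuous_intros Fc pole_c)
    also have "cint w R (\<lambda>\<zeta>. of_real t * ((\<zeta> - c) ^ n / (\<zeta> - \<mu>))) = of_real t * cint w R (\<lambda>\<zeta>. (\<zeta> - c) ^ n / (\<zeta> - \<mu>))"
      unfolding divide_inverse by (intro cint_cmult R continuous_intros pole_c)
    also have "cint w R (\<lambda>\<zeta>. (\<zeta> - c) ^ n / (\<zeta> - \<mu>)) = (\<mu> - c) ^ n"
      by (intro cint_Cauchy R holomorphic_intros \<mu>w)
    finally show ?thesis .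
  qed
  then have "norm (of_real t * (\<mu> - c) ^ n) \<le> norm (\<alpha> (H t)) + norm (\<alpha> F)"
    using norm_triangle_ineq4[of "\<alpha> (H t)" "\<alpha> F"] by simp
  moreover have "norm (of_real t * (\<mu> - c) ^ n) = t * dist c \<mu> ^ n"
    using t by (simp add: norm_mult norm_power dist_norm norm_minus_commute)
  \<comment> \<open>Two coefficients differing by more than \<open>2 * r ^ n\<close> cannot both
    have modulus at most \<open>r ^ n\<close>: either the perturbed function or \<open>F\<close>
    itself works.\<close>
  ultimately have "r ^ n < norm (\<alpha> (H t)) \<or> r ^ n < norm (\<alpha> (H 0))"
    using n(2) by (auto simp: H_def)
  then obtain s where s: "0 \<le> s" "s \<le> t" "r ^ n < norm (\<alpha> (H s))"
    using t by (metis less_imp_le order_refl)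
  have Hs: "princ_approx w (away K \<delta>') (H s)"
    unfolding H_def using K \<mu>(1) \<delta>'(1) F
    by (intro princ_approx_add princ_approx_cmult princ_approx_pole princ_approx_princ)
  have powc: "continuous_on (sphere w R) (\<lambda>\<zeta>. (\<zeta> - c) ^ n)"
    by (intro continuous_intros)
  obtain B where B: "0 \<le> B" "\<forall>\<zeta>\<in>sphere w R. norm ((\<zeta> - c) ^ n) \<le> B"
    using norm_bounded_on_sphere[OF powc] by blast
  \<comment> \<open>On the circle \<open>G\<close> is within \<open>2 * \<eta>\<close> of
    \<open>H s\<close>, so its coefficient moves by at most \<open>R * B * 2 * \<eta>\<close>, which
    has to stay below this surplus.\<close>
  define gap where "gap = norm (\<alpha> (H s)) - r ^ n"
  define \<eta> where "\<eta> = min (e / 2) (gap / 2 / (R * B + 1))"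
  have pos: "0 < R * B + 1" using R B(1) by (simp add: add_nonneg_pos)
  have gap: "0 < gap" using s(3) by (simp add: gap_def)
  have "0 < gap / 2 / (R * B + 1)" using gap pos by simp
  then have \<eta>: "0 < \<eta>" "\<eta> \<le> e / 2"
    using e unfolding \<eta>_def by linarith+
  have small: "R * (B * (2 * \<eta>)) < gap"
  proof -
    have "(R * B + 1) * \<eta> \<le> (R * B + 1) * (gap / 2 / (R * B + 1))"
      using pos unfolding \<eta>_def by (intro mult_left_mono) linarith+
    also have "\<dots> = gap / 2"
      by (rule trans[OF times_divide_eq_right nonzero_mult_div_cancel_left]) (use pos in linarith)
    finally have "2 * ((R * B + 1) * \<eta>) \<le> gap" by simp
    moreover have "R * (B * (2 * \<eta>)) < 2 * ((R * B + 1) * \<eta>)"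
      using \<eta>(1) by (simp add: algebra_simps)
    ultimately show ?thesis by linarith
  qed
  obtain F' where F': "F' \<in> princ w" "\<forall>\<xi>\<in>away K \<delta>'. norm (F' \<xi> - H s \<xi>) < \<eta>"
    using Hs \<eta>(1) unfolding princ_approx_def by blast
  have "norm (F' \<xi> - F \<xi>) < e" if \<xi>: "\<xi> \<in> away K \<delta>" for \<xi>
  proof -
    have "\<xi> \<in> away K \<delta>'" using \<xi> away_mono[OF \<delta>'(2)] by blast
    then have near: "norm (F' \<xi> - H s \<xi>) < \<eta>" and "\<delta>' \<le> dist \<mu> \<xi>"
      using F'(2) \<mu>(1) by (auto simp: away_def)
    then have inv: "inverse (norm (\<xi> - \<mu>)) \<le> inverse \<delta>'"
      using \<delta>'(1) by (intro le_imp_inverse_le) (simp_all add: dist_norm norm_minus_commute)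
    have "norm (H s \<xi> - F \<xi>) = s * inverse (norm (\<xi> - \<mu>))"
      using s(1) by (simp add: H_def norm_mult norm_inverse)
    also have "\<dots> \<le> t * inverse \<delta>'"
      using s(1,2) inv by (intro mult_mono) auto
    also have "\<dots> = e / 2"
      using \<delta>'(1) by (simp add: t_def)
    finally have "norm (H s \<xi> - F \<xi>) \<le> e / 2" .
    with near \<eta>(2) norm_triangle_ineq[of "F' \<xi> - H s \<xi>" "H s \<xi> - F \<xi>"] show ?thesis by simp
  qed
  moreover have "\<exists>n\<ge>N. r ^ n < norm (cint w R (\<lambda>\<zeta>. (\<zeta> - c) ^ n * G \<zeta>))"
    if G: "princ_limit w K G" "\<forall>\<xi>\<in>away K 1. norm (G \<xi> - F' \<xi>) \<le> \<eta>" for G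
  proof -
    have Gc: "continuous_on (sphere w R) G"
      using K G(1) by (intro princ_limit_continuous_on_sphere)
    have "norm (H s \<zeta> - G \<zeta>) \<le> 2 * \<eta>" if \<zeta>: "\<zeta> \<in> sphere w R" for \<zeta>
    proof -
      have 1: "\<zeta> \<in> away K 1" using exterior_subset_away[OF K(3)] \<zeta> by auto
      then have "\<zeta> \<in> away K \<delta>'" using away_mono[OF \<delta>'(3)] by blast
      then have "norm (F' \<zeta> - H s \<zeta>) < \<eta>" using F'(2) by blast
      moreover have "norm (G \<zeta> - F' \<zeta>) \<le> \<eta>" using G(2) 1 by blast
      ultimately show ?thesis
        using norm_triangle_ineq[of "G \<zeta> - F' \<zeta>" "F' \<zeta> - H s \<zeta>"] by (simp add: norm_minus_commute)
    qed
    then have "norm (\<alpha> (H s) - \<alpha> G) \<le> R * (B * (2 * \<eta>))"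
      unfolding \<alpha>_def using B(2) by (intro cint_close R powc Hc Gc) auto
    then have "norm (\<alpha> (H s)) - norm (\<alpha> G) < gap"
      using small norm_triangle_ineq2[of "\<alpha> (H s)" "\<alpha> G"] by linarith
    then have "r ^ n < norm (\<alpha> G)" by (simp add: gap_def)
    then show ?thesis using n(1) unfolding \<alpha>_def by blast
  qed
  ultimately show ?thesis
    using \<eta>(1) by (intro bexI[OF _ F'(1)] exI[of _ \<eta>] conjI ballI allI impI)
qed

section \<open>The conjugate indicator diagram\<close>

text \<open>A compact convex set is an intersection of closed discs; as the separation is strict,
  centres from a dense set suffice.\<close>

lemma separating_disc:
  fixes a :: complex
  assumes K: "compact K" "convex K" "a \<notin> K"
    and D: "\<And>X :: complex set. open X \<Longrightarrow> X \<noteq> {} \<Longrightarrow> \<exists>d\<in>D. d \<in> X"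
  obtains c r where "c \<in> D" "0 < r" "K \<subseteq> cball c r" "r < dist c a"
proof -
  \<comment> \<open>a large disc whose centre lies far out along the inner normal of a separating line\<close>
  obtain c r0 where r0: "0 \<le> r0" "r0 < dist c a" "\<forall>x\<in>K. dist c x \<le> r0"
  proof (cases "K = {}")
    case True
    then show ?thesis by (intro that[of 0 "a + 1"]) (auto simp: dist_norm)
  next
    case False
    then obtain x0 where x0: "x0 \<in> K" by blast
    obtain u b where ub: "inner u a < b" "\<forall>x\<in>K. b < inner u x"
      using separating_hyperplane_closed_point[OF K(2) compact_imp_closed[OF K(1)] K(3)] by blast
    obtain M where M: "0 < M" "\<forall>x\<in>K. norm (x - a) \<le> M"
      using compact_imp_bounded[OF compact_translation_subtract[OF K(1), of a]] unfolding bounded_pos by auto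
    define \<kappa> where "\<kappa> = b - inner u a"
    have \<kappa>: "0 < \<kappa>" using ub(1) by (simp add: \<kappa>_def)
    \<comment> \<open>Moving the centre by \<open>T *\<^sub>R u\<close> gains at least
      \<open>2 * T * \<kappa> = 2 * M ^ 2 + 2 * \<kappa>\<close> from the linear term of the squared
      distance, against a quadratic term of at most \<open>M ^ 2\<close>.\<close>
    define T where "T = M\<^sup>2 / \<kappa> + 1"
    have T: "0 < T" using \<kappa> by (simp add: T_def add_nonneg_pos)
    define c where "c = a + T *\<^sub>R u"
    define L where "L = dist c a"
    have closer: "dist c x ^ 2 \<le> L ^ 2 - \<kappa>" if x: "x \<in> K" for x
    proof -
      define y where "y = x - a"
      have "dist c x = norm (T *\<^sub>R u - y)" "L = norm (T *\<^sub>R u)"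
        by (simp_all add: c_def L_def y_def dist_norm algebra_simps)
      then have "dist c x ^ 2 = L ^ 2 - 2 * T * inner u y + norm y ^ 2"
        by (simp only: power2_norm_eq_inner inner_diff) (simp add: inner_commute)
      also have "\<dots> = L ^ 2 - 2 * T * inner u (x - a) + norm (x - a) ^ 2"
        by (simp only: y_def)
      also have "\<dots> \<le> L ^ 2 - 2 * T * \<kappa> + M ^ 2"
      proof -
        have "\<kappa> \<le> inner u (x - a)"
          using ub(2) x by (force simp: \<kappa>_def inner_diff_right)
        then have "T * \<kappa> \<le> T * inner u (x - a)" using T by simp
        moreover have "norm (x - a) ^ 2 \<le> M ^ 2" using M(2) x by (intro power_mono) auto
        ultimately show ?thesis by simp
      qed
      also have "\<dots> = L ^ 2 - M ^ 2 - 2 * \<kappa>"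
        using \<kappa> by (simp add: T_def field_simps)
      also have "\<dots> \<le> L ^ 2 - \<kappa>" using \<kappa> zero_le_power2[of M] by linarith
      finally show ?thesis .
    qed
    have nonneg: "0 \<le> L ^ 2 - \<kappa>" using closer[OF x0] zero_le_power2[of "dist c x0"] by linarith
    show ?thesis
    proof (rule that)
      show "0 \<le> sqrt (L ^ 2 - \<kappa>)" using nonneg by simp
      show "sqrt (L ^ 2 - \<kappa>) < dist c a"
        using \<kappa> nonneg unfolding L_def[symmetric] by (intro real_less_lsqrt) (auto simp: L_def)
      show "\<forall>x\<in>K. dist c x \<le> sqrt (L ^ 2 - \<kappa>)" using closer by (auto intro: real_le_rsqrt)
    qed
  qed
  define L where "L = dist c a"
  \<comment> \<open>A quarter of the slack: shifting the centre by less than \<open>d\<close>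
    changes distances by less than \<open>d\<close>, so the radius \<open>r0 + 2 * d\<close> still
    separates.\<close>
  define d where "d = (L - r0) / 4"
  have d: "0 < d" using r0 by (simp add: d_def L_def)
  obtain c' where c': "c' \<in> D" "c' \<in> ball c d"
    using D[of "ball c d"] d by auto
  show ?thesis
  proof (rule that[OF c'(1)])
    show "0 < r0 + 2 * d" using r0(1) d by simp
    show "K \<subseteq> cball c' (r0 + 2 * d)"
    proof
      fix x assume "x \<in> K"
      then show "x \<in> cball c' (r0 + 2 * d)"
        using r0(3) c'(2) d dist_triangle[of c' x c] by (fastforce simp: dist_commute)
    qed
    show "r0 + 2 * d < dist c' a"
    proof -
      have "L \<le> dist c c' + dist c' a" unfolding L_def by (rule dist_triangle)
      moreover have "dist c c' < d" using c'(2) by simp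
      moreover have "L = r0 + 4 * d" by (simp add: d_def field_simps)
      ultimately show ?thesis using d by linarith
    qed
  qed
qed

text \<open>The derivatives of the transform at 0 are the Laurent coefficients of \<open>G\<close>
  about 0, so the Borel series is the Laurent series of \<open>G\<close>.\<close>

lemma borel_transform_exp_transform:
  assumes K: "compact K" "K \<subseteq> cball w (R - 1)" "w \<in> K" and G: "princ_limit w K G"
    and R: "0 < R" and z: "R + norm w < norm z"
  shows "borel_transform (exp_transform w R G) z = G z"
proof -
  have Gc: "continuous_on (sphere w R) G"
    using K G by (intro princ_limit_continuous_on_sphere)
  have "(deriv ^^ n) (exp_transform w R G) 0 = cint w R (\<lambda>\<zeta>. (\<zeta> - 0) ^ n * G \<zeta>)" for n
    by (simp add: higher_deriv_exp_transform[OF R Gc] exp_transform_def)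
  then show ?thesis
    using Laurent_sums[OF K G R, of 0 z] z
    by (simp add: borel_transform_def sums_iff)
qed

text \<open>The function \<open>G\<close> itself continues the Borel transform off \<open>K\<close>.
  If a competitor \<open>K'\<close> missed a point of \<open>K\<close>, a disc containing
  \<open>K'\<close> but not that point would bound the growth of the Laurent coefficients about its
  centre, contrary to \<open>growth\<close>.\<close>

lemma conj_indicator_diagram_exp_transform:
  assumes K: "compact K" "convex K" "K \<subseteq> cball w (R - 1)" "w \<in> K" and G: "princ_limit w K G"
    and R: "0 < R"
    and D: "\<And>X :: complex set. open X \<Longrightarrow> X \<noteq> {} \<Longrightarrow> \<exists>d\<in>D. d \<in> X"
    and growth: "\<And>c r N \<mu>. c \<in> D \<Longrightarrow> r \<in> \<rat> \<Longrightarrow> 0 < r \<Longrightarrow> \<mu> \<in> K \<Longrightarrow> r < dist c \<mu> \<Longrightarrow>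
      \<exists>n\<ge>N. r ^ n < norm (cint w R (\<lambda>\<zeta>. (\<zeta> - c) ^ n * G \<zeta>))"
  shows "conj_indicator_diagram (exp_transform w R G) = K"
  unfolding conj_indicator_diagram_def
proof (rule Least_equality)
  let ?f = "exp_transform w R G"
  have borel: "borel_transform ?f z = G z" if "R + norm w < norm z" for z
    using borel_transform_exp_transform[OF K(1,3,4) G R that] .
  have "borel_continues_off ?f K"
    unfolding borel_continues_off_def eventually_at_infinity
  proof (intro exI[of _ G] exI[of _ "R + norm w + 1"] conjI allI impI)
    show "G holomorphic_on - K"
      using K G by (intro princ_limit_holomorphic)
    show "G z = borel_transform ?f z" if "R + norm w + 1 \<le> norm z" for z
      using borel[of z] that by simp
  qed
  with K show "compact K \<and> convex K \<and> borel_continues_off ?f K" by blast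
next
  fix K' assume K': "compact K' \<and> convex K' \<and> borel_continues_off (exp_transform w R G) K'"
  show "K \<subseteq> K'"
  proof
    fix a assume a: "a \<in> K"
    show "a \<in> K'"
    proof (rule ccontr)
      assume "a \<notin> K'"
      with K' obtain c r where c: "c \<in> D" and r: "0 < r" "K' \<subseteq> cball c r" "r < dist c a"
        using separating_disc[OF _ _ _ D, of K' a] by blast
      \<comment> \<open>The growth hypothesis covers rational radii only, which keeps the family of
        requirements countable.\<close>
      obtain s where s: "s \<in> \<rat>" "r < s" "s < dist c a"
        using Rats_dense_in_real[OF r(3)] by blast
      define \<alpha> where "\<alpha> = (\<lambda>n. cint w R (\<lambda>\<zeta>. (\<zeta> - c) ^ n * G \<zeta>))"
      obtain F b where F: "F holomorphic_on - K'"
        and Fb: "\<And>z. b \<le> norm z \<Longrightarrow> F z = borel_transform (exp_transform w R G) z"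
        using K' unfolding borel_continues_off_def eventually_at_infinity by blast
      \<comment> \<open>\<open>H u = (\<Sum>n. \<alpha> n * u ^ Suc n)\<close> near \<open>0\<close>; the continuation to \<open>- K'\<close> makes the series
        converge at \<open>1 / s\<close>, against the growth of \<open>\<alpha>\<close>\<close>
      define H where "H = (\<lambda>u. if u = 0 then 0 else F (c + inverse u))"
      define A where "A = Abs_fps (\<lambda>n. case n of 0 \<Rightarrow> 0 | Suc n \<Rightarrow> \<alpha> n)"
      \<comment> \<open>If \<open>norm u < inverse M\<close>, then \<open>z = c + inverse u\<close>
        is far enough out for the Laurent expansion about \<open>c\<close>, for \<open>F\<close> to
        agree with the Borel series, and for that series to equal \<open>G z\<close>.\<close>
      define M where "M = \<bar>b\<bar> + R + norm w + norm c + dist w c + 1"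
      have M: "0 < M"
        unfolding M_def using R norm_ge_zero[of w] norm_ge_zero[of c] zero_le_dist[of w c] by linarith
      have near_0: "(\<lambda>n. fps_nth A n * u ^ n) sums H u" if u: "norm u < inverse M" for u
      proof (cases "u = 0")
        case True
        have "(\<lambda>n. fps_nth A n * 0 ^ n) sums fps_nth A 0"
          using powser_sums_zero[of "fps_nth A"] .
        then show ?thesis using True by (simp add: H_def A_def)
      next
        case False
        define z where "z = c + inverse u"
        have big: "M < norm (inverse u)"
          using less_imp_inverse_less[OF u] False by (simp add: norm_inverse)
        moreover have "dist c z = norm (inverse u)"
          by (simp add: z_def dist_norm)
        ultimately have zc: "R + dist w c < dist c z"
          unfolding M_def using norm_ge_zero[of w] norm_ge_zero[of c] by linarith
        have "norm (inverse u) \<le> norm z + norm c"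
          using norm_triangle_ineq4[of z c] by (simp add: z_def)
        then have "b \<le> norm z" "R + norm w < norm z"
          using big zero_le_dist[of w c] R norm_ge_zero[of w] unfolding M_def by linarith+
        then have "H u = G z"
          using False Fb[of z] borel_transform_exp_transform[OF K(1,3,4) G R, of z] by (simp add: H_def z_def)
        moreover have "(\<lambda>n. \<alpha> n / (z - c) ^ Suc n) sums G z"
          unfolding \<alpha>_def by (rule Laurent_sums[OF K(1,3,4) G R zc])
        then have "(\<lambda>n. fps_nth A (Suc n) * u ^ Suc n) sums G z"
          by (simp add: A_def z_def divide_inverse power_inverse)
        then have "(\<lambda>n. fps_nth A n * u ^ n) sums (G z + fps_nth A 0 * u ^ 0)"
          by (rule sums_Suc)
        ultimately show ?thesis by (simp add: A_def)
      qed
      then have exp: "H has_fps_expansion A"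
        using M by (intro has_fps_expansionI) (auto simp: eventually_nhds_metric intro!: exI[of _ "inverse M"])
      obtain S where S: "open S" "0 \<in> S" "H holomorphic_on S"
        using has_fps_expansion_imp_holomorphic[OF exp] by metis
      have "H holomorphic_on ball 0 (inverse r) - {0}"
      proof -
        have "(\<lambda>u. F (c + inverse u)) holomorphic_on ball 0 (inverse r) - {0}"
        proof (rule holomorphic_on_compose_gen[OF _ F, unfolded o_def])
          show "(\<lambda>u. c + inverse u) holomorphic_on ball 0 (inverse r) - {0}"
            by (intro holomorphic_intros) auto
          show "(\<lambda>u. c + inverse u) ` (ball 0 (inverse r) - {0}) \<subseteq> - K'"
          proof
            fix y assume "y \<in> (\<lambda>u. c + inverse u) ` (ball 0 (inverse r) - {0})"
            then obtain u where "u \<in> ball 0 (inverse r) - {0}" and y: "y = c + inverse u" by blast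
            then have u: "u \<noteq> 0" "norm u < inverse r" by simp_all
            then have "r < norm (inverse u)"
              using less_imp_inverse_less[OF u(2)] by (simp add: norm_inverse)
            then have "y \<notin> cball c r" by (simp add: y dist_norm)
            then show "y \<in> - K'" using r(2) by blast
          qed
        qed
        then show ?thesis
          by (rule holomorphic_transform) (simp add: H_def)
      qed
      \<comment> \<open>The power series gives holomorphy at 0, the point at infinity in the
        original variable; the continuation \<open>F\<close> gives it on the rest of the
        disc.\<close>
      then have "H holomorphic_on (ball 0 (inverse r) - {0}) \<union> S"
        using S by (intro holomorphic_on_Un) auto
      then have hol: "H holomorphic_on ball 0 (inverse r)"
        by (rule holomorphic_on_subset) (use S(2) in auto)
      have s0: "0 < s" using r(1) s(2) by simp
      have "complex_of_real (inverse s) \<in> ball 0 (inverse r)"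
        using r(1) s(2) by (simp add: norm_inverse)
      from holomorphic_power_series[OF hol this]
      have "summable (\<lambda>n. fps_nth A n * complex_of_real (inverse s) ^ n)"
        by (simp add: fps_nth_fps_expansion[OF exp] sums_iff)
      then have "summable (\<lambda>n. fps_nth A (Suc n) * complex_of_real (inverse s) ^ Suc n)"
        by (subst summable_Suc_iff)
      then have "(\<lambda>n. norm (\<alpha> n * complex_of_real (inverse s) ^ Suc n)) \<longlonglongrightarrow> 0"
        by (intro tendsto_norm_zero summable_LIMSEQ_zero) (simp add: A_def)
      \<comment> \<open>The threshold \<open>inverse s\<close> absorbs the shift of index: the term
        carries \<open>inverse s ^ Suc n\<close>, while the growth is compared with
        \<open>s ^ n\<close>.\<close>
      then have "\<forall>\<^sub>F n in sequentially. norm (\<alpha> n * complex_of_real (inverse s) ^ Suc n) < inverse s"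
        using s0 by (intro order_tendstoD) auto
      then obtain N where N: "\<And>n. N \<le> n \<Longrightarrow> norm (\<alpha> n * complex_of_real (inverse s) ^ Suc n) < inverse s"
        by (auto simp: eventually_sequentially)
      obtain n where n: "N \<le> n" "s ^ n < norm (\<alpha> n)"
        using growth[OF c s(1) s0 a s(3), of N] unfolding \<alpha>_def by blast
      have "norm (\<alpha> n * complex_of_real (inverse s) ^ Suc n) = norm (\<alpha> n) / s ^ n * inverse s"
        using s0 by (simp add: norm_mult norm_power norm_inverse power_inverse divide_inverse)
      moreover have "1 < norm (\<alpha> n) / s ^ n"
        using n(2) s0 by simp
      then have "1 * inverse s < norm (\<alpha> n) / s ^ n * inverse s"
        using s0 by (intro mult_strict_right_mono) simp_all
      ultimately show False
        using N[OF n(1)] by linarith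
    qed
  qed
qed

section \<open>Countably many targets, and assembly of the proof\<close>

text \<open>Supplies countably many targets when \<open>D\<close> is countable. The coefficients are
  replaced one at a time along Horner's scheme.\<close>

lemma poly_dense:
  fixes D :: "complex set"
  assumes D: "\<And>X :: complex set. open X \<Longrightarrow> X \<noteq> {} \<Longrightarrow> \<exists>d\<in>D. d \<in> X" and e: "0 < e" and B: "0 \<le> B"
  shows "\<exists>q\<in>Poly ` lists D. \<forall>z\<in>cball 0 B. norm (poly q z - poly p z) < e"
  using e
proof (induction p arbitrary: e)
  case 0
  have "0 \<in> Poly ` lists D" by (rule image_eqI[of _ _ "[]"]) auto
  then show ?case using 0 by (intro bexI[of _ 0]) auto
next
  case (pCons a p)
  obtain a' where a': "a' \<in> D" "a' \<in> ball a (e / 2)"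
    using D[of "ball a (e / 2)"] pCons.prems by auto
  \<comment> \<open>Half the tolerance goes to the constant coefficient; the rest is multiplied by
    \<open>z\<close> with \<open>norm z \<le> B\<close>, hence the division by \<open>B + 1\<close>,
    which is positive even for \<open>B = 0\<close>.\<close>
  have "0 < e / 2 / (B + 1)" using pCons.prems B by simp
  from pCons.IH[OF this] obtain xs where xs: "xs \<in> lists D"
    and q: "\<forall>z\<in>cball 0 B. norm (poly (Poly xs) z - poly p z) < e / 2 / (B + 1)"
    by blast
  show ?case
  proof (intro bexI ballI)
    show "Poly (a' # xs) \<in> Poly ` lists D" using a'(1) xs by (intro imageI) simp
    fix z :: complex assume z: "z \<in> cball 0 B"
    have "norm (z * (poly (Poly xs) z - poly p z)) \<le> B * (e / 2 / (B + 1))"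
      unfolding norm_mult using z bspec[OF q z] B by (intro mult_mono) auto
    also have "\<dots> \<le> (B + 1) * (e / 2 / (B + 1))"
      using \<open>0 < e / 2 / (B + 1)\<close> by (intro mult_right_mono) auto
    also have "\<dots> = e / 2"
      by (rule trans[OF times_divide_eq_right nonzero_mult_div_cancel_left]) (use B in linarith)
    finally have 1: "norm (z * (poly (Poly xs) z - poly p z)) \<le> e / 2" .
    have 2: "norm (a' - a) < e / 2" using a'(2) by (simp add: dist_norm norm_minus_commute)
    have split: "poly (Poly (a' # xs)) z - poly (pCons a p) z = (a' - a) + z * (poly (Poly xs) z - poly p z)"
      by (simp add: algebra_simps)
    show "norm (poly (Poly (a' # xs)) z - poly (pCons a p) z) < e"
      unfolding split
      using norm_triangle_ineq[of "a' - a" "z * (poly (Poly xs) z - poly p z)"] 1 2 by linarith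
  qed
qed

lemma entire_approx_poly:
  assumes g: "g \<in> entire" and e: "0 < e"
  shows "\<exists>p. \<forall>z\<in>cball 0 B. norm (poly p z - g z) < e"
proof -
  define a where "a = (\<lambda>n. (deriv ^^ n) g 0 / fact n)"
  have ser: "(\<lambda>n. a n * z ^ n) sums g z" for z
    using holomorphic_power_series[of g 0 "norm z + 1" z] g
    by (auto simp: entire_def a_def intro: holomorphic_on_subset)
  then have "conv_radius a = \<infinity>"
    by (intro conv_radius_inftyI'') (auto simp: sums_iff)
  then have "uniform_limit (cball 0 B) (\<lambda>n z. \<Sum>i<n. a i * (z - 0) ^ i) (\<lambda>z. \<Sum>i. a i * (z - 0) ^ i) sequentially"
    by (intro powser_uniform_limit) simp
  then obtain n where n: "\<forall>z\<in>cball 0 B. dist (\<Sum>i<n. a i * (z - 0) ^ i) (\<Sum>i. a i * (z - 0) ^ i) < e"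
    using eventually_happens'[OF sequentially_bot uniform_limitD[OF _ e]] by blast
  define p where "p = (\<Sum>i<n. monom (a i) i)"
  have "norm (poly p z - g z) < e" if "z \<in> cball 0 B" for z
  proof -
    have "poly p z = (\<Sum>i<n. a i * (z - 0) ^ i)" by (simp add: p_def poly_sum poly_monom)
    moreover have "g z = (\<Sum>i. a i * (z - 0) ^ i)" using ser[of z] by (simp add: sums_iff)
    ultimately show ?thesis using bspec[OF n that] by (simp add: dist_norm)
  qed
  then show ?thesis by blast
qed

theorem theorem1p1:
  fixes \<phi> :: "complex \<Rightarrow> complex" and K :: "complex set"
  assumes "exponential_type \<phi>"
    and "\<not> \<phi> constant_on UNIV"
    and "compact K" and "convex K"
    and "K \<inter> {z. norm (\<phi> z) = 1} \<noteq> {}"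
  shows "\<exists>f \<in> hypercyclic_vectors (diff_op \<phi>) entire_topology.
           exponential_type f \<and> conj_indicator_diagram f = K"
proof -
  have \<phi>: "\<phi> \<in> entire" "\<not> \<phi> constant_on UNIV"
    using assms(1,2) by (auto simp: exponential_type_def)
  obtain w where w: "w \<in> K" "norm (\<phi> w) = 1"
    using assms(5) by auto
  obtain R0 where R0: "0 < R0" "K \<subseteq> ball w R0"
    using bounded_subset_ballD[OF compact_imp_bounded[OF assms(3)]] by blast
  \<comment> \<open>The unit margin around \<open>K\<close> makes \<open>away K 1\<close> contain
    the circle.\<close>
  define R where "R = R0 + 1"
  have R: "0 < R" and KR: "K \<subseteq> cball w (R - 1)"
    using R0 ball_subset_cball[of w R0] by (auto simp: R_def)
  obtain D :: "complex set" where "countable D" and D: "\<And>X. open X \<Longrightarrow> X \<noteq> {} \<Longrightarrow> \<exists>d\<in>D. d \<in> X"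
    by (rule countable_dense_setE) blast
  \<comment> \<open>Restricting to polynomials over \<open>D\<close>, integer radii and tolerances
    \<open>1 / (j + 1)\<close> leaves countably many requirements, still enough to test density of
    the orbit.\<close>
  define orbit :: "complex poly \<Rightarrow> nat \<Rightarrow> nat \<Rightarrow> (complex \<Rightarrow> complex) \<Rightarrow> bool" where
    "orbit = (\<lambda>p B j G. \<exists>n. \<forall>z\<in>cball 0 (real B).
       norm (exp_transform w R (\<lambda>\<xi>. \<phi> \<xi> ^ n * G \<xi>) z - poly p z * exp (w * z)) < inverse (Suc j))"
  define growth where
    "growth = (\<lambda>c r N G. \<exists>n\<ge>N. r ^ n < norm (cint w R (\<lambda>\<zeta>. (\<zeta> - c) ^ n * G \<zeta>)))"
  define \<P> where "\<P> = (\<lambda>(p, B, j). orbit p B j) ` (Poly ` lists D \<times> UNIV \<times> UNIV) \<union>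
    (\<lambda>(c, r, N). growth c r N) ` {(c, r, N) \<in> D \<times> \<rat> \<times> UNIV. 0 < r \<and> (\<exists>\<mu>\<in>K. r < dist c \<mu>)}"
  have count: "countable \<P>"
  proof -
    have "countable (Poly ` lists D \<times> (UNIV :: nat set) \<times> (UNIV :: nat set))"
      using \<open>countable D\<close> by (intro countable_SIGMA countable_image countable_lists) auto
    moreover have "countable (D \<times> (\<rat> :: real set) \<times> (UNIV :: nat set))"
      using \<open>countable D\<close> by (intro countable_SIGMA countable_rat) auto
    then have "countable {(c, r, N) \<in> D \<times> (\<rat> :: real set) \<times> (UNIV :: nat set). 0 < r \<and> (\<exists>\<mu>\<in>K. r < dist c \<mu>)}"
      by (rule countable_subset[rotated]) auto
    ultimately show ?thesis
      unfolding \<P>_def by (intro countable_Un countable_image)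
  qed
  have dense: "\<exists>F'\<in>princ w. \<exists>e'>0. (\<forall>\<xi>\<in>away K \<delta>. norm (F' \<xi> - F \<xi>) < e) \<and>
      (\<forall>G. princ_limit w K G \<longrightarrow> (\<forall>\<xi>\<in>away K 1. norm (G \<xi> - F' \<xi>) \<le> e') \<longrightarrow> P G)"
    if P: "P \<in> \<P>" and F: "F \<in> princ w" "0 < \<delta>" "0 < e" for P F \<delta> e
  proof -
    consider p B j where "P = orbit p B j" | c r N \<mu> where "P = growth c r N" "0 < r" "\<mu> \<in> K" "r < dist c \<mu>"
      using P unfolding \<P>_def by auto
    then show ?thesis
    proof cases
      case 1
      show ?thesis
        unfolding 1 orbit_def
        using orbit_requirement_dense[OF \<phi> w(2) R assms(3) KR w(1) F, of "inverse (real (Suc j))" "real B" p]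
        by simp
    next
      case 2
      show ?thesis
        unfolding 2(1) growth_def
        using growth_requirement_dense[OF R assms(3,4) KR w(1) 2(3,4,2) F, of N] .
    qed
  qed
  have "\<exists>G. princ_limit w K G \<and> (\<forall>P\<in>\<P>. P G)"
    by (rule generic_princ_limit[OF count]) (rule dense)
  then obtain G where G: "princ_limit w K G" and GP: "\<forall>P\<in>\<P>. P G"
    by (elim exE conjE)
  have Gc: "continuous_on (sphere w R) G"
    using assms(3) KR w(1) G by (rule princ_limit_continuous_on_sphere)
  have "\<exists>n. (diff_op \<phi> ^^ n) (exp_transform w R G) \<in> entire_nbhd g C e"
    if g: "g \<in> entire" and C: "compact C" and e: "0 < e" for g C e
  proof -
    obtain B0 where B0: "C \<subseteq> ball 0 B0"
      using bounded_subset_ballD[OF compact_imp_bounded[OF C]] by blast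
    obtain B :: nat where "B0 \<le> real B" using real_arch_simple by blast
    then have CB: "C \<subseteq> cball 0 (real B)" using B0 by force
    define E where "E = exp (norm w * real B)"
    have E: "0 < E" by (simp add: E_def)
    \<comment> \<open>Dividing by \<open>exp (w * z)\<close> reduces the approximation of
      \<open>g\<close> to that of an entire function by polynomials; \<open>E\<close> bounds the
      factor put back.\<close>
    have "(\<lambda>z. g z * exp (- (w * z))) \<in> entire"
      using g unfolding entire_def mem_Collect_eq by (intro holomorphic_intros)
    moreover have e3: "0 < e / 3 / E" using e E by simp
    ultimately obtain p where p: "\<forall>z\<in>cball 0 (real B). norm (poly p z - g z * exp (- (w * z))) < e / 3 / E"
      using entire_approx_poly by blast
    obtain q where q: "q \<in> Poly ` lists D" "\<forall>z\<in>cball 0 (real B). norm (poly q z - poly p z) < e / 3 / E"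
      using poly_dense[OF D e3, of "real B" p] by auto
    obtain j where j: "inverse (real (Suc j)) < e / 3"
      using reals_Archimedean[of "e / 3"] e by auto
    have "orbit q B j \<in> \<P>" unfolding \<P>_def
      using q(1) by (intro UnI1 image_eqI[of _ _ "(q, B, j)"]) simp_all
    then have "orbit q B j G" by (rule bspec[OF GP])
    then obtain n where n: "\<forall>z\<in>cball 0 (real B). norm (exp_transform w R (\<lambda>\<xi>. \<phi> \<xi> ^ n * G \<xi>) z - poly q z * exp (w * z)) < inverse (Suc j)"
      unfolding orbit_def ..
    have orbit: "(diff_op \<phi> ^^ n) (exp_transform w R G) = exp_transform w R (\<lambda>\<xi>. \<phi> \<xi> ^ n * G \<xi>)"
      by (rule diff_op_funpow_exp_transform[OF \<phi>(1) R Gc])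
    have "dist ((diff_op \<phi> ^^ n) (exp_transform w R G) z) (g z) < e" if z: "z \<in> C" for z
    proof -
      have zB: "z \<in> cball 0 (real B)" using z CB by blast
      have "norm (exp (w * z)) \<le> E"
      proof -
        have "norm (w * z) \<le> norm w * real B" unfolding norm_mult using zB by (intro mult_left_mono) auto
        then have "exp (norm (w * z)) \<le> E" unfolding E_def by (rule iffD2[OF exp_le_cancel_iff])
        then show ?thesis by (rule order_trans[OF norm_exp])
      qed
      have scale: "norm (x * exp (w * z)) < e / 3" if "norm x < e / 3 / E" for x
      proof -
        have "norm (x * exp (w * z)) \<le> norm x * E"
          unfolding norm_mult using \<open>norm (exp (w * z)) \<le> E\<close> by (intro mult_left_mono) auto
        also have "\<dots> < e / 3" using that E by (simp add: pos_less_divide_eq)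
        finally show ?thesis .
      qed
      \<comment> \<open>Three errors of at most \<open>e / 3\<close> each: the orbit against its
        target, \<open>q\<close> against \<open>p\<close>, and \<open>p * exp (w * z)\<close>
        against \<open>g\<close>.\<close>
      define x where "x = exp_transform w R (\<lambda>\<xi>. \<phi> \<xi> ^ n * G \<xi>) z - poly q z * exp (w * z)"
      define y where "y = (poly q z - poly p z) * exp (w * z)"
      define v where "v = (poly p z - g z * exp (- (w * z))) * exp (w * z)"
      have "norm x < e / 3"
        unfolding x_def using bspec[OF n zB] j by linarith
      moreover have "norm y < e / 3"
        unfolding y_def using bspec[OF q(2) zB] by (rule scale)
      moreover have "norm v < e / 3"
        unfolding v_def using bspec[OF p zB] by (rule scale)
      ultimately have "norm (x + y + v) < e"
        using norm_triangle_ineq[of "x + y" v] norm_triangle_ineq[of x y] by linarith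
      moreover have "exp_transform w R (\<lambda>\<xi>. \<phi> \<xi> ^ n * G \<xi>) z - g z = x + y + v"
        by (simp add: x_def y_def v_def algebra_simps flip: exp_add)
      ultimately show ?thesis
        unfolding orbit dist_norm by simp
    qed
    moreover have "(diff_op \<phi> ^^ n) (exp_transform w R G) \<in> entire"
      unfolding orbit by (intro exp_transform_entire R continuous_intros entire_continuous_on \<phi> Gc)
    ultimately show ?thesis unfolding entire_nbhd_def by blast
  qed
  then have "exp_transform w R G \<in> hypercyclic_vectors (diff_op \<phi>) entire_topology"
    using exp_transform_entire[OF R Gc] by (simp add: hypercyclic_vectors_entire_iff)
  moreover have "exponential_type (exp_transform w R G)"
    by (rule exponential_type_exp_transform[OF R Gc])
  moreover have "conj_indicator_diagram (exp_transform w R G) = K"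
  proof (rule conj_indicator_diagram_exp_transform[OF assms(3,4) KR w(1) G R D])
    show "\<exists>n\<ge>N. r ^ n < norm (cint w R (\<lambda>\<zeta>. (\<zeta> - c) ^ n * G \<zeta>))"
      if "c \<in> D" "r \<in> \<rat>" "0 < r" "\<mu> \<in> K" "r < dist c \<mu>" for c r N \<mu>
    proof -
      have "growth c r N \<in> \<P>"
        unfolding \<P>_def using that by (intro UnI2 image_eqI[of _ _ "(c, r, N)"]) auto
      then have "growth c r N G" by (rule bspec[OF GP])
      then show ?thesis by (simp only: growth_def)
    qed
  qed
  ultimately show ?thesis by blast
qed

end
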